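(* Let $s\in(0,1)$, let $\Omega$ be a smooth bounded domain of $\mathbb{R}^n$, and let $W:\mathbb{R}\to[0,+\infty)$ be an even function of class $C^2$ with $W(\pm1)=0$, $W>0$ in $(-1,1)$, $W'(\pm1)=0$ and $W''(\pm1)>0$. Let $F_\epsilon$ be the fractional Allen-Cahn energy on $H^s(\Omega)$ defined in the context. Then there exist two sequences of positive numbers $(\epsilon_k)_k$, $(c_k)_k$ such that, for every positive integer $k$ and every $\epsilon\in(0,\epsilon_k)$, the functional $F_\epsilon$ has at least $k$ pairs $$(-u_{1,\epsilon},u_{1,\epsilon}),\dots,(-u_{k,\epsilon},u_{k,\epsilon})$$ of critical points, all of them different from the constant pair $(-1,1)$, satisfying $$-1\le u_{i,\epsilon}(x)\le 1\quad\forall x\in\Omega,\ \forall\epsilon\in(0,\epsilon_k),\ i=1,\dots,k,$$ $$F_\epsilon(u_{i,\epsilon})\le c_k\quad\forall\epsilon\in(0,\epsilon_k),\ i=1,\dots,k.$$ Moreover, for all $\epsilon\in(0,\epsilon_k)$ and all $i=1,\dots,k$, $$F_\epsilon(u_{i,\epsilon})\ge\min\Big\{F_\epsilon(u): u\in H^s(\Omega),\ -1\le u(x)\le1\text{ for }x\in\Omega,\ \int_\Omega u\,dx=0\Big\}.$$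
   Context: $H^s(\Omega)=W^{s,2}(\Omega)$ is the real fractional Sobolev space of $u\in L^2(\Omega)$ with $\int_\Omega\int_\Omega\frac{|u(x)-u(y)|^2}{|x-y|^{n+2s}}\,dx\,dy<\infty$; pointwise inequalities for its elements are understood almost everywhere. For $\epsilon>0$ (with $\epsilon\ne1$ if $s=1/2$) and $u\in H^s(\Omega)$, the functional $F_\epsilon$ is defined by $$F_\epsilon(u)=\int_\Omega\int_\Omega\frac{|u(x)-u(y)|^2}{|x-y|^{n+2s}}\,dx\,dy+\frac1{\epsilon^{2s}}\int_\Omega W(u)\,dx\quad\text{if }s\in(0,1/2),$$ $$F_\epsilon(u)=\frac1{|\log\epsilon|}\int_\Omega\int_\Omega\frac{|u(x)-u(y)|^2}{|x-y|^{n+1}}\,dx\,dy+\frac1{|\epsilon\log\epsilon|}\int_\Omega W(u)\,dx\quad\text{if }s=1/2,$$ $$F_\epsilon(u)=\frac{\epsilon^{2s-1}}2\int_\Omega\int_\Omega\frac{|u(x)-u(y)|^2}{|x-y|^{n+2s}}\,dx\,dy+\frac1\epsilon\int_\Omega W(u)\,dx\quad\text{if }s\in(1/2,1).$$ Writing $F_\epsilon(u)=A_\epsilon\int_\Omega\int_\Omega\frac{|u(x)-u(y)|^2}{|x-y|^{n+2s}}\,dx\,dy+B_\epsilon\int_\Omega W(u)\,dx$ with the corresponding coefficients $A_\epsilon,B_\epsilon$, a function $u\in H^s(\Omega)$ with $|u|\le1$ is a critical point of $F_\epsilon$ if for all $v\in H^s(\Omega)$ $$F_\epsilon'(u)(v)=2A_\epsilon\int_\Omega\int_\Omega\frac{(u(x)-u(y))(v(x)-v(y))}{|x-y|^{n+2s}}\,dx\,dy+B_\epsilon\int_\Omega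 W'(u)v\,dx=0.$$ *)

theory Defs
  imports "HOL-Analysis.Analysis"
begin

fun C_k :: "nat \<Rightarrow> ('a::euclidean_space \<Rightarrow> real) \<Rightarrow> bool" where
  "C_k 0 f \<longleftrightarrow> continuous_on UNIV f"
| "C_k (Suc k) f \<longleftrightarrow>
     (\<forall>x. f differentiable (at x)) \<and> (\<forall>b\<in>Basis. C_k k (\<lambda>x. frechet_derivative f (at x) b))"

text \<open>Near each boundary point, in suitable orthonormal coordinates with last axis \<open>e\<close>, the set is
  the strict supergraph of a smooth function of the other coordinates.  A smooth function on the
  hyperplane orthogonal to \<open>e\<close> is represented by a smooth function \<open>g\<close> on the whole space, of which
  only the values on that hyperplane are used.\<close>

definition smooth_boundary :: "'a::euclidean_space set \<Rightarrow> bool" where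
  "smooth_boundary \<Omega> \<longleftrightarrow>
     (\<forall>p\<in>frontier \<Omega>. \<exists>r>0. \<exists>e g. norm e = 1 \<and> (\<forall>k. C_k k g) \<and>
        \<Omega> \<inter> ball p r = {x \<in> ball p r. g (x - (x \<bullet> e) *\<^sub>R e) < x \<bullet> e})"

definition smooth_bounded_domain :: "'a::euclidean_space set \<Rightarrow> bool" where
  "smooth_bounded_domain \<Omega> \<longleftrightarrow>
     open \<Omega> \<and> connected \<Omega> \<and> \<Omega> \<noteq> {} \<and> bounded \<Omega> \<and> smooth_boundary \<Omega>"

text \<open>Elements of \<open>L\<^sup>2\<close> and \<open>H\<^sup>s\<close> are represented by Borel functions on the domain, identified when
  they agree almost everywhere; every class of Lebesgue measurable functions has such a
  representative.\<close>

abbreviation dom_measure :: "'a::euclidean_space set \<Rightarrow> 'a measure" where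
  "dom_measure \<Omega> \<equiv> restrict_space lborel \<Omega>"

definition frac_kernel :: "real \<Rightarrow> 'a::euclidean_space \<Rightarrow> 'a \<Rightarrow> real" where
  "frac_kernel s x y = 1 / norm (x - y) powr (real DIM('a) + 2 * s)"

definition frac_seminorm_sq :: "real \<Rightarrow> 'a::euclidean_space set \<Rightarrow> ('a \<Rightarrow> real) \<Rightarrow> ennreal" where
  "frac_seminorm_sq s \<Omega> u =
     (\<integral>\<^sup>+(x, y). ennreal (\<bar>u x - u y\<bar>\<^sup>2 * frac_kernel s x y) \<partial>(dom_measure \<Omega> \<Otimes>\<^sub>M dom_measure \<Omega>))"

definition frac_form ::
  "real \<Rightarrow> 'a::euclidean_space set \<Rightarrow> ('a \<Rightarrow> real) \<Rightarrow> ('a \<Rightarrow> real) \<Rightarrow> real" where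
  "frac_form s \<Omega> u v =
     (\<integral>(x, y). (u x - u y) * (v x - v y) * frac_kernel s x y
        \<partial>(dom_measure \<Omega> \<Otimes>\<^sub>M dom_measure \<Omega>))"

definition H_space :: "real \<Rightarrow> 'a::euclidean_space set \<Rightarrow> ('a \<Rightarrow> real) set" where
  "H_space s \<Omega> = {u. u \<in> borel_measurable (dom_measure \<Omega>) \<and>
     integrable (dom_measure \<Omega>) (\<lambda>x. (u x)\<^sup>2) \<and> frac_seminorm_sq s \<Omega> u < \<infinity>}"

definition coeff_A :: "real \<Rightarrow> real \<Rightarrow> real" where
  "coeff_A s \<epsilon> =
     (if s < 1/2 then 1
      else if s = 1/2 then 1 / \<bar>ln \<epsilon>\<bar>
      else \<epsilon> powr (2 * s - 1) / 2)"

definition coeff_B :: "real \<Rightarrow> real \<Rightarrow> real" where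
  "coeff_B s \<epsilon> =
     (if s < 1/2 then 1 / \<epsilon> powr (2 * s)
      else if s = 1/2 then 1 / \<bar>\<epsilon> * ln \<epsilon>\<bar>
      else 1 / \<epsilon>)"

text \<open>Extended-valued, since the potential term may be infinite for an unbounded function in
  \<open>H\<^sup>s\<close>.  For \<open>s = 1/2\<close> it is meaningful only when \<open>\<epsilon> \<noteq> 1\<close>.\<close>

definition energy ::
  "real \<Rightarrow> (real \<Rightarrow> real) \<Rightarrow> 'a::euclidean_space set \<Rightarrow> real \<Rightarrow> ('a \<Rightarrow> real) \<Rightarrow> ennreal" where
  "energy s W \<Omega> \<epsilon> u =
     ennreal (coeff_A s \<epsilon>) * frac_seminorm_sq s \<Omega> u +
     ennreal (coeff_B s \<epsilon>) * (\<integral>\<^sup>+x. ennreal (W (u x)) \<partial>dom_measure \<Omega>)"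

definition critical_point ::
  "real \<Rightarrow> (real \<Rightarrow> real) \<Rightarrow> 'a::euclidean_space set \<Rightarrow> real \<Rightarrow> ('a \<Rightarrow> real) \<Rightarrow> bool" where
  "critical_point s W \<Omega> \<epsilon> u \<longleftrightarrow>
     u \<in> H_space s \<Omega> \<and> (AE x in dom_measure \<Omega>. \<bar>u x\<bar> \<le> 1) \<and>
     (\<forall>v\<in>H_space s \<Omega>.
        2 * coeff_A s \<epsilon> * frac_form s \<Omega> u v +
        coeff_B s \<epsilon> * (\<integral>x. deriv W (u x) * v x \<partial>dom_measure \<Omega>) = 0)"

definition ae_eq :: "'a::euclidean_space set \<Rightarrow> ('a \<Rightarrow> real) \<Rightarrow> ('a \<Rightarrow> real) \<Rightarrow> bool" where
  "ae_eq \<Omega> u v \<longleftrightarrow> (AE x in dom_measure \<Omega>. u x = v x)"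

definition zero_mean_class :: "real \<Rightarrow> 'a::euclidean_space set \<Rightarrow> ('a \<Rightarrow> real) set" where
  "zero_mean_class s \<Omega> = {u \<in> H_space s \<Omega>.
     (AE x in dom_measure \<Omega>. -1 \<le> u x \<and> u x \<le> 1) \<and> (\<integral>x. u x \<partial>dom_measure \<Omega>) = 0}"

end

theory Submission
  imports Defs "HOL-Complex_Analysis.Great_Picard" "HOL-Library.Multiset" "HOL-Library.Sublist"
begin

text \<open>
  The energy is a convex quadratic form plus a potential that becomes convex when a multiple of the
  square is added.  For a large constant \<open>\<tau>\<close> the functional \<open>E v + \<tau> \<integral>(v - u)\<^sup>2\<close> is
  therefore strongly convex in \<open>v\<close>; let \<open>T u\<close> be its minimizer among the functions with values in
  \<open>[-1,1]\<close> and \<open>\<Phi> u\<close> its minimum.  Since the derivative of the potential vanishes at \<open>-1\<close> and \<open>1\<close>,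
  the constraint on the values exerts no force, and the fixed points of \<open>T\<close> are critical points of the
  energy (\<open>fixed_point_critical\<close>).  The map \<open>T\<close> is odd, both \<open>T\<close> and \<open>\<Phi>\<close> are continuous for the
  mean distance although \<open>E\<close> is only lower semicontinuous, and \<open>\<Phi>\<close> decreases strictly along the
  iterates of \<open>T\<close> away from fixed points.  Sublevel sets of \<open>E\<close> are compact for the mean distance
  (\<open>fractional_rellich\<close>), so iterating \<open>T\<close> can replace the gradient flow in the argument of
  Lusternik and Schnirelmann.

  That argument measures a symmetric set by the least number of antipodal pairs \<open>D\<close>, \<open>-D\<close> that cover
  it, where each \<open>D\<close> has a positive distance from \<open>-D\<close>.  Let \<open>m\<close> be the minimum of the energy over
  the functions of zero mean.  Where \<open>\<Phi> u < m\<close>, the mean of \<open>T u\<close> is not zero and its sign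
  separates antipodes, so one pair suffices there; each level of fixed points at or above \<open>m\<close> costs one
  more pair (\<open>antipodal_cover_levels\<close>).  If a sublevel set cannot be covered by \<open>k\<close> pairs, it thus
  contains \<open>k\<close> pairs of fixed points with energy at least \<open>m\<close> (\<open>many_fixed_points\<close>).

  The sublevel set in question contains an odd family of functions of one coordinate that are
  \<open>1\<close> or \<open>-1\<close> except in at most \<open>k\<close> transition layers of width comparable to \<open>\<epsilon>\<close>.
  Their energy is at most \<open>k\<close> times a constant that does not depend on \<open>\<epsilon>\<close>
  (\<open>test_fun_energy\<close>).  The family is a \<open>k\<close>-dimensional sphere, and a covering of it by \<open>k\<close> antipodal
  pairs contradicts the Borsuk-Ulam theorem.  The combinatorial form of that theorem which is used is
  Fan's lemma on alternating labels (\<open>hemisphere_alternating\<close>), proved here for chains of profiles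
  whose kinks lie on a fine grid.

  The function \<open>0\<close> has energy proportional to the coefficient of the potential, which is unbounded as
  \<open>\<epsilon>\<close> tends to \<open>0\<close>; for small \<open>\<epsilon>\<close> it is outside the sublevel set.  The constants \<open>1\<close> and
  \<open>-1\<close> have energy \<open>0\<close>, which is less than \<open>m\<close>.
\<close>

section \<open>Fan's lemma for swept hemispheres\<close>

text \<open>A simplex is the list of its vertices and a chain modulo 2 is a list of simplices.  The empty list is
  kept as the face of a vertex, so the complex is augmented.\<close>

fun faces :: "'v list \<Rightarrow> 'v list list" where
  "faces [] = []"
| "faces (x # xs) = xs # map ((#) x) (faces xs)"

text \<open>The standard triangulation of the prism over a simplex, with bottom mapped by \<open>p\<close> and top by \<open>q\<close>.\<close>

fun prism :: "('v \<Rightarrow> 'v) \<Rightarrow> ('v \<Rightarrow> 'v) \<Rightarrow> 'v list \<Rightarrow> 'v list list" where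
  "prism p q [] = []"
| "prism p q (x # xs) = (p x # q x # map q xs) # map ((#) (p x)) (prism p q xs)"

text \<open>Chains modulo 2 are compared by the parities of the numbers of their simplices with a given property;
  two chains are equal modulo 2 when these parities agree for all properties.\<close>

definition odd_in :: "('v list \<Rightarrow> bool) \<Rightarrow> 'v list list \<Rightarrow> bool" where
  "odd_in f C \<longleftrightarrow> odd (length (filter f C))"

lemma odd_in_simps [simp]:
  "odd_in f [] = False"
  "odd_in f (x # C) = (f x \<noteq> odd_in f C)"
  "odd_in f (C @ D) = (odd_in f C \<noteq> odd_in f D)"
  by (auto simp: odd_in_def)

lemma odd_in_map [simp]: "odd_in f (map g C) = odd_in (\<lambda>x. f (g x)) C"
  by (simp add: odd_in_def filter_map o_def)

lemma odd_in_concat: "odd_in f (concat (map g C)) = odd_in (\<lambda>\<sigma>. odd_in f (g \<sigma>)) C"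
  by (induction C) auto

lemma odd_in_xor: "odd_in (\<lambda>\<sigma>. f \<sigma> = (\<not> g \<sigma>)) C = (odd_in f C = (\<not> odd_in g C))"
  by (induction C) auto

lemma odd_in_cong: "(\<And>\<sigma>. \<sigma> \<in> set C \<Longrightarrow> f \<sigma> = g \<sigma>) \<Longrightarrow> odd_in f C = odd_in g C"
  by (induction C) auto

lemma odd_in_False: "(\<And>\<sigma>. \<sigma> \<in> set C \<Longrightarrow> \<not> f \<sigma>) \<Longrightarrow> \<not> odd_in f C"
  by (induction C) auto

lemma faces_map: "faces (map g xs) = map (map g) (faces xs)"
  by (induction xs) (simp_all)

text \<open>The prism is a chain homotopy from \<open>p\<close> to \<open>q\<close>: the boundary of the prism and the prism over the
  boundary differ by top and bottom.  By induction on the list: the simplices that arise by removing one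
  of the two copies of the vertex where the prism changes from \<open>p\<close> to \<open>q\<close> cancel in pairs.\<close>

lemma prism_homotopy:
  "(odd_in (\<lambda>\<rho>. odd_in f (faces \<rho>)) (prism p q \<sigma>) \<noteq> odd_in (\<lambda>\<rho>. odd_in f (prism p q \<rho>)) (faces \<sigma>))
     = (f (map p \<sigma>) \<noteq> f (map q \<sigma>))"
proof (induction \<sigma> arbitrary: f)
  case Nil
  then show ?case by simp
next
  case (Cons x \<sigma>)
  show ?case
    using Cons.IH[of "\<lambda>\<rho>. f (p x # \<rho>)"]
    by (simp add: faces_map odd_in_xor) blast
qed

text \<open>The prisms between consecutive maps of a sequence \<open>Q\<close>, glued to one homotopy from \<open>Q 0\<close> to \<open>Q N\<close>.\<close>

definition sweep :: "nat \<Rightarrow> (nat \<Rightarrow> 'v \<Rightarrow> 'v) \<Rightarrow> 'v list \<Rightarrow> 'v list list" where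
  "sweep N Q \<sigma> = concat (map (\<lambda>j. prism (Q j) (Q (Suc j)) \<sigma>) [0..<N])"

lemma sweep_homotopy:
  "(odd_in (\<lambda>\<rho>. odd_in f (faces \<rho>)) (sweep N Q \<sigma>) \<noteq> odd_in (\<lambda>\<rho>. odd_in f (sweep N Q \<rho>)) (faces \<sigma>))
     = (f (map (Q 0) \<sigma>) \<noteq> f (map (Q N) \<sigma>))"
proof (induction N)
  case 0
  then show ?case by (simp add: sweep_def odd_in_False)
next
  case (Suc N)
  show ?case
    using Suc prism_homotopy[of f "Q N" "Q (Suc N)" \<sigma>]
    by (simp add: sweep_def odd_in_xor) blast
qed

text \<open>Constant simplices have to be neglected, but a prism over a constant simplex is not constant.  The
  lists with two equal neighbours are a larger class that the prism construction preserves.\<close>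

definition vanishes_on_degenerate :: "('v list \<Rightarrow> bool) \<Rightarrow> bool" where
  "vanishes_on_degenerate f \<longleftrightarrow> (\<forall>\<sigma>. \<not> distinct_adj \<sigma> \<longrightarrow> \<not> f \<sigma>)"

lemma set_prism:
  assumes "\<rho> \<in> set (prism p q \<sigma>)"
  shows "length \<rho> = Suc (length \<sigma>)" "set \<rho> \<subseteq> p ` set \<sigma> \<union> q ` set \<sigma>"
  using assms by (induction \<sigma> arbitrary: \<rho>) fastforce+

lemma prism_degenerate:
  "\<not> distinct_adj \<sigma> \<Longrightarrow> \<rho> \<in> set (prism p q \<sigma>) \<Longrightarrow> \<not> distinct_adj \<rho>"
proof (induction \<sigma> arbitrary: \<rho>)
  case Nil
  then show ?case by simp
next
  case (Cons x \<sigma>)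
  then obtain y \<tau> where \<sigma>: "\<sigma> = y # \<tau>"
    by (cases \<sigma>) auto
  show ?case
  proof (cases "x = y")
    case True
    then show ?thesis using Cons.prems \<sigma> by (auto simp: distinct_adj_Cons)
  next
    case False
    then have nd: "\<not> distinct_adj \<sigma>"
      using Cons.prems \<sigma> by simp
    then have "\<not> distinct_adj (map q \<sigma>)"
      using distinct_adj_mapD by blast
    moreover have "\<not> distinct_adj \<rho>'" if "\<rho>' \<in> set (prism p q \<sigma>)" for \<rho>'
      using Cons.IH nd that by blast
    moreover have "map q \<sigma> \<noteq> []" by (simp add: \<sigma>)
    moreover have "[] \<notin> set (prism p q \<sigma>)" using set_prism(1)[of "[]" p q \<sigma>] by auto
    ultimately show ?thesis using Cons.prems(2) 
      by (auto simp: distinct_adj_Cons simp del: list.map)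
  qed
qed

lemma vanishes_sweep:
  "vanishes_on_degenerate f \<Longrightarrow> vanishes_on_degenerate (\<lambda>\<sigma>. odd_in f (sweep N Q \<sigma>))"
  unfolding vanishes_on_degenerate_def sweep_def
  by (intro allI impI odd_in_False) (auto dest: prism_degenerate)

text \<open>The hemisphere of dimension \<open>d + 1\<close> is the sphere of dimension \<open>d\<close> (a hemisphere and its antipode)
  contracted to a point along \<open>Q\<close>.\<close>

fun hemisphere :: "nat \<Rightarrow> (nat \<Rightarrow> 'v \<Rightarrow> 'v) \<Rightarrow> ('v \<Rightarrow> 'v) \<Rightarrow> 'v \<Rightarrow> nat \<Rightarrow> 'v list list" where
  "hemisphere N Q neg pole 0 = [[pole]]"
| "hemisphere N Q neg pole (Suc d) =
     concat (map (sweep N Q) (hemisphere N Q neg pole d @ map (map neg) (hemisphere N Q neg pole d)))"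

lemma set_sweep:
  assumes "\<rho> \<in> set (sweep N Q \<sigma>)"
  obtains j where "j < N" "length \<rho> = Suc (length \<sigma>)" "set \<rho> \<subseteq> Q j ` set \<sigma> \<union> Q (Suc j) ` set \<sigma>"
  using assms set_prism unfolding sweep_def by fastforce

text \<open>The maps \<open>Q j\<close> contract the whole space: the last one is the identity and the first one is constant.\<close>

locale sweeping =
  fixes N :: nat and Q :: "nat \<Rightarrow> 'v \<Rightarrow> 'v" and neg :: "'v \<Rightarrow> 'v" and pole :: 'v
  assumes Q0: "\<And>v w. Q 0 v = Q 0 w" and QN: "\<And>v. Q N v = v" and neg_neg: "\<And>v. neg (neg v) = v"
begin

abbreviation "hemi \<equiv> hemisphere N Q neg pole"

lemma length_hemi: "\<sigma> \<in> set (hemi d) \<Longrightarrow> length \<sigma> = Suc d"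
proof (induction d arbitrary: \<sigma>)
  case (Suc d)
  have "length \<rho> = Suc (length \<tau>)" if "\<rho> \<in> set (sweep N Q \<tau>)" for \<rho> \<tau>
    using that by (rule set_sweep)
  with Suc show ?case by fastforce
qed simp

lemma map_neg_neg: "map (neg \<circ> neg) \<sigma> = \<sigma>"
  by (simp add: neg_neg comp_def)

text \<open>The boundary of a hemisphere is the sphere that was contracted.  By the homotopy formula, the other
  contributions are the constant image of the sphere, which is degenerate (in dimension \<open>0\<close>, a
  point counted twice), and the sweep over the boundary of the sphere, which is zero because both of its
  halves have the same boundary.\<close>

lemma hemi_boundary:
  assumes "vanishes_on_degenerate f"
  shows "odd_in (\<lambda>\<sigma>. odd_in f (faces \<sigma>)) (hemi (Suc d))
     = (odd_in f (hemi d) \<noteq> odd_in (\<lambda>\<sigma>. f (map neg \<sigma>)) (hemi d))"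
  using assms
proof (induction d arbitrary: f)
  case 0
  have "f [Q 0 pole] = f [Q 0 (neg pole)]" using Q0 by metis
  then show ?case using sweep_homotopy[of f N Q "[pole]"] sweep_homotopy[of f N Q "[neg pole]"]
    by (auto simp: QN sweep_def odd_in_False)
next
  case (Suc d)
  let ?S = "hemi (Suc d) @ map (map neg) (hemi (Suc d))"
  let ?g = "\<lambda>\<sigma>. odd_in f (sweep N Q \<sigma>)"
  have g: "vanishes_on_degenerate ?g" using Suc.prems by (rule vanishes_sweep)
  have gn: "vanishes_on_degenerate (\<lambda>\<sigma>. ?g (map neg \<sigma>))"
    using g unfolding vanishes_on_degenerate_def by (meson distinct_adj_mapD)
  have cyc: "\<not> odd_in (\<lambda>\<sigma>. odd_in ?g (faces \<sigma>)) ?S"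
    using Suc.IH[OF g] Suc.IH[OF gn]
    by (simp del: hemisphere.simps add: faces_map neg_neg map_neg_neg) blast
  have const: "\<not> f (map (Q 0) \<sigma>)" if "\<sigma> \<in> set ?S" for \<sigma>
  proof -
    have "length \<sigma> = Suc (Suc d)" using that length_hemi by (auto simp del: hemisphere.simps)
    then obtain x y \<tau> where "\<sigma> = x # y # \<tau>" by (metis length_Suc_conv)
    then have "\<not> distinct_adj (map (Q 0) \<sigma>)" using Q0[of x y] by simp
    then show ?thesis using Suc.prems unfolding vanishes_on_degenerate_def by blast
  qed
  have "odd_in (\<lambda>\<sigma>. odd_in f (faces \<sigma>)) (hemi (Suc (Suc d)))
      = odd_in (\<lambda>\<sigma>. odd_in (\<lambda>\<rho>. odd_in f (faces \<rho>)) (sweep N Q \<sigma>)) ?S"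
    by (subst hemisphere.simps(2)) (rule odd_in_concat)
  also have "\<dots> = odd_in (\<lambda>\<sigma>. odd_in ?g (faces \<sigma>) = (\<not> f \<sigma>)) ?S"
  proof (rule odd_in_cong)
    fix \<sigma> assume "\<sigma> \<in> set ?S"
    then have "\<not> f (map (Q 0) \<sigma>)" by (rule const)
    moreover have "map (Q N) \<sigma> = \<sigma>" by (simp add: QN map_idI)
    ultimately show "odd_in (\<lambda>\<rho>. odd_in f (faces \<rho>)) (sweep N Q \<sigma>) = (odd_in ?g (faces \<sigma>) = (\<not> f \<sigma>))"
      using sweep_homotopy[of f N Q \<sigma>] by metis
  qed
  also have "\<dots> = odd_in f ?S"
    using cyc unfolding odd_in_xor by blast
  finally show ?case by (simp del: hemisphere.simps)
qed

end

text \<open>Labels are nonzero integers.  A list alternates with first sign \<open>s\<close> when the absolute values increase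
  strictly and the signs alternate.\<close>

fun alternating :: "int \<Rightarrow> int list \<Rightarrow> bool" where
  "alternating s [] = True"
| "alternating s (x # xs) \<longleftrightarrow> sgn x = s \<and> (\<forall>y\<in>set xs. \<bar>x\<bar> < \<bar>y\<bar>) \<and> alternating (- s) xs"

definition no_complementary :: "int set \<Rightarrow> bool" where
  "no_complementary A \<longleftrightarrow> (\<forall>x\<in>A. x \<noteq> 0 \<and> - x \<notin> A)"

text \<open>Suppose that a simplex has an alternating facet with first sign \<open>s\<close>.  If the simplex itself
  alternates, removing its last vertex (for the first sign \<open>s\<close>) or its first vertex (for the opposite
  one) gives the only such facet.  Otherwise the remaining vertex has the same label as a vertex of the
  facet, or the same sign as one neighbour in the order of the labels; exchanging these two gives exactly
  one further facet of this kind.\<close>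

lemma odd_in_alternating_sorted:
  assumes "sorted (map abs ls)" "no_complementary (set ls)" "s = 1 \<or> s = -1"
  shows "odd_in (alternating s) (faces ls) = (alternating s ls \<noteq> alternating (- s) ls)"
  using assms
proof (induction ls arbitrary: s)
  case Nil
  then show ?case by simp
next
  case (Cons x xs)
  have nc: "no_complementary (set xs)" using Cons.prems unfolding no_complementary_def by auto
  have x0: "x \<noteq> 0" using Cons.prems unfolding no_complementary_def by auto
  have srt: "sorted (map abs xs)" using Cons.prems by simp
  have IH: "odd_in (alternating s) (faces xs) = (alternating s xs \<noteq> alternating (- s) xs)"
      "odd_in (alternating (-s)) (faces xs) = (alternating (-s) xs \<noteq> alternating s xs)"
    using Cons.IH[OF srt nc, of s] Cons.IH[OF srt nc, of "-s"] Cons.prems by auto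
  have sub: "set \<rho> \<subseteq> set ys" if "\<rho> \<in> set (faces ys)" for \<rho> ys :: "int list"
    using that by (induction ys arbitrary: \<rho>) fastforce+
  show ?case
  proof (cases "\<forall>y\<in>set xs. \<bar>x\<bar> < \<bar>y\<bar>")
    case True
    have "odd_in (\<lambda>\<rho>. alternating s (x # \<rho>)) (faces xs) = (sgn x = s \<and> odd_in (alternating (-s)) (faces xs))"
    proof (cases "sgn x = s")
      case True': True
      show ?thesis using True' by (simp, intro odd_in_cong) (use True sub in fastforce)
    qed (simp add: odd_in_False)
    moreover have "sgn x = s \<or> sgn x = - s" using x0 Cons.prems(3) by (auto simp: sgn_if)
    ultimately show ?thesis using IH True Cons.prems(3) by auto
  next
    case False
    then obtain y ys where xs: "xs = y # ys" by (cases xs) auto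
    from False obtain z where z: "z \<in> set xs" "\<bar>z\<bar> \<le> \<bar>x\<bar>" by force
    have "\<bar>y\<bar> \<le> \<bar>z\<bar>" using z(1) srt xs by auto
    moreover have "\<bar>x\<bar> \<le> \<bar>y\<bar>" using Cons.prems(1) xs by simp
    ultimately have "\<bar>x\<bar> = \<bar>y\<bar>" using z by linarith
    moreover have "y \<noteq> - x" using Cons.prems(2) xs unfolding no_complementary_def by auto
    ultimately have yx: "y = x" by linarith
    have "\<not> odd_in (\<lambda>\<rho>. alternating s (x # y # \<rho>)) (faces ys)"
      by (rule odd_in_False) (simp add: yx)
    then show ?thesis using False xs yx by auto
  qed
qed

text \<open>Vertices of a simplex are not listed in the order of their labels, so the alternation of a simplex is a
  property of the multiset of its labels.\<close>

definition alternating_mset :: "int \<Rightarrow> int multiset \<Rightarrow> bool" where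
  "alternating_mset s A \<longleftrightarrow> (\<exists>ls. mset ls = A \<and> alternating s ls)"

lemma alternating_sorted: "alternating s ls \<Longrightarrow> sorted (map abs ls) \<and> distinct (map abs ls)"
  by (induction s ls rule: alternating.induct) (auto simp: less_imp_le)

lemma no_complementary_inj: "no_complementary A \<Longrightarrow> inj_on abs A"
  by (auto simp: no_complementary_def inj_on_def abs_eq_iff)

text \<open>Without complementary labels, the absolute value is injective on the labels, so there is only one way to
  sort them.\<close>

lemma alternating_mset_sorted:
  assumes "sorted (map abs ls)" "no_complementary (set ls)"
  shows "alternating_mset s (mset ls) = alternating s ls"
proof
  assume "alternating_mset s (mset ls)"
  then obtain ks where ks: "mset ks = mset ls" "alternating s ks"
    unfolding alternating_mset_def by blast
  have st: "set ks = set ls" using ks(1) by (metis set_mset_mset)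
  have eq: "map abs ks = map abs ls"
  proof -
    have "mset (map abs ks) = mset (map abs ls)" using ks by simp
    moreover have "sorted (map abs ks)" using alternating_sorted ks by blast
    ultimately show ?thesis using assms(1) by (metis properties_for_sort)
  qed
  have "ks = ls"
    by (rule map_inj_on[OF eq]) (use no_complementary_inj[OF assms(2)] st in simp)
  then show "alternating s ls" using ks by simp
qed (auto simp: alternating_mset_def)

lemma mset_faces: "image_mset mset (mset (faces ls)) = image_mset (\<lambda>x. mset ls - {#x#}) (mset ls)"
proof (induction ls)
  case (Cons x xs)
  have "image_mset mset (mset (faces (x # xs))) = add_mset (mset xs) (image_mset (add_mset x) (image_mset mset (mset (faces xs))))"
    by (simp add: image_mset.compositionality comp_def)
  also have "\<dots> = add_mset (mset xs) (image_mset (\<lambda>y. add_mset x (mset xs - {#y#})) (mset xs))"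
    unfolding Cons.IH by (simp add: image_mset.compositionality comp_def)
  also have "image_mset (\<lambda>y. add_mset x (mset xs - {#y#})) (mset xs)
     = image_mset (\<lambda>y. add_mset x (mset xs) - {#y#}) (mset xs)"
    by (rule image_mset_cong) (simp add: add_mset_commute)
  finally show ?case by simp
qed simp

lemma odd_in_alternating_faces:
  assumes "no_complementary (set ls)" "s = 1 \<or> s = -1"
  shows "odd_in (\<lambda>\<rho>. alternating_mset s (mset \<rho>)) (faces ls)
     = (alternating_mset s (mset ls) \<noteq> alternating_mset (- s) (mset ls))"
proof -
  define ks where "ks = sort_key abs ls"
  have ks: "mset ks = mset ls" "set ks = set ls" "sorted (map abs ks)" "no_complementary (set ks)"
    using assms by (auto simp: ks_def)
  have faces_sorted: "alternating_mset s (mset \<rho>) = alternating s \<rho>" if "\<rho> \<in> set (faces ks)" for \<rho>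
  proof -
    have "subseq \<rho> ks" 
      using that by (induction ks arbitrary: \<rho>) auto
    then obtain A where "\<rho> = nths ks A" by (auto simp: subseq_conv_nths)
    then have "sorted (map abs \<rho>)" "set \<rho> \<subseteq> set ks"
      using ks(3) by (auto simp: sorted_nths set_nths_subset simp flip: nths_map)
    then show ?thesis using ks(4) by (intro alternating_mset_sorted) (auto simp: no_complementary_def)
  qed
  have "odd_in (\<lambda>\<rho>. alternating_mset s (mset \<rho>)) (faces ls)
      = odd (size (filter_mset (alternating_mset s) (image_mset mset (mset (faces ls)))))"
    by (simp add: odd_in_def filter_mset_image_mset flip: mset_filter)
  also have "\<dots> = odd (size (filter_mset (alternating_mset s) (image_mset mset (mset (faces ks)))))"
    unfolding mset_faces ks(1) ..
  also have "\<dots> = odd_in (\<lambda>\<rho>. alternating_mset s (mset \<rho>)) (faces ks)"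
    by (simp add: odd_in_def filter_mset_image_mset flip: mset_filter)
  also have "\<dots> = odd_in (alternating s) (faces ks)"
    by (rule odd_in_cong) (rule faces_sorted)
  also have "\<dots> = (alternating s ks \<noteq> alternating (- s) ks)"
    by (rule odd_in_alternating_sorted) (use ks assms in auto)
  also have "\<dots> = (alternating_mset s (mset ls) \<noteq> alternating_mset (- s) (mset ls))"
    using alternating_mset_sorted[OF ks(3,4)] ks(1) by simp
  finally show ?thesis .
qed


context sweeping
begin

lemma hemi_Suc_cases:
  assumes "\<sigma> \<in> set (hemi (Suc d))"
  obtains \<tau> j where "\<tau> \<in> set (hemi d) \<or> \<tau> \<in> map neg ` set (hemi d)" "j < N"
    "set \<sigma> \<subseteq> Q j ` set \<tau> \<union> Q (Suc j) ` set \<tau>"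
proof -
  from assms obtain \<tau> where \<tau>: "\<tau> \<in> set (hemi d) \<or> \<tau> \<in> map neg ` set (hemi d)" "\<sigma> \<in> set (sweep N Q \<tau>)"
    by auto
  from \<tau>(2) show ?thesis by (rule set_sweep) (rule that[OF \<tau>(1)])
qed

text \<open>An invariant that may depend on the dimension, such as a bound on the number of kinks.\<close>

lemma hemi_vertices:
  assumes "\<sigma> \<in> set (hemi d)" "v \<in> set \<sigma>"
    and "P 0 pole" and "\<And>d v. P d v \<Longrightarrow> P d (neg v)" and "\<And>d v j. P d v \<Longrightarrow> j \<le> N \<Longrightarrow> P (Suc d) (Q j v)"
  shows "P d v"
  using assms(1,2)
proof (induction d arbitrary: \<sigma> v)
  case 0
  then show ?case by (simp add: assms(3))
next
  case (Suc d)
  from Suc.prems(1) show ?case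
  proof (rule hemi_Suc_cases)
    fix \<tau> j assume \<tau>: "\<tau> \<in> set (hemi d) \<or> \<tau> \<in> map neg ` set (hemi d)" "j < N"
      "set \<sigma> \<subseteq> Q j ` set \<tau> \<union> Q (Suc j) ` set \<tau>"
    have "P d w" if "w \<in> set \<tau>" for w
      using \<tau>(1) that Suc.IH assms(4) by auto
    then show ?thesis using \<tau>(2,3) Suc.prems(2) assms(5) by (auto simp: subset_iff)
  qed
qed

text \<open>A relation between the vertices of one simplex; it is used to bound the diameter of simplices.\<close>

lemma hemi_spread:
  assumes "\<sigma> \<in> set (hemi d)" "v \<in> set \<sigma>" "w \<in> set \<sigma>" and "R 0 pole pole"
    and "\<And>d v w. R d v w \<Longrightarrow> R d (neg v) (neg w)"
    and "\<And>d v w i j. R d v w \<Longrightarrow> i \<le> N \<Longrightarrow> j \<le> N \<Longrightarrow> i \<le> Suc j \<Longrightarrow> j \<le> Suc i \<Longrightarrow> R (Suc d) (Q i v) (Q j w)"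
  shows "R d v w"
  using assms(1-3)
proof (induction d arbitrary: \<sigma> v w)
  case 0
  then show ?case by (simp add: assms(4))
next
  case (Suc d)
  from Suc.prems(1) show ?case
  proof (rule hemi_Suc_cases)
    fix \<tau> j assume \<tau>: "\<tau> \<in> set (hemi d) \<or> \<tau> \<in> map neg ` set (hemi d)" "j < N"
      "set \<sigma> \<subseteq> Q j ` set \<tau> \<union> Q (Suc j) ` set \<tau>"
    have R: "R d w w'" if "w \<in> set \<tau>" "w' \<in> set \<tau>" for w w'
      using \<tau>(1) that Suc.IH assms(5) by auto
    obtain i w1 where 1: "v = Q i w1" "w1 \<in> set \<tau>" "i = j \<or> i = Suc j"
      using \<tau>(3) Suc.prems(2) by blast
    obtain i' w2 where 2: "w = Q i' w2" "w2 \<in> set \<tau>" "i' = j \<or> i' = Suc j"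
      using \<tau>(3) Suc.prems(3) by blast
    show ?thesis
      unfolding 1 2 by (rule assms(6)[OF R[OF 1(2) 2(2)]]) (use 1 2 \<tau>(2) in auto)
  qed
qed

text \<open>Fan's lemma.  By the facet count and the formula for the boundary, the number of alternating simplices
  in a hemisphere (of both signs) has the parity of the number of alternating simplices with first sign
  \<open>1\<close> in its equator.  The equator consists of the lower hemisphere and its antipode, and the antipodal
  map changes the first sign, so this is the parity of the number of alternating simplices (of both signs)
  in the lower hemisphere.  In dimension \<open>0\<close> there is a single vertex.\<close>

theorem hemisphere_alternating:
  fixes lab :: "'v \<Rightarrow> int"
  assumes lab_neg: "\<And>d \<sigma> v. d \<le> k \<Longrightarrow> \<sigma> \<in> set (hemi d) \<Longrightarrow> v \<in> set \<sigma> \<Longrightarrow> lab (neg v) = - lab v"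
    and nc: "\<And>d \<sigma>. d \<le> k \<Longrightarrow> \<sigma> \<in> set (hemi d) \<Longrightarrow> no_complementary (lab ` set \<sigma>)"
  shows "\<exists>\<sigma>\<in>set (hemi k). \<exists>s. alternating_mset s (mset (map lab \<sigma>))"
proof -
  let ?f = "\<lambda>s \<sigma>. alternating_mset s (mset (map lab \<sigma>))"
  have vanish: "vanishes_on_degenerate (?f s)" for s
    unfolding vanishes_on_degenerate_def
  proof (intro allI impI notI)
    fix \<sigma> assume nd: "\<not> distinct_adj \<sigma>" and "?f s \<sigma>"
    then obtain ls where "mset ls = mset (map lab \<sigma>)" "alternating s ls"
      unfolding alternating_mset_def by blast
    then have "distinct (map lab \<sigma>)"
      using alternating_sorted[of s ls] by (metis distinct_map mset_eq_imp_distinct_iff)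
    then show False using nd by (metis distinct_adj_altdef distinct_adj_mapD remdups_adj_distinct)
  qed
  have neg: "?f s (map neg \<sigma>) = ?f (- s) \<sigma>" if "d \<le> k" "\<sigma> \<in> set (hemi d)" for \<sigma> d s
  proof -
    have alt_uminus: "alternating (- s) (map uminus ls) = alternating s ls" for ls and s :: int
    proof (induction ls arbitrary: s)
      case (Cons x ls)
      show ?case using Cons.IH[of "- s"] by (auto simp: sgn_minus)
    qed simp
    have imp: "alternating_mset (- s) (image_mset uminus A)" if "alternating_mset s A" for A and s :: int
      using that alt_uminus unfolding alternating_mset_def by (metis mset_map)
    have "mset (map lab (map neg \<sigma>)) = image_mset uminus (mset (map lab \<sigma>))"
      using lab_neg[OF that] by (auto simp: image_mset.compositionality comp_def intro!: image_mset_cong)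
    moreover have "image_mset uminus (image_mset uminus (mset (map lab \<sigma>))) = mset (map lab \<sigma>)"
      by (simp add: image_mset.compositionality comp_def)
    ultimately show ?thesis
      using imp[of s "mset (map lab (map neg \<sigma>))"] imp[of "-s" "mset (map lab \<sigma>)"] by auto
  qed
  have "odd_in (?f 1) (hemi d) \<noteq> odd_in (?f (-1)) (hemi d)" if "d \<le> k" for d
    using that
  proof (induction d)
    case 0
    have "no_complementary {lab pole}" using nc[of 0 "[pole]"] by simp
    then have "sgn (lab pole) = 1 \<or> sgn (lab pole) = -1" by (auto simp: no_complementary_def sgn_if)
    moreover have "alternating_mset s {#x#} \<longleftrightarrow> sgn x = s" for s x
      unfolding alternating_mset_def by auto
    ultimately show ?case by auto
  next
    case (Suc d)
    have "odd_in (\<lambda>\<sigma>. odd_in (?f 1) (faces \<sigma>)) (hemi (Suc d))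
      = odd_in (\<lambda>\<sigma>. ?f 1 \<sigma> = (\<not> ?f (-1) \<sigma>)) (hemi (Suc d))"
    proof (rule odd_in_cong)
      fix \<sigma> assume "\<sigma> \<in> set (hemi (Suc d))"
      then have "no_complementary (set (map lab \<sigma>))" using nc Suc.prems by simp
      from odd_in_alternating_faces[OF this, of 1]
      show "odd_in (?f 1) (faces \<sigma>) = (?f 1 \<sigma> = (\<not> ?f (-1) \<sigma>))"
        by (simp add: faces_map)
    qed
    then have "(odd_in (?f 1) (hemi (Suc d)) \<noteq> odd_in (?f (-1)) (hemi (Suc d)))
       = (odd_in (?f 1) (hemi d) \<noteq> odd_in (\<lambda>\<sigma>. ?f 1 (map neg \<sigma>)) (hemi d))"
      using hemi_boundary[OF vanish[of 1], of d] unfolding odd_in_xor by blast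
    also have "odd_in (\<lambda>\<sigma>. ?f 1 (map neg \<sigma>)) (hemi d) = odd_in (?f (-1)) (hemi d)"
      by (rule odd_in_cong, rule neg) (use Suc.prems in simp_all)
    finally show ?case using Suc by simp
  qed
  from this[of k] show ?thesis
    using odd_in_False[of "hemi k" "?f 1"] odd_in_False[of "hemi k" "?f (-1)"] by blast
qed

text \<open>The combinatorial Borsuk-Ulam theorem (Tucker's lemma): an alternating simplex of dimension \<open>k\<close> needs
  \<open>k + 1\<close> different absolute values.\<close>

theorem hemisphere_label_bound:
  fixes lab :: "'v \<Rightarrow> int"
  assumes lab_neg: "\<And>d \<sigma> v. d \<le> k \<Longrightarrow> \<sigma> \<in> set (hemi d) \<Longrightarrow> v \<in> set \<sigma> \<Longrightarrow> lab (neg v) = - lab v"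
    and nc: "\<And>d \<sigma>. d \<le> k \<Longrightarrow> \<sigma> \<in> set (hemi d) \<Longrightarrow> no_complementary (lab ` set \<sigma>)"
    and bound: "\<And>\<sigma> v. \<sigma> \<in> set (hemi k) \<Longrightarrow> v \<in> set \<sigma> \<Longrightarrow> \<bar>lab v\<bar> \<le> int k"
  shows False
proof -
  have "\<exists>\<sigma>\<in>set (hemi k). \<exists>s. alternating_mset s (mset (map lab \<sigma>))"
    by (rule hemisphere_alternating) (fact lab_neg, fact nc)
  then obtain \<sigma> s ls where \<sigma>: "\<sigma> \<in> set (hemi k)" and ls: "mset ls = mset (map lab \<sigma>)" "alternating s ls"
    unfolding alternating_mset_def by blast
  have len: "length ls = Suc k"
    using ls(1) length_hemi[OF \<sigma>] by (metis length_map size_mset)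
  have "set ls = lab ` set \<sigma>" using ls(1) by (metis set_map set_mset_mset)
  then have "abs ` set ls \<subseteq> {1..int k}"
    using nc[OF order_refl \<sigma>] bound[OF \<sigma>] unfolding no_complementary_def by force
  then have "card (abs ` set ls) \<le> k" using card_mono[of "{1..int k}"] by simp
  moreover have "card (abs ` set ls) = Suc k"
    using alternating_sorted[OF ls(2)] len distinct_card[of "map abs ls"] by simp
  ultimately show False by simp
qed

end

section \<open>Counting the fixed points of an odd map with a Lyapunov function\<close>

text \<open>The functional \<open>\<Phi>\<close> is a Lyapunov function of the odd map \<open>T\<close> on a sequentially compact
  pseudometric space without fixed points of the antipodal map.  The odd functional \<open>\<mu>\<close> has no zeros below
  the level \<open>m\<close>.\<close>

locale odd_dynamics =
  fixes X :: "'b set" and d :: "'b \<Rightarrow> 'b \<Rightarrow> real" and neg T :: "'b \<Rightarrow> 'b" and \<Phi> :: "'b \<Rightarrow> real"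
    and \<mu> :: "'b \<Rightarrow> real" and m :: real
  assumes d_self: "x \<in> X \<Longrightarrow> d x x = 0"
    and d_sym: "x \<in> X \<Longrightarrow> y \<in> X \<Longrightarrow> d x y = d y x"
    and d_tri: "x \<in> X \<Longrightarrow> y \<in> X \<Longrightarrow> z \<in> X \<Longrightarrow> d x z \<le> d x y + d y z"
    and d_nonneg: "x \<in> X \<Longrightarrow> y \<in> X \<Longrightarrow> 0 \<le> d x y"
    and neg_X: "x \<in> X \<Longrightarrow> neg x \<in> X"
    and neg_neg: "x \<in> X \<Longrightarrow> neg (neg x) = x"
    and d_neg: "x \<in> X \<Longrightarrow> y \<in> X \<Longrightarrow> d (neg x) (neg y) = d x y"
    and d_neg_pos: "x \<in> X \<Longrightarrow> 0 < d x (neg x)"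
    and compact_X: "(\<And>n::nat. f n \<in> X) \<Longrightarrow> \<exists>l\<in>X. \<exists>r::nat \<Rightarrow> nat. strict_mono r \<and> (\<lambda>n. d (f (r n)) l) \<longlonglongrightarrow> 0"
    and T_X: "x \<in> X \<Longrightarrow> T x \<in> X"
    and T_neg: "x \<in> X \<Longrightarrow> T (neg x) = neg (T x)"
    and T_cont: "0 < e \<Longrightarrow> \<exists>\<delta>>0. \<forall>x\<in>X. \<forall>y\<in>X. d x y < \<delta> \<longrightarrow> d (T x) (T y) < e"
    and \<Phi>_cont: "0 < e \<Longrightarrow> \<exists>\<delta>>0. \<forall>x\<in>X. \<forall>y\<in>X. d x y < \<delta> \<longrightarrow> \<bar>\<Phi> x - \<Phi> y\<bar> < e"
    and \<mu>_cont: "0 < e \<Longrightarrow> \<exists>\<delta>>0. \<forall>x\<in>X. \<forall>y\<in>X. d x y < \<delta> \<longrightarrow> \<bar>\<mu> x - \<mu> y\<bar> < e"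
    and \<Phi>_nonneg: "x \<in> X \<Longrightarrow> 0 \<le> \<Phi> x"
    and \<Phi>_neg: "x \<in> X \<Longrightarrow> \<Phi> (neg x) = \<Phi> x"
    and \<Phi>_T: "x \<in> X \<Longrightarrow> \<Phi> (T x) \<le> \<Phi> x"
    and \<Phi>_fixed: "x \<in> X \<Longrightarrow> \<Phi> (T x) = \<Phi> x \<Longrightarrow> d x (T x) = 0"
    and \<mu>_neg: "x \<in> X \<Longrightarrow> \<mu> (neg x) = - \<mu> x"
    and \<mu>_nz: "x \<in> X \<Longrightarrow> \<Phi> x < m \<Longrightarrow> \<mu> x \<noteq> 0"
begin

definition tends :: "(nat \<Rightarrow> 'b) \<Rightarrow> 'b \<Rightarrow> bool" where
  "tends f l \<longleftrightarrow> l \<in> X \<and> (\<forall>n. f n \<in> X) \<and> (\<lambda>n. d (f n) l) \<longlonglongrightarrow> 0"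

text \<open>A quantitative disjointness of \<open>D\<close> and its antipode.  As it only refers to distances, it passes to
  preimages under uniformly continuous odd maps.\<close>

definition gap :: "real \<Rightarrow> 'b set \<Rightarrow> bool" where
  "gap \<delta> D \<longleftrightarrow> 0 < \<delta> \<and> D \<subseteq> X \<and> (\<forall>x\<in>D. \<forall>y\<in>D. \<delta> \<le> d x (neg y))"

text \<open>An upper bound for the Lusternik-Schnirelmann category of the quotient by the antipodal map.\<close>

definition antipodal_cover :: "'b set \<Rightarrow> nat \<Rightarrow> bool" where
  "antipodal_cover Y k \<longleftrightarrow> (\<exists>D. (\<forall>i<k. \<exists>\<delta>. gap \<delta> (D i)) \<and> (\<forall>y\<in>Y. \<exists>i<k. y \<in> D i \<or> neg y \<in> D i))"

lemma iter_X: "x \<in> X \<Longrightarrow> (T ^^ n) x \<in> X"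
  by (induction n) (auto intro: T_X)

lemma iter_neg: "x \<in> X \<Longrightarrow> (T ^^ n) (neg x) = neg ((T ^^ n) x)"
  by (induction n) (auto simp: T_neg iter_X)

lemma iter_cont: "0 < e \<Longrightarrow> \<exists>\<delta>>0. \<forall>x\<in>X. \<forall>y\<in>X. d x y < \<delta> \<longrightarrow> d ((T ^^ n) x) ((T ^^ n) y) < e"
proof (induction n arbitrary: e)
  case 0
  then show ?case by auto
next
  case (Suc n)
  obtain \<delta> where "\<delta> > 0" "\<forall>x\<in>X. \<forall>y\<in>X. d x y < \<delta> \<longrightarrow> d (T x) (T y) < e"
    using T_cont Suc.prems by blast
  moreover obtain \<delta>' where "\<delta>' > 0" "\<forall>x\<in>X. \<forall>y\<in>X. d x y < \<delta>' \<longrightarrow> d ((T ^^ n) x) ((T ^^ n) y) < \<delta>"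
    using Suc.IH \<open>\<delta> > 0\<close> by blast
  ultimately show ?case by (intro exI[of _ \<delta>']) (auto intro: iter_X)
qed

lemma \<Phi>_iter_antimono:
  assumes "x \<in> X" "n \<le> n'" shows "\<Phi> ((T ^^ n') x) \<le> \<Phi> ((T ^^ n) x)"
  using assms(2) by (induction n' rule: dec_induct) (auto intro: order_trans[OF \<Phi>_T] iter_X assms(1))

lemma compactE:
  fixes f :: "nat \<Rightarrow> 'b"
  assumes "\<And>n. f n \<in> X"
  obtains r l where "strict_mono r" "tends (f \<circ> r) l"
  using compact_X[of f] assms unfolding tends_def by (auto simp: o_def)

lemma tends_D: "tends f l \<Longrightarrow> l \<in> X" "tends f l \<Longrightarrow> f n \<in> X"
  by (auto simp: tends_def)

lemma tends_eventually: "tends f l \<Longrightarrow> 0 < e \<Longrightarrow> \<forall>\<^sub>F n in sequentially. d (f n) l < e"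
  unfolding tends_def by (auto simp: order_tendsto_iff)

lemma tends_subseq: "tends f l \<Longrightarrow> strict_mono r \<Longrightarrow> tends (f \<circ> r) l"
  unfolding tends_def using LIMSEQ_subseq_LIMSEQ[of "\<lambda>n. d (f n) l" 0 r] by (auto simp: o_def)

lemma tends_iter:
  assumes "tends f l" shows "tends (\<lambda>n. (T ^^ k) (f n)) ((T ^^ k) l)"
proof -
  have "\<forall>\<^sub>F n in sequentially. d ((T ^^ k) (f n)) ((T ^^ k) l) < e" if e: "0 < e" for e
  proof -
    obtain \<delta> where \<delta>: "\<delta> > 0" "\<forall>x\<in>X. \<forall>y\<in>X. d x y < \<delta> \<longrightarrow> d ((T ^^ k) x) ((T ^^ k) y) < e"
      using iter_cont[OF e, of k] by blast
    from tends_eventually[OF assms \<delta>(1)] show ?thesis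
      by eventually_elim (use \<delta>(2) tends_D[OF assms] in blast)
  qed
  moreover have "0 \<le> d ((T ^^ k) (f n)) ((T ^^ k) l)" for n
    using tends_D[OF assms] by (intro d_nonneg iter_X)
  ultimately have "(\<lambda>n. d ((T ^^ k) (f n)) ((T ^^ k) l)) \<longlonglongrightarrow> 0"
    by (intro tendstoI) (simp add: dist_real_def)
  then show ?thesis unfolding tends_def using tends_D[OF assms] by (auto intro: iter_X)
qed

lemma tends_real:
  fixes g :: "'b \<Rightarrow> real"
  assumes "\<And>e. 0 < e \<Longrightarrow> \<exists>\<delta>>0. \<forall>x\<in>X. \<forall>y\<in>X. d x y < \<delta> \<longrightarrow> \<bar>g x - g y\<bar> < e" "tends f l"
  shows "(\<lambda>n. g (f n)) \<longlonglongrightarrow> g l"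
proof (rule tendstoI)
  fix e :: real assume "0 < e"
  then obtain \<delta> where \<delta>: "\<delta> > 0" "\<forall>x\<in>X. \<forall>y\<in>X. d x y < \<delta> \<longrightarrow> \<bar>g x - g y\<bar> < e"
    using assms by blast
  from tends_eventually[OF assms(2) \<delta>(1)] show "\<forall>\<^sub>F n in sequentially. dist (g (f n)) (g l) < e"
    by eventually_elim (use \<delta>(2) tends_D[OF assms(2)] in \<open>auto simp: dist_real_def\<close>)
qed

lemma tends_\<Phi>_iter: "tends f l \<Longrightarrow> (\<lambda>n. \<Phi> ((T ^^ k) (f n))) \<longlonglongrightarrow> \<Phi> ((T ^^ k) l)"
  using tends_real[OF \<Phi>_cont tends_iter] by blast

lemma tends_neg: "tends f l \<Longrightarrow> tends (\<lambda>n. neg (f n)) (neg l)"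
  unfolding tends_def by (auto simp: d_neg neg_X)

lemma tends_near:
  assumes "tends f l" "\<And>n. g n \<in> X" "(\<lambda>n. d (f n) (g n)) \<longlonglongrightarrow> 0"
  shows "tends g l"
proof -
  have "(\<lambda>n. d (f n) (g n) + d (f n) l) \<longlonglongrightarrow> 0 + 0"
    using assms(1,3) by (intro tendsto_add) (auto simp: tends_def)
  then have sum: "(\<lambda>n. d (f n) (g n) + d (f n) l) \<longlonglongrightarrow> 0" by simp
  have le: "d (g n) l \<le> d (f n) (g n) + d (f n) l" for n
    using d_tri[of "g n" "f n" l] d_sym[of "g n" "f n"] tends_D[OF assms(1)] assms(2) by simp
  have ge: "0 \<le> d (g n) l" for n
    using d_nonneg[OF assms(2) tends_D(1)[OF assms(1)]] .
  have "(\<lambda>n. d (g n) l) \<longlonglongrightarrow> 0"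
    by (rule tendsto_sandwich[OF _ _ tendsto_const sum]) (simp_all add: le ge)
  then show ?thesis using assms(2) tends_D(1)[OF assms(1)] unfolding tends_def by blast
qed

lemma gap_iter:
  assumes "gap \<delta> D" shows "\<exists>\<delta>'. gap \<delta>' {x \<in> X. (T ^^ n) x \<in> D}"
proof -
  obtain \<delta>' where \<delta>': "\<delta>' > 0" "\<forall>x\<in>X. \<forall>y\<in>X. d x y < \<delta>' \<longrightarrow> d ((T ^^ n) x) ((T ^^ n) y) < \<delta>"
    using iter_cont assms unfolding gap_def by blast
  have "\<delta>' \<le> d x (neg y)" if "x \<in> X" "y \<in> X" "(T ^^ n) x \<in> D" "(T ^^ n) y \<in> D" for x y
  proof (rule ccontr)
    assume "\<not> \<delta>' \<le> d x (neg y)"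
    then have "d ((T ^^ n) x) (neg ((T ^^ n) y)) < \<delta>"
      using \<delta>'(2) that(1,2) neg_X[of y] iter_neg[of y n] by force
    then show False using assms that unfolding gap_def by force
  qed
  then show ?thesis using \<delta>'(1) unfolding gap_def by blast
qed

definition closed_sym :: "'b set \<Rightarrow> bool" where
  "closed_sym Y \<longleftrightarrow> Y \<subseteq> X \<and> (\<forall>y\<in>Y. neg y \<in> Y) \<and> (\<forall>f l. (\<forall>n. f n \<in> Y) \<and> tends f l \<longrightarrow> l \<in> Y)"

text \<open>The argument of Dini's theorem, for the decreasing sequence \<open>\<Phi> ((T ^^ n) y)\<close> on a compact set.\<close>

lemma eventually_below:
  assumes "closed_sym Y" "\<And>y. y \<in> Y \<Longrightarrow> \<exists>n. \<Phi> ((T ^^ n) y) < a"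
  shows "\<exists>N. \<forall>y\<in>Y. \<Phi> ((T ^^ N) y) < a"
proof (rule ccontr)
  assume "\<not> ?thesis"
  then obtain f where f: "\<And>N. f N \<in> Y" "\<And>N. a \<le> \<Phi> ((T ^^ N) (f N))"
    by (metis not_le)
  have fX: "f n \<in> X" for n using f assms(1) unfolding closed_sym_def by blast
  then obtain r l where r: "strict_mono r" "tends (f \<circ> r) l" using compactE[of f] by blast
  have "l \<in> Y" using assms(1) f r(2) unfolding closed_sym_def by (metis comp_apply)
  then obtain n where n: "\<Phi> ((T ^^ n) l) < a" using assms(2) by blast
  have "a \<le> \<Phi> ((T ^^ n) (f (r i)))" if "n \<le> i" for i
    using f(2)[of "r i"] \<Phi>_iter_antimono[OF fX, of n "r i" "r i"] seq_suble[OF r(1), of i] that by linarith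
  then have "a \<le> \<Phi> ((T ^^ n) l)"
    using tends_\<Phi>_iter[OF r(2), of n] by (intro LIMSEQ_le_const[where X="\<lambda>i. \<Phi> ((T ^^ n) (f (r i)))"]) auto
  with n show False by simp
qed

text \<open>After a common number of iterations, \<open>\<mu>\<close> has no zero on \<open>Y\<close>, and its sign there separates
  antipodes.  The separation is uniform by compactness.\<close>

lemma cover_below:
  assumes Y: "closed_sym Y" and below: "\<And>y. y \<in> Y \<Longrightarrow> \<exists>n. \<Phi> ((T ^^ n) y) < m"
  shows "antipodal_cover Y 1"
proof -
  obtain N where N: "\<forall>y\<in>Y. \<Phi> ((T ^^ N) y) < m" using eventually_below[OF assms] by blast
  let ?\<nu> = "\<lambda>x. \<mu> ((T ^^ N) x)"
  have YX: "y \<in> X" "neg y \<in> Y" if "y \<in> Y" for y using that Y unfolding closed_sym_def by blast+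
  have nz: "?\<nu> y \<noteq> 0" if "y \<in> Y" for y using \<mu>_nz[OF iter_X] N that YX by blast
  have \<nu>_neg: "?\<nu> (neg y) = - ?\<nu> y" if "y \<in> Y" for y
    using that YX by (simp add: iter_neg \<mu>_neg iter_X)
  define D where "D = {y \<in> Y. 0 < ?\<nu> y}"
  have "\<exists>\<delta>. gap \<delta> D"
  proof (rule ccontr)
    assume "\<not> ?thesis"
    moreover have "D \<subseteq> X" using YX unfolding D_def by blast
    ultimately have "\<exists>x\<in>D. \<exists>y\<in>D. d x (neg y) < \<delta>" if "0 < \<delta>" for \<delta>
      using that unfolding gap_def by force
    then have "\<forall>n. \<exists>x y. x \<in> D \<and> y \<in> D \<and> d x (neg y) < inverse (real (Suc n))"
      by (meson inverse_positive_iff_positive of_nat_0_less_iff zero_less_Suc)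
    then obtain f g where fg: "\<And>n. f n \<in> D" "\<And>n. g n \<in> D" "\<And>n. d (f n) (neg (g n)) < inverse (real (Suc n))"
      by metis
    have fgX: "f n \<in> X" "g n \<in> X" "neg (g n) \<in> X" for n using fg YX unfolding D_def by auto
    obtain r l where r: "strict_mono r" "tends (f \<circ> r) l" using compactE[of f] fgX by blast
    have "(\<lambda>n. d (f n) (neg (g n))) \<longlonglongrightarrow> 0"
      using less_imp_le[OF fg(3)] d_nonneg[OF fgX(1,3)]
      by (intro tendsto_sandwich[OF _ _ tendsto_const LIMSEQ_inverse_real_of_nat] always_eventually allI) blast+
    from filterlim_compose[OF this filterlim_subseq[OF r(1)]]
    have "(\<lambda>n. d ((f \<circ> r) n) (neg (g (r n)))) \<longlonglongrightarrow> 0" by simp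
    then have g: "tends (\<lambda>n. neg (g (r n))) l" by (rule tends_near[OF r(2) fgX(3)])
    have fY: "(f \<circ> r) n \<in> Y" for n using fg(1)[of "r n"] unfolding D_def by simp
    have lY: "l \<in> Y" using Y fY r(2) unfolding closed_sym_def by blast
    have "0 \<le> ?\<nu> ((f \<circ> r) n)" for n using fg(1)[of "r n"] unfolding D_def by simp
    then have "0 \<le> ?\<nu> l"
      using tends_real[OF \<mu>_cont tends_iter[OF r(2)], of N] by (intro LIMSEQ_le_const) auto
    moreover have "?\<nu> (neg (g n)) \<le> 0" for n using fg(2)[of n] \<nu>_neg[of "g n"] unfolding D_def by auto
    then have "?\<nu> l \<le> 0"
      using tends_real[OF \<mu>_cont tends_iter[OF g], of N] by (intro LIMSEQ_le_const2) auto
    ultimately show False using nz[OF lY] by linarith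
  qed
  moreover have "y \<in> D \<or> neg y \<in> D" if "y \<in> Y" for y
    using nz[OF that] \<nu>_neg[OF that] YX(2)[OF that] that unfolding D_def by simp linarith
  ultimately have "(\<forall>i<1. \<exists>\<delta>. gap \<delta> D) \<and> (\<forall>y\<in>Y. \<exists>i<1::nat. y \<in> D \<or> neg y \<in> D)" by simp
  then show ?thesis unfolding antipodal_cover_def by (rule exI[where x = "\<lambda>_. D"])
qed

text \<open>Along an orbit the values of \<open>\<Phi>\<close> converge.  At a limit point of the orbit, \<open>T\<close> does not lower the
  value, so this is a fixed point.\<close>

lemma limit_level_fixed:
  assumes "x \<in> X" "\<And>n. a \<le> \<Phi> ((T ^^ n) x)" 
  shows "\<exists>p\<in>X. d p (T p) = 0 \<and> a \<le> \<Phi> p \<and> (\<lambda>n. \<Phi> ((T ^^ n) x)) \<longlonglongrightarrow> \<Phi> p"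
proof -
  have "decseq (\<lambda>n. \<Phi> ((T ^^ n) x))" using \<Phi>_iter_antimono[OF assms(1)] by (simp add: decseq_def)
  then obtain L where L: "(\<lambda>n. \<Phi> ((T ^^ n) x)) \<longlonglongrightarrow> L"
    using decseq_convergent[where X = "\<lambda>n. \<Phi> ((T ^^ n) x)" and B = a] assms(2) by blast
  obtain r p where r: "strict_mono r" "tends ((\<lambda>n. (T ^^ n) x) \<circ> r) p"
    using compactE[of "\<lambda>n. (T ^^ n) x"] iter_X[OF assms(1)] by blast
  have 1: "(\<lambda>n. \<Phi> ((T ^^ (r n)) x)) \<longlonglongrightarrow> \<Phi> p" using tends_\<Phi>_iter[OF r(2), of 0] by simp
  have 2: "(\<lambda>n. \<Phi> ((T ^^ Suc (r n)) x)) \<longlonglongrightarrow> \<Phi> (T p)" using tends_\<Phi>_iter[OF r(2), of 1] by simp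
  have "(\<lambda>n. \<Phi> ((T ^^ (r n)) x)) \<longlonglongrightarrow> L"
    by (rule filterlim_compose[OF L filterlim_subseq[OF r(1)]])
  then have "\<Phi> p = L" using 1 LIMSEQ_unique by blast
  have "strict_mono (\<lambda>n. Suc (r n))" using r(1) by (simp add: strict_mono_def)
  from filterlim_compose[OF L filterlim_subseq[OF this]] have "\<Phi> (T p) = L"
    using 2 LIMSEQ_unique by blast
  have "d p (T p) = 0" using \<Phi>_fixed tends_D[OF r(2)] \<open>\<Phi> p = L\<close> \<open>\<Phi> (T p) = L\<close> by simp
  moreover have "a \<le> L" by (rule LIMSEQ_le_const[OF L]) (use assms(2) in blast)
  ultimately show ?thesis using L \<open>\<Phi> p = L\<close> tends_D[OF r(2)] by blast
qed


lemma finite_gap: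
  assumes "finite P" "P \<subseteq> X" "\<And>p q. p \<in> P \<Longrightarrow> q \<in> P \<Longrightarrow> 0 < d p (neg q)"
  shows "\<exists>\<delta>>0. gap \<delta> {x \<in> X. \<exists>p\<in>P. d x p < \<delta>}"
proof (cases "P = {}")
  case True
  then show ?thesis by (intro exI[of _ 1]) (simp add: gap_def)
next
  case False
  define S where "S = (\<lambda>(p, q). d p (neg q)) ` (P \<times> P)"
  have S: "finite S" "S \<noteq> {}" using assms False by (auto simp: S_def)
  define \<delta> where "\<delta> = Min S / 4"
  have "0 < Min S" using S assms(3) by (subst Min_gr_iff) (auto simp: S_def)
  then have "\<delta> > 0" by (simp add: \<delta>_def)
  have "\<delta> \<le> d x (neg y)" if xy: "x \<in> X" "y \<in> X" "p \<in> P" "q \<in> P" "d x p < \<delta>" "d y q < \<delta>" for x y p q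
  proof -
    have pq: "p \<in> X" "q \<in> X" "neg q \<in> X" "neg y \<in> X" using xy assms(2) neg_X by auto
    have "4 * \<delta> \<le> d p (neg q)" unfolding \<delta>_def using S xy by (auto simp: S_def intro!: Min_le)
    also have "\<dots> \<le> d p x + d x (neg y) + d (neg y) (neg q)"
      using d_tri[of p x "neg q"] d_tri[of x "neg y" "neg q"] xy pq by simp
    also have "\<dots> = d x p + d x (neg y) + d y q" using d_sym d_neg xy pq by simp
    finally show ?thesis using xy \<open>\<delta> > 0\<close> by simp
  qed
  then show ?thesis using \<open>\<delta> > 0\<close> by (intro exI[of _ \<delta>]) (auto simp: gap_def)
qed

text \<open>Induction on the levels, from the highest level \<open>a\<close> downwards.  Points whose orbits stay at or above
  \<open>a\<close> are, after a common number \<open>N\<close> of iterations, close to the fixed points of level \<open>a\<close>, by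
  compactness.  Small balls around representatives of these finitely many fixed points form a set that is
  separated from its antipode, and its preimage under \<open>T ^^ N\<close> is one member of the covering.  The orbits
  of all other points of \<open>Y\<close> fall below \<open>a\<close>.\<close>

theorem antipodal_cover_levels:
  assumes "finite P" "P \<subseteq> X" "\<And>p q. p \<in> P \<Longrightarrow> q \<in> P \<Longrightarrow> 0 < d p (neg q)"
    and fixed: "\<And>x. x \<in> X \<Longrightarrow> d x (T x) = 0 \<Longrightarrow> m \<le> \<Phi> x \<Longrightarrow> \<exists>p\<in>P. d x p = 0 \<or> d x (neg p) = 0"
    and "finite L" "closed_sym Y"
    and levels: "\<And>y. y \<in> Y \<Longrightarrow> (\<exists>n. \<Phi> ((T ^^ n) y) < m) \<or> (\<exists>a\<in>L. (\<lambda>n. \<Phi> ((T ^^ n) y)) \<longlonglongrightarrow> a)"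
  shows "antipodal_cover Y (Suc (card L))"
  using assms(5-7)
proof (induction L arbitrary: Y rule: finite_linorder_max_induct)
  case empty
  then show ?case using cover_below by auto
next
  case (insert a L)
  have YX: "Y \<subseteq> X" and Yneg: "\<And>y. y \<in> Y \<Longrightarrow> neg y \<in> Y"
    and Ycl: "\<And>f l. (\<And>n. f n \<in> Y) \<Longrightarrow> tends f l \<Longrightarrow> l \<in> Y"
    using insert.prems(1) unfolding closed_sym_def by blast+
  obtain \<delta> where \<delta>: "\<delta> > 0" "gap \<delta> {x \<in> X. \<exists>p\<in>P. d x p < \<delta>}" using finite_gap[OF assms(1-3)] by blast
  define W where "W = {x \<in> X. \<exists>p\<in>P. d x p < \<delta>}"
  define V where "V N = {y \<in> Y. (T ^^ N) y \<notin> W \<and> neg ((T ^^ N) y) \<notin> W}" for N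
  \<comment> \<open>A failure for every \<open>N\<close> yields points \<open>x\<close>, the limits of late iterates, at which \<open>\<Phi>\<close> equals \<open>a\<close>
  and cannot decrease, hence fixed points of level \<open>a\<close> outside the open set \<open>W\<close> and its antipode.\<close>
  have "\<exists>N. \<forall>y\<in>V N. \<exists>n. \<Phi> ((T ^^ n) y) < max a m"
  proof (rule ccontr)
    assume "\<not> ?thesis"
    then obtain f where f: "\<And>N. f N \<in> V N" "\<And>N n. max a m \<le> \<Phi> ((T ^^ n) (f N))"
      by (metis not_le)
    have fY: "f n \<in> Y" for n using f by (simp add: V_def)
    then have fX: "f n \<in> X" for n using YX by blast
    obtain r u where r: "strict_mono r" "tends (f \<circ> r) u" using compactE[of f] fX by blast
    define g where "g n = (T ^^ (r n)) (f (r n))" for n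
    have gX: "g n \<in> X" for n using fX iter_X by (simp add: g_def)
    obtain r' x where r': "strict_mono r'" "tends (g \<circ> r') x" using compactE[of g] gX by blast
    have uY: "u \<in> Y" by (rule Ycl[OF _ r(2)]) (simp add: fY)
    have u_ge: "max a m \<le> \<Phi> ((T ^^ n) u)" for n
      by (rule LIMSEQ_le_const[OF tends_\<Phi>_iter[OF r(2)]]) (simp add: f(2) del: max.bounded_iff)
    then have "\<not> (\<exists>n. \<Phi> ((T ^^ n) u) < m)" by (metis max.bounded_iff not_le)
    then obtain b where b: "b \<in> insert a L" "(\<lambda>n. \<Phi> ((T ^^ n) u)) \<longlonglongrightarrow> b" using insert.prems(2)[OF uY] by blast
    have "max a m \<le> b" by (rule LIMSEQ_le_const[OF b(2)]) (simp add: u_ge del: max.bounded_iff)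
    moreover have "b \<le> a" using b(1) insert.hyps(2) by (auto simp: less_imp_le)
    ultimately have lim_a: "(\<lambda>n. \<Phi> ((T ^^ n) u)) \<longlonglongrightarrow> a" and ma: "m \<le> a" using b(2) by auto
    have x_ge: "a \<le> \<Phi> ((T ^^ n) x)" for n
    proof (rule LIMSEQ_le_const[OF tends_\<Phi>_iter[OF r'(2)]], intro exI allI impI)
      fix i :: nat
      have "(T ^^ n) ((g \<circ> r') i) = (T ^^ (n + r (r' i))) (f (r (r' i)))" by (simp add: g_def funpow_add)
      then show "a \<le> \<Phi> ((T ^^ n) ((g \<circ> r') i))" using f(2) by (metis max.bounded_iff)
    qed
    have "\<Phi> x \<le> \<Phi> ((T ^^ n) u)" for n
    proof -
      have "strict_mono (r \<circ> r')" using r(1) r'(1) by (rule strict_mono_o)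
      have 1: "(\<lambda>i. \<Phi> ((g \<circ> r') i)) \<longlonglongrightarrow> \<Phi> x" using tends_\<Phi>_iter[OF r'(2), of 0] by simp
      have 2: "(\<lambda>i. \<Phi> ((T ^^ n) ((f \<circ> r \<circ> r') i))) \<longlonglongrightarrow> \<Phi> ((T ^^ n) u)"
        by (rule tends_\<Phi>_iter[OF tends_subseq[OF r(2) r'(1)]])
      have "\<Phi> ((g \<circ> r') i) \<le> \<Phi> ((T ^^ n) ((f \<circ> r \<circ> r') i))" if "n \<le> i" for i
      proof -
        have "n \<le> r (r' i)" using that seq_suble[OF \<open>strict_mono (r \<circ> r')\<close>, of i] by simp
        then show ?thesis using \<Phi>_iter_antimono[OF fX] by (simp add: g_def)
      qed
      then show ?thesis by (intro LIMSEQ_le[OF 1 2]) blast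
    qed
    then have "\<Phi> x \<le> a" by (intro LIMSEQ_le_const[OF lim_a]) blast
    have xX: "x \<in> X" using tends_D r'(2) by blast
    have "\<Phi> x = a" "\<Phi> (T x) = a"
      using \<open>\<Phi> x \<le> a\<close> x_ge[of 0] x_ge[of 1] \<Phi>_T[OF xX] by auto
    then obtain p where p: "p \<in> P" "d x p = 0 \<or> d x (neg p) = 0"
      using fixed[OF xX] \<Phi>_fixed[OF xX] ma by auto
    have "\<exists>i. (g \<circ> r') i \<in> W \<or> neg ((g \<circ> r') i) \<in> W"
    proof -
      obtain i where i: "d ((g \<circ> r') i) x < \<delta>"
        using tends_eventually[OF r'(2) \<delta>(1)] by (auto simp: eventually_sequentially)
      have pX: "p \<in> X" "neg p \<in> X" using p assms(2) neg_X by auto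
      have gi: "(g \<circ> r') i \<in> X" using gX by simp
      from p(2) show ?thesis
      proof
        assume "d x p = 0"
        then have "d ((g \<circ> r') i) p < \<delta>" using d_tri[OF gi xX pX(1)] i by simp
        then show ?thesis using gi p(1) unfolding W_def by blast
      next
        assume "d x (neg p) = 0"
        then have "d ((g \<circ> r') i) (neg p) < \<delta>" using d_tri[OF gi xX pX(2)] i by simp
        then have "d (neg ((g \<circ> r') i)) p < \<delta>" using d_neg[OF gi pX(2)] neg_neg[OF pX(1)] by simp
        then show ?thesis using neg_X[OF gi] p(1) unfolding W_def by blast
      qed
    qed
    then show False using f(1) unfolding V_def g_def by auto
  qed
  then obtain N where N: "\<forall>y\<in>V N. \<exists>n. \<Phi> ((T ^^ n) y) < max a m" by blast
  have "closed_sym (V N)"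
    unfolding closed_sym_def
  proof (intro conjI ballI allI impI)
    show "V N \<subseteq> X" using YX by (auto simp: V_def)
    fix y assume "y \<in> V N"
    then show "neg y \<in> V N" using YX Yneg neg_neg iter_X by (auto simp: V_def iter_neg subset_iff)
  next
    fix f l assume fl: "(\<forall>n. f n \<in> V N) \<and> tends f l"
    have lY: "l \<in> Y" by (rule Ycl[of f]) (use fl in \<open>auto simp: V_def\<close>)
    have open_W: "\<exists>n. h n \<in> W" if h: "tends h z" "z \<in> W" for h z
    proof -
      obtain p where p: "p \<in> P" "d z p < \<delta>" using h(2) by (auto simp: W_def)
      have "\<forall>\<^sub>F n in sequentially. d (h n) z < \<delta> - d z p" by (rule tends_eventually[OF h(1)]) (use p in simp)
      then obtain n where "d (h n) z < \<delta> - d z p" by (auto simp: eventually_sequentially)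
      then have "d (h n) p < \<delta>" using d_tri[of "h n" z p] tends_D[OF h(1)] p(1) assms(2) by fastforce
      then show ?thesis using p(1) tends_D[OF h(1)] unfolding W_def by blast
    qed
    have it: "tends (\<lambda>n. (T ^^ N) (f n)) ((T ^^ N) l)" using fl tends_iter by blast
    have "(T ^^ N) l \<notin> W" using open_W[OF it] fl by (auto simp: V_def)
    moreover have "neg ((T ^^ N) l) \<notin> W" using open_W[OF tends_neg[OF it]] fl by (auto simp: V_def)
    ultimately show "l \<in> V N" using lY by (simp add: V_def)
  qed
  moreover have "(\<exists>n. \<Phi> ((T ^^ n) y) < m) \<or> (\<exists>b\<in>L. (\<lambda>n. \<Phi> ((T ^^ n) y)) \<longlonglongrightarrow> b)" if "y \<in> V N" for y
  proof (rule ccontr)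
    assume neg_lev: "\<not> ?thesis"
    have y: "y \<in> Y" "y \<in> X" using that YX by (auto simp: V_def)
    then have "(\<lambda>n. \<Phi> ((T ^^ n) y)) \<longlonglongrightarrow> a" using insert.prems(2)[OF y(1)] neg_lev by blast
    then have "a \<le> \<Phi> ((T ^^ n) y)" for n
      using \<Phi>_iter_antimono[OF y(2)] by (intro LIMSEQ_le_const2[of "\<lambda>n. \<Phi> ((T ^^ n) y)"]) blast+
    then show False using N that neg_lev by (metis max_def not_le)
  qed
  ultimately have "antipodal_cover (V N) (Suc (card L))" by (rule insert.IH)
  then obtain D where D: "\<forall>i<Suc (card L). \<exists>\<delta>. gap \<delta> (D i)" "\<forall>y\<in>V N. \<exists>i<Suc (card L). y \<in> D i \<or> neg y \<in> D i"
    unfolding antipodal_cover_def by blast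
  define D' where "D' = D(Suc (card L) := {x \<in> X. (T ^^ N) x \<in> W})"
  have card: "card (insert a L) = Suc (card L)" using insert.hyps by (subst card_insert_disjoint) auto
  have "\<exists>\<delta>. gap \<delta> (D' i)" if "i < Suc (Suc (card L))" for i
    using that D(1) gap_iter[of \<delta> W N] \<delta>(2) by (auto simp: D'_def W_def less_Suc_eq)
  moreover have "\<exists>i<Suc (Suc (card L)). y \<in> D' i \<or> neg y \<in> D' i" if y: "y \<in> Y" for y
  proof (cases "y \<in> V N")
    case True
    then obtain i where "i < Suc (card L)" "y \<in> D i \<or> neg y \<in> D i" using D(2) by blast
    then show ?thesis by (intro exI[of _ i]) (auto simp: D'_def)
  next
    case False
    then show ?thesis using y YX neg_X by (intro exI[of _ "Suc (card L)"]) (auto simp: D'_def V_def iter_neg)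
  qed
  ultimately show ?case unfolding antipodal_cover_def card by blast
qed


lemma antipodal_cover_mono:
  assumes "antipodal_cover Y k" "k \<le> k'" shows "antipodal_cover Y k'"
proof -
  obtain D where D: "\<forall>i<k. \<exists>\<delta>. gap \<delta> (D i)" "\<forall>y\<in>Y. \<exists>i<k. y \<in> D i \<or> neg y \<in> D i"
    using assms(1) unfolding antipodal_cover_def by blast
  define D' where "D' i = (if i < k then D i else {})" for i
  have "gap 1 {}" by (simp add: gap_def)
  then have "\<exists>\<delta>. gap \<delta> (D' i)" for i using D(1) unfolding D'_def by (cases "i < k") auto
  moreover have "\<exists>i<k'. y \<in> D' i \<or> neg y \<in> D' i" if "y \<in> Y" for y
  proof -
    obtain i where "i < k" "y \<in> D i \<or> neg y \<in> D i" using D(2) \<open>y \<in> Y\<close> by blast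
    then show ?thesis using assms(2) by (intro exI[of _ i]) (simp add: D'_def)
  qed
  ultimately show ?thesis unfolding antipodal_cover_def by blast
qed

lemma \<Phi>_cong:
  assumes "x \<in> X" "y \<in> X" "d x y = 0" shows "\<Phi> x = \<Phi> y"
proof (rule ccontr)
  assume "\<Phi> x \<noteq> \<Phi> y"
  then obtain \<delta> where "\<delta> > 0" "\<forall>x'\<in>X. \<forall>y'\<in>X. d x' y' < \<delta> \<longrightarrow> \<bar>\<Phi> x' - \<Phi> y'\<bar> < \<bar>\<Phi> x - \<Phi> y\<bar>"
    using \<Phi>_cont[of "\<bar>\<Phi> x - \<Phi> y\<bar>"] by auto
  then show False using assms by fastforce
qed

text \<open>As long as fewer than \<open>k\<close> pairs of fixed points have been found, they cannot be all, since otherwise the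
  preceding theorem would give a covering by at most \<open>k\<close> pairs.\<close>

theorem many_fixed_points:
  assumes no_cover: "\<not> antipodal_cover X k"
  shows "\<exists>P. finite P \<and> card P = k \<and> (\<forall>p\<in>P. p \<in> X \<and> d p (T p) = 0 \<and> m \<le> \<Phi> p) \<and>
     (\<forall>p\<in>P. \<forall>q\<in>P. p \<noteq> q \<longrightarrow> 0 < d p q \<and> 0 < d p (neg q))"
proof -
  have "j \<le> k \<Longrightarrow> \<exists>P. finite P \<and> card P = j \<and> (\<forall>p\<in>P. p \<in> X \<and> d p (T p) = 0 \<and> m \<le> \<Phi> p) \<and>
     (\<forall>p\<in>P. \<forall>q\<in>P. p \<noteq> q \<longrightarrow> 0 < d p q \<and> 0 < d p (neg q))" for j
  proof (induction j)
    case 0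
    show ?case by (rule exI[of _ "{}"]) simp
  next
    case (Suc j)
    then obtain P where P: "finite P" "card P = j" "\<And>p. p \<in> P \<Longrightarrow> p \<in> X" "\<And>p. p \<in> P \<Longrightarrow> d p (T p) = 0 \<and> m \<le> \<Phi> p"
       and sep: "\<And>p q. p \<in> P \<Longrightarrow> q \<in> P \<Longrightarrow> p \<noteq> q \<Longrightarrow> 0 < d p q \<and> 0 < d p (neg q)"
      by auto
    have "\<exists>x\<in>X. d x (T x) = 0 \<and> m \<le> \<Phi> x \<and> (\<forall>p\<in>P. d x p \<noteq> 0 \<and> d x (neg p) \<noteq> 0)"
    proof (rule ccontr)
      assume contra: "\<not> ?thesis"
      have fixed: "\<exists>p\<in>P. d x p = 0 \<or> d x (neg p) = 0" if "x \<in> X" "d x (T x) = 0" "m \<le> \<Phi> x" for x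
        using contra that by blast
      have "antipodal_cover X (Suc (card (\<Phi> ` P)))"
      proof (rule antipodal_cover_levels[OF P(1)])
        show "P \<subseteq> X" using P(3) by blast
        show "0 < d p (neg q)" if "p \<in> P" "q \<in> P" for p q
          using sep[OF that] d_neg_pos P(3) that by (cases "p = q") auto
        show "\<exists>p\<in>P. d x p = 0 \<or> d x (neg p) = 0" if "x \<in> X" "d x (T x) = 0" "m \<le> \<Phi> x" for x
          by (rule fixed[OF that])
        show "finite (\<Phi> ` P)" using P(1) by simp
        show "closed_sym X" unfolding closed_sym_def using neg_X by (auto simp: tends_def)
        fix y assume y: "y \<in> X"
        show "(\<exists>n. \<Phi> ((T ^^ n) y) < m) \<or> (\<exists>a\<in>\<Phi> ` P. (\<lambda>n. \<Phi> ((T ^^ n) y)) \<longlonglongrightarrow> a)"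
        proof (cases "\<exists>n. \<Phi> ((T ^^ n) y) < m")
          case False
          then have "m \<le> \<Phi> ((T ^^ n) y)" for n by (simp add: not_less)
          then obtain x where x: "x \<in> X" "d x (T x) = 0" "m \<le> \<Phi> x" "(\<lambda>n. \<Phi> ((T ^^ n) y)) \<longlonglongrightarrow> \<Phi> x"
            using limit_level_fixed[OF y] by blast
          obtain p where p: "p \<in> P" "d x p = 0 \<or> d x (neg p) = 0" using fixed[OF x(1-3)] by blast
          have "\<Phi> x = \<Phi> p"
            using p(2) \<Phi>_cong[OF x(1) P(3)[OF p(1)]] \<Phi>_cong[OF x(1) neg_X[OF P(3)[OF p(1)]]] \<Phi>_neg[OF P(3)[OF p(1)]] by metis
          then show ?thesis using x(4) p(1) by auto
        qed simp
      qed
      moreover have "Suc (card (\<Phi> ` P)) \<le> k" using card_image_le[OF P(1), of \<Phi>] P(2) Suc.prems by simp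
      ultimately show False using no_cover antipodal_cover_mono by blast
    qed
    then obtain x where x: "x \<in> X" "d x (T x) = 0" "m \<le> \<Phi> x" "\<And>p. p \<in> P \<Longrightarrow> d x p \<noteq> 0 \<and> d x (neg p) \<noteq> 0" by blast
    have xp: "0 < d x p" "0 < d x (neg p)" "0 < d p x" "0 < d p (neg x)" if "p \<in> P" for p
    proof -
      have pX: "p \<in> X" "neg p \<in> X" "neg x \<in> X" using P(3) that neg_X x(1) by auto
      show 1: "0 < d x p" "0 < d x (neg p)" using x(4)[OF that] d_nonneg[OF x(1) pX(1)] d_nonneg[OF x(1) pX(2)] by auto
      show "0 < d p x" using 1 d_sym[OF x(1) pX(1)] by simp
      show "0 < d p (neg x)" using 1 d_sym[OF pX(1,3)] d_neg[OF x(1) pX(2)] neg_neg[OF pX(1)] by simp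
    qed
    have "x \<notin> P" using xp(1)[of x] d_self[OF x(1)] by auto
    then show ?case
      using P x sep xp by (intro exI[of _ "insert x P"]) (auto simp: card_insert_disjoint)
  qed
  then show ?thesis by blast
qed

end

section \<open>Functions bounded by one and their mean distance\<close>

definition unit_functions :: "'b measure \<Rightarrow> ('b \<Rightarrow> real) set" where
  "unit_functions M = {u \<in> borel_measurable M. \<forall>x. \<bar>u x\<bar> \<le> 1}"

abbreviation L1_dist :: "'b measure \<Rightarrow> ('b \<Rightarrow> real) \<Rightarrow> ('b \<Rightarrow> real) \<Rightarrow> real" where
  "L1_dist M u v \<equiv> (\<integral>x. \<bar>u x - v x\<bar> \<partial>M)"

lemma (in finite_measure) unit_functions_integrable:
  assumes "u \<in> unit_functions M" "v \<in> unit_functions M"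
  shows "integrable M u" "integrable M (\<lambda>x. \<bar>u x - v x\<bar>)" "integrable M (\<lambda>x. (u x - v x)\<^sup>2)"
proof -
  have [measurable]: "u \<in> borel_measurable M" "v \<in> borel_measurable M"
    using assms by (auto simp: unit_functions_def)
  have b: "\<bar>u x\<bar> \<le> 1" "\<bar>v x\<bar> \<le> 1" for x using assms by (auto simp: unit_functions_def)
  have d: "\<bar>u x - v x\<bar> \<le> 2" for x using b[of x] by linarith
  show "integrable M u" by (rule integrable_const_bound[of _ 1]) (use b in auto)
  show "integrable M (\<lambda>x. \<bar>u x - v x\<bar>)" by (rule integrable_const_bound[of _ 2]) (use d in auto)
  have "(u x - v x)\<^sup>2 \<le> 4" for x using d[of x] abs_le_square_iff[of "u x - v x" 2] by simp
  then show "integrable M (\<lambda>x. (u x - v x)\<^sup>2)" by (intro integrable_const_bound[of _ 4]) auto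
qed

lemma (in finite_measure) L1_dist_triangle:
  assumes "u \<in> unit_functions M" "v \<in> unit_functions M" "w \<in> unit_functions M"
  shows "L1_dist M u w \<le> L1_dist M u v + L1_dist M v w"
proof -
  note i = unit_functions_integrable(2)
  have "L1_dist M u w \<le> (\<integral>x. \<bar>u x - v x\<bar> + \<bar>v x - w x\<bar> \<partial>M)"
    by (rule integral_mono) (use i assms in auto)
  also have "\<dots> = L1_dist M u v + L1_dist M v w" by (rule Bochner_Integration.integral_add) (use i assms in auto)
  finally show ?thesis .
qed

lemma (in finite_measure) L1_dist_dominated:
  fixes u :: "nat \<Rightarrow> 'a \<Rightarrow> real"
  assumes "\<And>n. u n \<in> unit_functions M" "v \<in> unit_functions M" "AE x in M. (\<lambda>n. u n x) \<longlonglongrightarrow> v x"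
  shows "(\<lambda>n. L1_dist M (u n) v) \<longlonglongrightarrow> 0"
proof -
  have [measurable]: "u n \<in> borel_measurable M" "v \<in> borel_measurable M" for n
    using assms by (auto simp: unit_functions_def)
  have b: "\<bar>u n x\<bar> \<le> 1" "\<bar>v x\<bar> \<le> 1" for n x using assms by (auto simp: unit_functions_def)
  have d: "\<bar>u n x - v x\<bar> \<le> 2" for n x using b(1)[of n x] b(2)[of x] by linarith
  have "AE x in M. (\<lambda>n. \<bar>u n x - v x\<bar>) \<longlonglongrightarrow> 0"
    using assms(3) by eventually_elim (auto simp: LIM_zero_iff tendsto_rabs_zero_iff)
  then have "(\<lambda>n. L1_dist M (u n) v) \<longlonglongrightarrow> (\<integral>x. 0 \<partial>M)"
    by (intro integral_dominated_convergence[where w = "\<lambda>_. 2"]) (use d in auto)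
  then show ?thesis by simp
qed

text \<open>A subsequence with summable successive distances converges almost everywhere, and by dominated
  convergence also in the mean.\<close>

lemma (in finite_measure) L1_complete:
  fixes u :: "nat \<Rightarrow> 'a \<Rightarrow> real"
  assumes u: "\<And>n. u n \<in> unit_functions M"
    and cauchy: "\<And>e. 0 < e \<Longrightarrow> \<exists>N. \<forall>m\<ge>N. \<forall>n\<ge>N. L1_dist M (u m) (u n) < e"
  shows "\<exists>v\<in>unit_functions M. (\<lambda>n. L1_dist M (u n) v) \<longlonglongrightarrow> 0"
proof -
  have [measurable]: "u n \<in> borel_measurable M" for n
    using u by (auto simp: unit_functions_def)
  have b: "\<bar>u n x\<bar> \<le> 1" for n x using u by (auto simp: unit_functions_def)
  obtain r where r: "strict_mono r" "\<And>k. L1_dist M (u (r (Suc k))) (u (r k)) \<le> (1/2) ^ k"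
  proof -
    define N where "N k = (SOME N. \<forall>m\<ge>N. \<forall>n\<ge>N. L1_dist M (u m) (u n) < (1/2) ^ k)" for k :: nat
    have N: "\<forall>m\<ge>N k. \<forall>n\<ge>N k. L1_dist M (u m) (u n) < (1/2) ^ k" for k
      unfolding N_def by (rule someI_ex) (rule cauchy, simp)
    \<comment> \<open>A strictly increasing sequence with \<open>N k \<le> r k\<close>.\<close>
    define r where "r k = (\<Sum>i\<le>k. Suc (N i))" for k
    have "strict_mono r" unfolding strict_mono_Suc_iff by (simp add: r_def)
    moreover have "N k \<le> r k" for k
      unfolding r_def using member_le_sum[of k "{..k}" "\<lambda>i. Suc (N i)"] by simp
    moreover have "r k \<le> r (Suc k)" for k by (simp add: r_def)
    ultimately show ?thesis using N that by (meson less_imp_le order_trans)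
  qed
  let ?g = "\<lambda>k x. u (r (Suc k)) x - u (r k) x"
  have int: "integrable M (\<lambda>x. \<bar>?g k x\<bar>)" for k using unit_functions_integrable u by blast
  have "(\<integral>\<^sup>+x. (\<Sum>k. ennreal \<bar>?g k x\<bar>) \<partial>M) = (\<Sum>k. \<integral>\<^sup>+x. ennreal \<bar>?g k x\<bar> \<partial>M)"
    by (rule nn_integral_suminf) simp
  also have "\<dots> = (\<Sum>k. ennreal (L1_dist M (u (r (Suc k))) (u (r k))))"
    using int by (subst nn_integral_eq_integral) auto
  also have "\<dots> \<le> (\<Sum>k. ennreal ((1/2) ^ k))"
    by (intro suminf_le summableI ennreal_leI r(2))
  also have "\<dots> = ennreal (\<Sum>k. (1/2) ^ k)"
    by (rule suminf_ennreal2) (auto intro: summable_geometric)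
  also have "\<dots> < \<infinity>" by simp
  finally have "(\<integral>\<^sup>+x. (\<Sum>k. ennreal \<bar>?g k x\<bar>) \<partial>M) \<noteq> \<infinity>" by simp
  then have "AE x in M. (\<Sum>k. ennreal \<bar>?g k x\<bar>) \<noteq> \<infinity>"
    by (intro nn_integral_noteq_infinite) auto
  then have conv: "AE x in M. convergent (\<lambda>k. u (r k) x)"
  proof eventually_elim
    case (elim x)
    then have "summable (\<lambda>k. \<bar>?g k x\<bar>)" by (intro summable_suminf_not_top) auto
    then have "summable (\<lambda>k. ?g k x)" by (rule summable_rabs_cancel)
    then obtain L where "(\<lambda>n. \<Sum>k<n. ?g k x) \<longlonglongrightarrow> L" by (auto simp: summable_def sums_def)
    then have "(\<lambda>n. u (r n) x - u (r 0) x) \<longlonglongrightarrow> L"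
      by (simp add: sum_lessThan_telescope[of "\<lambda>k. u (r k) x"])
    from tendsto_add[OF this tendsto_const[of "u (r 0) x"]] show ?case by (auto simp: convergent_def)
  qed
  \<comment> \<open>The truncation only matters where the limit does not exist, and there \<open>lim\<close> has an unknown value.\<close>
  define v where "v x = max (-1) (min 1 (lim (\<lambda>k. u (r k) x)))" for x
  have v: "v \<in> unit_functions M" unfolding unit_functions_def v_def by auto
  have "AE x in M. (\<lambda>k. u (r k) x) \<longlonglongrightarrow> v x"
    using conv
  proof eventually_elim
    case (elim x)
    then have L: "(\<lambda>k. u (r k) x) \<longlonglongrightarrow> lim (\<lambda>k. u (r k) x)" by (simp add: convergent_LIMSEQ_iff)
    have "\<bar>lim (\<lambda>k. u (r k) x)\<bar> \<le> 1"
      by (rule LIMSEQ_le_const2[OF tendsto_rabs[OF L]]) (use b in auto)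
    then have "v x = lim (\<lambda>k. u (r k) x)" by (auto simp: v_def abs_le_iff)
    then show ?case using L by simp
  qed
  then have sub: "(\<lambda>k. L1_dist M (u (r k)) v) \<longlonglongrightarrow> 0" using u v by (intro L1_dist_dominated) auto
  have "(\<lambda>n. L1_dist M (u n) v) \<longlonglongrightarrow> 0"
  proof (rule LIMSEQ_I)
    fix e :: real assume "0 < e"
    then obtain N where N: "\<forall>m\<ge>N. \<forall>n\<ge>N. L1_dist M (u m) (u n) < e / 2" using cauchy[of "e / 2"] by auto
    obtain K where K: "\<forall>k\<ge>K. \<bar>L1_dist M (u (r k)) v\<bar> < e / 2" using LIMSEQ_D[OF sub, of "e/2"] \<open>0 < e\<close> by auto
    define k where "k = max K N"
    have "N \<le> r k" using seq_suble[OF r(1), of k] by (simp add: k_def)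
    have "\<bar>L1_dist M (u n) v\<bar> < e" if "N \<le> n" for n
    proof -
      have "L1_dist M (u n) v \<le> L1_dist M (u n) (u (r k)) + L1_dist M (u (r k)) v"
        using u v by (intro L1_dist_triangle)
      also have "\<dots> < e / 2 + e / 2" using N K that \<open>N \<le> r k\<close>
        by (intro add_strict_mono) (auto simp: k_def dest: spec[of _ "max K N"])
      finally show ?thesis by simp
    qed
    then show "\<exists>N. \<forall>n\<ge>N. norm (L1_dist M (u n) v - 0) < e" by auto
  qed
  then show ?thesis using v by blast
qed

lemma (in finite_measure) L1_AE_subseq:
  fixes u :: "nat \<Rightarrow> 'a \<Rightarrow> real"
  assumes "\<And>n. u n \<in> unit_functions M" "v \<in> unit_functions M" "(\<lambda>n. L1_dist M (u n) v) \<longlonglongrightarrow> 0"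
  shows "\<exists>r. strict_mono r \<and> (AE x in M. (\<lambda>n. u (r n) x) \<longlonglongrightarrow> v x)"
proof -
  have i: "integrable M (\<lambda>x. u n x - v x)" for n using assms unit_functions_integrable by auto
  obtain r where r: "strict_mono r" "AE x in M. (\<lambda>n. u (r n) x - v x) \<longlonglongrightarrow> 0"
    using tendsto_L1_AE_subseq[of M "\<lambda>n x. u n x - v x"] i assms(3) by (auto simp: o_def)
  then show ?thesis by (intro exI[of _ r]) (auto simp: LIM_zero_iff)
qed

section \<open>Dyadic cells\<close>

text \<open>The half-open dyadic cube of side \<open>1 / 2 ^ j\<close> that contains \<open>x\<close>.\<close>

definition dyadic_cell :: "nat \<Rightarrow> 'a::euclidean_space \<Rightarrow> 'a set" where
  "dyadic_cell j x = {y. \<forall>b\<in>Basis. \<lfloor>2 ^ j * (y \<bullet> b)\<rfloor> = \<lfloor>2 ^ j * (x \<bullet> b)\<rfloor>}"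

lemma dyadic_cell_self: "x \<in> dyadic_cell j x" by (simp add: dyadic_cell_def)

lemma dyadic_cell_eq: "y \<in> dyadic_cell j x \<Longrightarrow> dyadic_cell j y = dyadic_cell j x"
  by (auto simp: dyadic_cell_def)

lemma dyadic_cell_pred: "Measurable.pred (borel \<Otimes>\<^sub>M borel) (\<lambda>(x, y). y \<in> dyadic_cell j (x::'a::euclidean_space))"
proof -
  have [measurable]: "(\<lambda>x::'a. \<lfloor>2 ^ j * (x \<bullet> b)\<rfloor>) \<in> measurable borel (count_space UNIV)" for b
    by measurable
  show ?thesis unfolding dyadic_cell_def mem_Collect_eq case_prod_beta by measurable
qed

lemma dyadic_cell_sets [measurable]: "dyadic_cell j (x::'a::euclidean_space) \<in> sets borel"
proof -
  have "Measurable.pred borel (\<lambda>y. (\<lambda>(x, y). y \<in> dyadic_cell j x) (x, y))"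
    by (rule measurable_compose[OF _ dyadic_cell_pred]) simp
  then show ?thesis by (simp add: pred_def)
qed

lemma dyadic_cell_dist: 
  assumes "y \<in> dyadic_cell j (x::'a::euclidean_space)" shows "norm (x - y) \<le> real DIM('a) / 2 ^ j"
proof -
  have "\<bar>(x - y) \<bullet> b\<bar> \<le> 1 / 2 ^ j" if "b \<in> Basis" for b
  proof -
    have "\<lfloor>2 ^ j * (y \<bullet> b)\<rfloor> = \<lfloor>2 ^ j * (x \<bullet> b)\<rfloor>" using assms that by (simp add: dyadic_cell_def)
    then have "\<bar>2 ^ j * (x \<bullet> b) - 2 ^ j * (y \<bullet> b)\<bar> \<le> 1"
      by linarith
    then have "2 ^ j * \<bar>x \<bullet> b - y \<bullet> b\<bar> \<le> 1" by (simp add: abs_mult flip: right_diff_distrib)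
    then show ?thesis by (simp add: inner_diff_left field_simps)
  qed
  then have "(\<Sum>b\<in>Basis. \<bar>(x - y) \<bullet> b\<bar>) \<le> (\<Sum>b\<in>(Basis::'a set). 1 / 2 ^ j)" by (rule sum_mono)
  then show ?thesis using norm_le_l1[of "x - y"] by simp
qed

lemma emeasure_dyadic_cell: "emeasure lborel (dyadic_cell j (x::'a::euclidean_space)) = ennreal ((1 / 2 ^ j) ^ DIM('a))"
proof -
  define l :: 'a where "l = (\<Sum>b\<in>Basis. (of_int \<lfloor>2 ^ j * (x \<bullet> b)\<rfloor> / 2 ^ j) *\<^sub>R b)"
  define h :: 'a where "h = l + (1 / 2 ^ j) *\<^sub>R One"
  have l: "l \<bullet> b = of_int \<lfloor>2 ^ j * (x \<bullet> b)\<rfloor> / 2 ^ j" if "b \<in> Basis" for b using that by (simp add: l_def)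
  have h: "h \<bullet> b = l \<bullet> b + 1 / 2 ^ j" if "b \<in> Basis" for b using that by (simp add: h_def inner_add_left)
  have iff: "\<lfloor>2 ^ j * (y \<bullet> b)\<rfloor> = \<lfloor>2 ^ j * (x \<bullet> b)\<rfloor> \<longleftrightarrow> l \<bullet> b \<le> y \<bullet> b \<and> y \<bullet> b < h \<bullet> b" if "b \<in> Basis" for y b
    unfolding h[OF that] l[OF that] floor_eq_iff by (simp add: field_simps)
  have prod: "(\<Prod>b\<in>Basis. (h - l) \<bullet> b) = (1 / 2 ^ j) ^ DIM('a)"
    using h by (simp add: inner_diff_left)
  have "l \<bullet> b \<le> h \<bullet> b" if "b \<in> Basis" for b using h that by simp
  then have "emeasure lborel (box l h) = ennreal ((1 / 2 ^ j) ^ DIM('a))" "emeasure lborel (cbox l h) = ennreal ((1 / 2 ^ j) ^ DIM('a))"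
    using prod by (simp_all add: emeasure_lborel_box emeasure_lborel_cbox)
  moreover have "box l h \<subseteq> dyadic_cell j x" "dyadic_cell j x \<subseteq> cbox l h"
    using iff by (auto simp: dyadic_cell_def mem_box less_imp_le)
  ultimately show ?thesis
    using emeasure_mono[of "box l h" "dyadic_cell j x" lborel] emeasure_mono[of "dyadic_cell j x" "cbox l h" lborel]
    by (intro antisym) auto
qed

text \<open>There are only countably many cells, because each one contains a point of a countable dense set.\<close>

lemma dyadic_cell_dense:
  assumes "\<And>U. open U \<Longrightarrow> U \<noteq> {} \<Longrightarrow> \<exists>d\<in>D. d \<in> U"
  shows "\<exists>y\<in>D. dyadic_cell j (x::'a::euclidean_space) = dyadic_cell j y"
proof -
  define l :: 'a where "l = (\<Sum>b\<in>Basis. (of_int \<lfloor>2 ^ j * (x \<bullet> b)\<rfloor> / 2 ^ j) *\<^sub>R b)"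
  define h :: 'a where "h = l + (1 / 2 ^ j) *\<^sub>R One"
  have l: "l \<bullet> b = of_int \<lfloor>2 ^ j * (x \<bullet> b)\<rfloor> / 2 ^ j" if "b \<in> Basis" for b using that by (simp add: l_def)
  have h: "h \<bullet> b = l \<bullet> b + 1 / 2 ^ j" if "b \<in> Basis" for b using that by (simp add: h_def inner_add_left)
  have "box l h \<noteq> {}" using h by (simp add: box_ne_empty)
  then obtain y where y: "y \<in> D" "y \<in> box l h" using assms[OF open_box] by blast
  have "\<lfloor>2 ^ j * (y \<bullet> b)\<rfloor> = \<lfloor>2 ^ j * (x \<bullet> b)\<rfloor>" if "b \<in> Basis" for b
    using y(2) that unfolding floor_eq_iff mem_box h[OF that] l[OF that]
    by (auto simp: h l field_simps dest!: bspec[OF _ that])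
  then have "y \<in> dyadic_cell j x" by (simp add: dyadic_cell_def)
  then show ?thesis using dyadic_cell_eq y(1) by blast
qed

section \<open>Compactness of bounded sets of the fractional Sobolev space\<close>

locale bounded_open_set =
  fixes \<Omega> :: "'a::euclidean_space set"
  assumes open_\<Omega>: "open \<Omega>" and bounded_\<Omega>: "bounded \<Omega>" and nonempty_\<Omega>: "\<Omega> \<noteq> {}"
begin

text \<open>A constant and not an abbreviation, so that the restricted measure is not unfolded in measurability
  arguments.\<close>

definition M :: "'a measure" where "M = dom_measure \<Omega>"

lemma dom_M: "dom_measure \<Omega> = M" by (simp add: M_def)

abbreviation "U \<equiv> unit_functions M"

lemma space_M: "space M = \<Omega>" by (simp add: M_def space_restrict_space)

lemma \<Omega>_sets [measurable]: "\<Omega> \<in> sets borel" using open_\<Omega> by simp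

lemma ident_M [measurable]: "(\<lambda>x. x) \<in> measurable M borel"
  unfolding M_def by (rule measurable_restrict_space1) simp

lemma finite_M: "finite_measure M"
  by (rule finite_measureI)
    (use emeasure_bounded_finite[OF bounded_\<Omega>] in \<open>simp add: M_def space_restrict_space emeasure_restrict_space\<close>)

sublocale M: finite_measure M by (rule finite_M)
sublocale MM: pair_sigma_finite M M ..

lemma emeasure_M: "A \<in> sets borel \<Longrightarrow> A \<subseteq> \<Omega> \<Longrightarrow> emeasure M A = emeasure lborel A"
  unfolding M_def by (rule emeasure_restrict_space) auto

lemma sets_M: "A \<in> sets borel \<Longrightarrow> A \<inter> \<Omega> \<in> sets M"
  by (auto simp: M_def sets_restrict_space)

definition volume :: real where "volume = measure M \<Omega>"

lemma volume_pos: "0 < volume"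
proof -
  have "emeasure lborel \<Omega> \<noteq> 0"
    using open_\<Omega> nonempty_\<Omega> by (metis null_setsI open_not_negligible negligible_iff_null_sets \<Omega>_sets null_sets_completionI sets_lborel)
  then show ?thesis unfolding volume_def
    using emeasure_M[of \<Omega>] M.emeasure_eq_measure[of \<Omega>] by (auto simp: zero_less_measure_iff)
qed

lemma frac_kernel_measurable [measurable]: "(\<lambda>p. frac_kernel s (fst p) (snd p)) \<in> borel_measurable (M \<Otimes>\<^sub>M M)"
  unfolding frac_kernel_def by measurable

lemma frac_kernel_nonneg: "0 \<le> frac_kernel s x y" by (simp add: frac_kernel_def)

definition diff_sq :: "real \<Rightarrow> ('a \<Rightarrow> real) \<Rightarrow> 'a \<times> 'a \<Rightarrow> real" where
  "diff_sq s u = (\<lambda>(x, y). (u x - u y)\<^sup>2 * frac_kernel s x y)"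

lemma diff_sq_measurable [measurable]:
  assumes [measurable]: "u \<in> borel_measurable M" shows "diff_sq s u \<in> borel_measurable (M \<Otimes>\<^sub>M M)"
  unfolding diff_sq_def case_prod_beta by measurable

lemma diff_sq_nonneg: "0 \<le> diff_sq s u p"
  by (simp add: diff_sq_def frac_kernel_nonneg split: prod.split)

lemma frac_seminorm_sq_eq: "frac_seminorm_sq s \<Omega> u = (\<integral>\<^sup>+p. ennreal (diff_sq s u p) \<partial>(M \<Otimes>\<^sub>M M))"
  unfolding frac_seminorm_sq_def diff_sq_def dom_M by (auto intro!: nn_integral_cong)

lemma H_space_iff: 
  assumes "u \<in> borel_measurable M" 
  shows "u \<in> H_space s \<Omega> \<longleftrightarrow> integrable M (\<lambda>x. (u x)\<^sup>2) \<and> integrable (M \<Otimes>\<^sub>M M) (diff_sq s u)"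
  using assms unfolding H_space_def frac_seminorm_sq_eq dom_M
  by (auto simp: integrable_iff_bounded diff_sq_nonneg)

lemma H_space_diff_sq: "u \<in> H_space s \<Omega> \<Longrightarrow> integrable (M \<Otimes>\<^sub>M M) (diff_sq s u)"
  using H_space_iff by (auto simp: H_space_def dom_M)

definition seminorm :: "real \<Rightarrow> ('a \<Rightarrow> real) \<Rightarrow> real" where
  "seminorm s u = integral\<^sup>L (M \<Otimes>\<^sub>M M) (diff_sq s u)"

lemma frac_seminorm_sq_seminorm:
  "u \<in> H_space s \<Omega> \<Longrightarrow> frac_seminorm_sq s \<Omega> u = ennreal (seminorm s u)"
  unfolding frac_seminorm_sq_eq seminorm_def
  by (intro nn_integral_eq_integral H_space_diff_sq) (auto simp: diff_sq_nonneg)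

lemma seminorm_nonneg: "0 \<le> seminorm s u"
  unfolding seminorm_def by (simp add: diff_sq_nonneg)

text \<open>The kernel of the averaging operator over dyadic cells, normalized by the volume of a full cell even
  where the cell leaves \<open>\<Omega>\<close>.\<close>

definition cell_ind :: "nat \<Rightarrow> 'a \<Rightarrow> 'a \<Rightarrow> real" where
  "cell_ind j x y = 2 ^ (j * DIM('a)) * indicator (dyadic_cell j x) y"

lemma cell_ind_measurable [measurable]: "(\<lambda>p. cell_ind j (fst p) (snd p)) \<in> borel_measurable (M \<Otimes>\<^sub>M M)"
proof -
  have "Measurable.pred (M \<Otimes>\<^sub>M M) (\<lambda>p. (\<lambda>(x, y). y \<in> dyadic_cell j (x::'a)) (fst p, snd p))"
    by (rule measurable_compose[OF _ dyadic_cell_pred]) measurable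
  then have [measurable]: "Measurable.pred (M \<Otimes>\<^sub>M M) (\<lambda>p. snd p \<in> dyadic_cell j (fst p))" by simp
  have "(\<lambda>p. cell_ind j (fst p) (snd p)) = (\<lambda>p. if snd p \<in> dyadic_cell j (fst p) then 2 ^ (j * DIM('a)) else 0)"
    by (auto simp: cell_ind_def fun_eq_iff)
  then show ?thesis by simp
qed

lemma cell_ind_measurable2 [measurable]: "cell_ind j x \<in> borel_measurable M"
  unfolding cell_ind_def by measurable

lemma cell_ind_bound: "0 \<le> cell_ind j x y" "cell_ind j x y \<le> 2 ^ (j * DIM('a))"
  by (auto simp: cell_ind_def indicator_def)

lemma cell_ind_integrable: "integrable M (cell_ind j x)"
  by (rule M.integrable_const_bound[of _ "2 ^ (j * DIM('a))"]) (use cell_ind_bound in auto)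

lemma cell_measure: "measure lborel (dyadic_cell j (x::'a)) * 2 ^ (j * DIM('a)) = 1"
  using emeasure_dyadic_cell[of j x] by (simp add: measure_def power_mult flip: power_mult_distrib)

lemma integral_cell_ind: "(\<integral>y. cell_ind j x y \<partial>M) = 2 ^ (j * DIM('a)) * measure lborel (dyadic_cell j x \<inter> \<Omega>)"
  unfolding cell_ind_def M_def by (simp add: space_restrict_space measure_restrict_space)

lemma integral_cell_ind_le: "(\<integral>y. cell_ind j x y \<partial>M) \<le> 1"
proof -
  have "emeasure lborel (dyadic_cell j x) < \<infinity>" by (simp add: emeasure_dyadic_cell)
  then have "measure lborel (dyadic_cell j x \<inter> \<Omega>) \<le> measure lborel (dyadic_cell j x)"
    by (intro measure_mono_fmeasurable) (auto simp: fmeasurable_def)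
  then show ?thesis unfolding integral_cell_ind using cell_measure[of j x]
    by (metis mult.commute mult_left_mono zero_le_numeral zero_le_power)
qed

definition cell_avg :: "nat \<Rightarrow> ('a \<Rightarrow> real) \<Rightarrow> 'a \<Rightarrow> real" where
  "cell_avg j u x = (\<integral>y. u y * cell_ind j x y \<partial>M)"

lemma cell_avg_measurable [measurable]:
  assumes [measurable]: "u \<in> borel_measurable M" shows "cell_avg j u \<in> borel_measurable M"
proof -
  have "(\<lambda>x. \<integral>y. u (snd (x, y)) * cell_ind j (fst (x, y)) (snd (x, y)) \<partial>M) \<in> borel_measurable M"
    by (rule M.borel_measurable_lebesgue_integral) (simp add: case_prod_beta)
  then show ?thesis by (simp add: cell_avg_def[abs_def])
qed

lemma cell_avg_integrable: "u \<in> U \<Longrightarrow> integrable M (\<lambda>y. u y * cell_ind j x y)"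
  by (rule Bochner_Integration.integrable_bound[OF cell_ind_integrable[of j x]])
     (auto simp: unit_functions_def abs_mult mult_left_le_one_le cell_ind_bound)

lemma cell_avg_bound: assumes "u \<in> U" shows "\<bar>cell_avg j u x\<bar> \<le> 1"
proof -
  have "\<bar>cell_avg j u x\<bar> \<le> (\<integral>y. \<bar>u y * cell_ind j x y\<bar> \<partial>M)"
    unfolding cell_avg_def by (rule integral_abs_bound)
  also have "\<dots> \<le> (\<integral>y. cell_ind j x y \<partial>M)"
    by (rule integral_mono) (use assms cell_avg_integrable cell_ind_integrable cell_ind_bound in \<open>auto simp: unit_functions_def abs_mult mult_left_le_one_le\<close>)
  also have "\<dots> \<le> 1" by (rule integral_cell_ind_le)
  finally show ?thesis .
qed

lemma cell_avg_unit: "u \<in> U \<Longrightarrow> cell_avg j u \<in> U"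
  using cell_avg_bound by (auto simp: unit_functions_def)

text \<open>The part of the mass that averaging loses because cells leave \<open>\<Omega>\<close>.\<close>

definition cell_loss :: "nat \<Rightarrow> real" where
  "cell_loss j = (\<integral>x. (1 - (\<integral>y. cell_ind j x y \<partial>M)) \<partial>M)"

text \<open>Every point of the open set \<open>\<Omega>\<close> has all its sufficiently small cells inside \<open>\<Omega>\<close>.\<close>

lemma cell_loss_tendsto: "cell_loss \<longlonglongrightarrow> 0"
proof -
  have meas [measurable]: "(\<lambda>x. \<integral>y. cell_ind j x y \<partial>M) \<in> borel_measurable M" for j by measurable
  have nn: "0 \<le> (\<integral>y. cell_ind j x y \<partial>M)" for j x using cell_ind_bound by simp
  have "AE x in M. (\<lambda>j. 1 - (\<integral>y. cell_ind j x y \<partial>M)) \<longlonglongrightarrow> 0"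
  proof (rule AE_I2)
    fix x assume "x \<in> space M"
    then obtain e where e: "e > 0" "ball x e \<subseteq> \<Omega>" using open_\<Omega> space_M by (auto simp: open_contains_ball)
    have "(\<lambda>j. real DIM('a) * (1 / 2) ^ j) \<longlonglongrightarrow> real DIM('a) * 0"
      by (intro tendsto_mult tendsto_const LIMSEQ_power_zero) simp
    then have "\<forall>\<^sub>F j in sequentially. real DIM('a) * (1 / 2) ^ j < e" using e(1) by (simp add: order_tendsto_iff)
    then have "\<forall>\<^sub>F j in sequentially. 1 - (\<integral>y. cell_ind j x y \<partial>M) = 0"
    proof eventually_elim
      case (elim j)
      have "dyadic_cell j x \<subseteq> ball x e"
        using dyadic_cell_dist[of _ j x] elim by (force simp: dist_norm power_one_over)
      then have "dyadic_cell j x \<inter> \<Omega> = dyadic_cell j x" using e by blast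
      then show ?case using cell_measure[of j x] by (simp add: integral_cell_ind mult.commute)
    qed
    then show "(\<lambda>j. 1 - (\<integral>y. cell_ind j x y \<partial>M)) \<longlonglongrightarrow> 0" by (rule tendsto_eventually)
  qed
  then have "cell_loss \<longlonglongrightarrow> (\<integral>x. 0 \<partial>M)" unfolding cell_loss_def[abs_def]
    by (intro integral_dominated_convergence[where w = "\<lambda>_. 1"]) (use integral_cell_ind_le nn in \<open>auto simp: abs_le_iff\<close>)
  then show ?thesis by simp
qed

text \<open>On a cell the kernel of the seminorm is bounded below by a power of the diameter, hence the averaged
  oscillation is controlled by the seminorm.  The inequality \<open>\<bar>a\<bar> \<le> \<theta> + a\<^sup>2 / \<theta>\<close> is used in place of the
  Cauchy-Schwarz inequality.\<close>

lemma cell_avg_error: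
  assumes u: "u \<in> U" and H: "u \<in> H_space s \<Omega>" and s: "0 < s" and \<theta>: "0 < \<theta>"
  shows "L1_dist M u (cell_avg j u) \<le> cell_loss j + \<theta> * volume
     + seminorm s u / \<theta> * (real DIM('a) powr (real DIM('a) + 2 * s) / (2 powr (2 * s)) ^ j)"
proof -
  let ?n = "real DIM('a)"
  define c where "c = ?n powr (?n + 2 * s) / (2 powr (2 * s)) ^ j"
  have um [measurable]: "u \<in> borel_measurable M" using u by (simp add: unit_functions_def)
  have u1: "\<bar>u x\<bar> \<le> 1" for x using u by (auto simp: unit_functions_def)
  have int: "integrable (M \<Otimes>\<^sub>M M) (diff_sq s u)" using H_space_diff_sq[OF H] .
  have intx: "AE x in M. integrable M (\<lambda>y. diff_sq s u (x, y))" by (rule MM.AE_integrable_fst'[OF int])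
  have Dint: "integrable M (\<lambda>x. \<integral>y. diff_sq s u (x, y) \<partial>M)" by (rule MM.integrable_fst'[OF int])
  have Deq: "(\<integral>x. (\<integral>y. diff_sq s u (x, y) \<partial>M) \<partial>M) = seminorm s u"
    unfolding seminorm_def using MM.integral_fst'[OF int] by simp
  have nn: "0 \<le> (\<integral>y. cell_ind j x y \<partial>M)" for x using cell_ind_bound by simp
  have ker: "cell_ind j x y \<le> c * frac_kernel s x y" if "x \<noteq> y" for x y
  proof (cases "y \<in> dyadic_cell j x")
    case False
    then show ?thesis by (simp add: cell_ind_def c_def frac_kernel_nonneg)
  next
    case True
    define z where "z = norm (x - y)"
    have z: "0 < z" "z \<le> ?n / 2 ^ j" using dyadic_cell_dist[OF True] that by (auto simp: z_def)
    have "z powr (?n + 2 * s) \<le> (?n / 2 ^ j) powr (?n + 2 * s)" using z s by (intro powr_mono2) auto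
    also have "\<dots> = ?n powr (?n + 2 * s) / (2 ^ j) powr (?n + 2 * s)" by (simp add: powr_divide)
    also have "(2 ^ j) powr (?n + 2 * s) = (2::real) ^ (j * DIM('a)) * (2 powr (2 * s)) ^ j"
      by (simp add: powr_add powr_realpow[symmetric] powr_powr power_mult mult.commute)
    finally have "2 ^ (j * DIM('a)) * z powr (?n + 2 * s) \<le> c" 
      by (simp add: c_def field_simps)
    then show ?thesis using z True by (simp add: cell_ind_def frac_kernel_def z_def[symmetric] field_simps)
  qed
  have pt: "\<bar>u x - cell_avg j u x\<bar> \<le> (1 - (\<integral>y. cell_ind j x y \<partial>M)) + (\<theta> + c / \<theta> * (\<integral>y. diff_sq s u (x, y) \<partial>M))"
    if x: "integrable M (\<lambda>y. diff_sq s u (x, y))" for x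
  proof -
    have i1: "integrable M (\<lambda>y. (u x - u y) * cell_ind j x y)"
    proof -
      have "integrable M (\<lambda>y. u x * cell_ind j x y - u y * cell_ind j x y)"
        by (intro Bochner_Integration.integrable_diff integrable_mult_right cell_ind_integrable cell_avg_integrable u)
      then show ?thesis by (simp add: algebra_simps)
    qed
    have eq: "u x - cell_avg j u x = u x * (1 - (\<integral>y. cell_ind j x y \<partial>M)) + (\<integral>y. (u x - u y) * cell_ind j x y \<partial>M)"
    proof -
      have "(\<integral>y. (u x - u y) * cell_ind j x y \<partial>M) = (\<integral>y. u x * cell_ind j x y - u y * cell_ind j x y \<partial>M)"
        by (simp add: algebra_simps)
      also have "\<dots> = u x * (\<integral>y. cell_ind j x y \<partial>M) - cell_avg j u x"
        unfolding cell_avg_def by (subst Bochner_Integration.integral_diff)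
          (auto intro!: integrable_mult_right cell_ind_integrable cell_avg_integrable u)
      finally show ?thesis by (simp add: algebra_simps)
    qed
    have "\<bar>\<integral>y. (u x - u y) * cell_ind j x y \<partial>M\<bar> \<le> (\<integral>y. \<bar>(u x - u y) * cell_ind j x y\<bar> \<partial>M)"
      by (rule integral_abs_bound)
    also have "\<dots> \<le> (\<integral>y. \<theta> * cell_ind j x y + c / \<theta> * diff_sq s u (x, y) \<partial>M)"
    proof (rule integral_mono)
      fix y
      have am: "\<bar>a\<bar> \<le> \<theta> + a\<^sup>2 / \<theta>" for a :: real
      proof -
        have "\<theta> * \<bar>a\<bar> \<le> \<theta>\<^sup>2 + a\<^sup>2" using \<theta> sum_squares_bound[of \<theta> "\<bar>a\<bar>"] by (simp add: mult.assoc) (smt (verit) mult_nonneg_nonneg abs_ge_zero)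
        then show ?thesis using \<theta> by (simp add: field_simps power2_eq_square)
      qed
      have "\<bar>(u x - u y) * cell_ind j x y\<bar> = \<bar>u x - u y\<bar> * cell_ind j x y"
        by (simp add: abs_mult cell_ind_bound)
      also have "\<dots> \<le> (\<theta> + (u x - u y)\<^sup>2 / \<theta>) * cell_ind j x y"
        by (intro mult_right_mono am cell_ind_bound)
      also have "\<dots> = \<theta> * cell_ind j x y + (u x - u y)\<^sup>2 / \<theta> * cell_ind j x y" by (simp add: algebra_simps)
      also have "(u x - u y)\<^sup>2 / \<theta> * cell_ind j x y \<le> c / \<theta> * diff_sq s u (x, y)"
      proof (cases "x = y")
        case False
        then have "(u x - u y)\<^sup>2 / \<theta> * cell_ind j x y \<le> (u x - u y)\<^sup>2 / \<theta> * (c * frac_kernel s x y)"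
          using ker \<theta> by (intro mult_left_mono) auto
        then show ?thesis by (simp add: diff_sq_def mult_ac)
      qed (simp add: diff_sq_def)
      finally show "\<bar>(u x - u y) * cell_ind j x y\<bar> \<le> \<theta> * cell_ind j x y + c / \<theta> * diff_sq s u (x, y)" by simp
    qed (use i1 x in \<open>auto intro!: cell_ind_integrable\<close>)
    also have "\<dots> = \<theta> * (\<integral>y. cell_ind j x y \<partial>M) + c / \<theta> * (\<integral>y. diff_sq s u (x, y) \<partial>M)"
      by (subst Bochner_Integration.integral_add) (use x cell_ind_integrable in auto)
    also have "\<dots> \<le> \<theta> + c / \<theta> * (\<integral>y. diff_sq s u (x, y) \<partial>M)"
      using mult_left_mono[OF integral_cell_ind_le[of j x], of \<theta>] \<theta> by simp
    finally have 2: "\<bar>\<integral>y. (u x - u y) * cell_ind j x y \<partial>M\<bar> \<le> \<theta> + c / \<theta> * (\<integral>y. diff_sq s u (x, y) \<partial>M)" .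
    have "\<bar>u x * (1 - (\<integral>y. cell_ind j x y \<partial>M))\<bar> \<le> 1 * (1 - (\<integral>y. cell_ind j x y \<partial>M))"
      unfolding abs_mult using u1[of x] integral_cell_ind_le[of j x] by (intro mult_mono) auto
    then have "\<bar>u x * (1 - (\<integral>y. cell_ind j x y \<partial>M))\<bar> \<le> 1 - (\<integral>y. cell_ind j x y \<partial>M)" by simp
    from add_mono[OF this 2] show ?thesis unfolding eq by (rule order_trans[OF abs_triangle_ineq])
  qed
  have li: "integrable M (\<lambda>x. 1 - (\<integral>y. cell_ind j x y \<partial>M))"
    by (rule M.integrable_const_bound[of _ 1]) (use integral_cell_ind_le nn in \<open>auto simp: abs_le_iff\<close>)
  have "L1_dist M u (cell_avg j u) \<le> (\<integral>x. (1 - (\<integral>y. cell_ind j x y \<partial>M)) + (\<theta> + c / \<theta> * (\<integral>y. diff_sq s u (x, y) \<partial>M)) \<partial>M)"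
  proof (rule integral_mono_AE)
    show "integrable M (\<lambda>x. \<bar>u x - cell_avg j u x\<bar>)" using M.unit_functions_integrable(2)[OF u cell_avg_unit[OF u]] .
    show "integrable M (\<lambda>x. (1 - (\<integral>y. cell_ind j x y \<partial>M)) + (\<theta> + c / \<theta> * (\<integral>y. diff_sq s u (x, y) \<partial>M)))"
      using li Dint by auto
    show "AE x in M. \<bar>u x - cell_avg j u x\<bar> \<le> (1 - (\<integral>y. cell_ind j x y \<partial>M)) + (\<theta> + c / \<theta> * (\<integral>y. diff_sq s u (x, y) \<partial>M))"
      using intx by eventually_elim (rule pt)
  qed
  also have "\<dots> = cell_loss j + (\<theta> * volume + c / \<theta> * seminorm s u)"
    using li Dint Deq by (simp add: cell_loss_def volume_def space_M)
  finally show ?thesis by (simp add: c_def algebra_simps)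
qed

text \<open>A diagonal sequence makes all of the countably many cell averages converge.  The averaged functions then
  converge in the mean for each cell size, and by the error estimate the sequence itself is a Cauchy
  sequence.\<close>

theorem fractional_rellich:
  fixes u :: "nat \<Rightarrow> 'a \<Rightarrow> real"
  assumes u: "\<And>n. u n \<in> U" "\<And>n. u n \<in> H_space s \<Omega>" and G: "\<And>n. seminorm s (u n) \<le> G" and s: "0 < s"
  shows "\<exists>r. strict_mono r \<and> (\<exists>v\<in>U. (\<lambda>n. L1_dist M (u (r n)) v) \<longlonglongrightarrow> 0)"
proof -
  obtain D :: "'a set" where D: "countable D" "\<And>V. open V \<Longrightarrow> V \<noteq> {} \<Longrightarrow> \<exists>d\<in>D. d \<in> V"
    using countable_dense_exists by blast
  have bd: "norm (cell_avg (fst p) (u n) (snd p)) \<le> 1" if "p \<in> UNIV \<times> D" for n p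
    using cell_avg_bound[OF u(1)] by simp
  have "countable (UNIV \<times> D :: (nat \<times> 'a) set)" using D(1) by simp
  then obtain r where r: "strict_mono r"
    "\<And>p. p \<in> UNIV \<times> D \<Longrightarrow> \<exists>l. (\<lambda>n. cell_avg (fst p) (u (r n)) (snd p)) \<longlonglongrightarrow> l"
    using function_convergent_subsequence[of "UNIV \<times> D" "\<lambda>n p. cell_avg (fst p) (u n) (snd p)" 1] bd by blast
  have conv: "\<exists>l. (\<lambda>n. cell_avg j (u (r n)) x) \<longlonglongrightarrow> l" for j x
  proof -
    obtain y where y: "y \<in> D" "dyadic_cell j x = dyadic_cell j y" using dyadic_cell_dense[of D j x] D(2) by blast
    then have "cell_avg j (u n) x = cell_avg j (u n) y" for n by (simp add: cell_avg_def cell_ind_def)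
    then show ?thesis using r(2)[of "(j, y)"] y(1) by simp
  qed
  define a where "a j x = lim (\<lambda>n. cell_avg j (u (r n)) x)" for j x
  have a_lim: "(\<lambda>n. cell_avg j (u (r n)) x) \<longlonglongrightarrow> a j x" for j x
    unfolding a_def using conv[of j x] by (simp add: convergent_LIMSEQ_iff[symmetric] convergent_def)
  have [measurable]: "u n \<in> borel_measurable M" for n using u(1) by (simp add: unit_functions_def)
  have a_U: "a j \<in> U" for j
    unfolding unit_functions_def
  proof (intro CollectI conjI allI)
    show "a j \<in> borel_measurable M" unfolding a_def[abs_def] by measurable
    show "\<bar>a j x\<bar> \<le> 1" for x
      by (rule LIMSEQ_le_const2[OF tendsto_rabs[OF a_lim]]) (use cell_avg_bound u in auto)
  qed
  have a_L1: "(\<lambda>n. L1_dist M (cell_avg j (u (r n))) (a j)) \<longlonglongrightarrow> 0" for j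
    by (rule M.L1_dist_dominated) (use cell_avg_unit u(1) a_U a_lim in auto)
  have "\<exists>v\<in>U. (\<lambda>n. L1_dist M (u (r n)) v) \<longlonglongrightarrow> 0"
  proof (rule M.L1_complete)
    show "u (r n) \<in> U" for n using u by simp
    fix e :: real assume e: "0 < e"
    \<comment> \<open>One half of the error budget \<open>e / 6\<close> of the averaging estimate is left for the terms that depend on the cell size.\<close>
    define \<theta> where "\<theta> = e / (12 * volume)"
    have \<theta>: "0 < \<theta>" "\<theta> * volume = e / 12" using e volume_pos by (auto simp: \<theta>_def)
    have G0: "0 \<le> G" using G[of 0] seminorm_nonneg order_trans by blast
    let ?c = "\<lambda>j. real DIM('a) powr (real DIM('a) + 2 * s) * (1 / 2 powr (2 * s)) ^ j"
    have "(\<lambda>j. cell_loss j + \<theta> * volume + G / \<theta> * ?c j) \<longlonglongrightarrow> 0 + \<theta> * volume + G / \<theta> * (real DIM('a) powr (real DIM('a) + 2 * s) * 0)"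
      by (intro tendsto_intros cell_loss_tendsto LIMSEQ_power_zero) (use s in simp)
    then have "\<forall>\<^sub>F j in sequentially. cell_loss j + \<theta> * volume + G / \<theta> * ?c j < e / 6"
      by (rule order_tendstoD(2)) (use \<theta>(2) e in simp)
    then obtain j where j: "cell_loss j + \<theta> * volume + G / \<theta> * ?c j < e / 6"
      by (auto simp: eventually_sequentially)
    have err: "L1_dist M (u n) (cell_avg j (u n)) < e / 6" for n
    proof -
      have "L1_dist M (u n) (cell_avg j (u n)) \<le> cell_loss j + \<theta> * volume + seminorm s (u n) / \<theta> * ?c j"
        using cell_avg_error[OF u(1,2) s \<theta>(1), of n j] by (simp add: power_one_over divide_inverse power_inverse)
      also have "\<dots> \<le> cell_loss j + \<theta> * volume + G / \<theta> * ?c j"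
        using G[of n] \<theta>(1) by (intro add_left_mono mult_right_mono divide_right_mono) auto
      also note j
      finally show ?thesis .
    qed
    obtain N where N: "\<And>n. n \<ge> N \<Longrightarrow> L1_dist M (cell_avg j (u (r n))) (a j) < e / 6"
      using order_tendstoD(2)[OF a_L1[of j], of "e / 6"] e by (auto simp: eventually_sequentially)
    have near: "L1_dist M (u (r n)) (a j) < e / 3" if "n \<ge> N" for n
      using M.L1_dist_triangle[OF u(1)[of "r n"] cell_avg_unit[OF u(1)[of "r n"], of j] a_U[of j]] err[of "r n"] N[OF that] by linarith
    have "L1_dist M (u (r m)) (u (r n)) < e" if "m \<ge> N" "n \<ge> N" for m n
    proof -
      have "L1_dist M (a j) (u (r n)) = L1_dist M (u (r n)) (a j)" by (simp add: abs_minus_commute)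
      then show ?thesis
        using M.L1_dist_triangle[OF u(1)[of "r m"] a_U[of j] u(1)[of "r n"]] near[OF that(1)] near[OF that(2)] e by linarith
    qed
    then show "\<exists>N. \<forall>m\<ge>N. \<forall>n\<ge>N. L1_dist M (u (r m)) (u (r n)) < e" by blast
  qed
  then show ?thesis using r(1) by blast
qed

end

section \<open>The quadratic form, the double well energy and lower semicontinuity\<close>

context bounded_open_set
begin

lemma H_space_borel: "u \<in> H_space s \<Omega> \<Longrightarrow> u \<in> borel_measurable M"
  by (simp add: H_space_def dom_M)

lemma H_space_square: "u \<in> H_space s \<Omega> \<Longrightarrow> integrable M (\<lambda>x. (u x)\<^sup>2)"
  by (simp add: H_space_def dom_M)

lemma add_square_le: "(a + b)\<^sup>2 \<le> 2 * a\<^sup>2 + 2 * (b::real)\<^sup>2"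
  using sum_squares_bound[of a b] by (simp add: power2_sum)

lemma H_space_lincomb:
  assumes "u \<in> H_space s \<Omega>" "v \<in> H_space s \<Omega>"
  shows "(\<lambda>x. a * u x + b * v x) \<in> H_space s \<Omega>"
proof -
  have [measurable]: "u \<in> borel_measurable M" "v \<in> borel_measurable M" using assms H_space_borel by auto
  have "integrable M (\<lambda>x. (a * u x + b * v x)\<^sup>2)"
  proof (rule Bochner_Integration.integrable_bound)
    show "integrable M (\<lambda>x. 2 * a\<^sup>2 * (u x)\<^sup>2 + 2 * b\<^sup>2 * (v x)\<^sup>2)"
      using assms H_space_square by auto
    show "AE x in M. norm ((a * u x + b * v x)\<^sup>2) \<le> norm (2 * a\<^sup>2 * (u x)\<^sup>2 + 2 * b\<^sup>2 * (v x)\<^sup>2)"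
      using add_square_le by (intro AE_I2) (simp add: power_mult_distrib[symmetric] mult.assoc)
  qed measurable
  moreover have "integrable (M \<Otimes>\<^sub>M M) (diff_sq s (\<lambda>x. a * u x + b * v x))"
  proof (rule Bochner_Integration.integrable_bound)
    show "integrable (M \<Otimes>\<^sub>M M) (\<lambda>p. 2 * a\<^sup>2 * diff_sq s u p + 2 * b\<^sup>2 * diff_sq s v p)"
      using assms H_space_diff_sq by auto
    show "AE p in M \<Otimes>\<^sub>M M. norm (diff_sq s (\<lambda>x. a * u x + b * v x) p) \<le> norm (2 * a\<^sup>2 * diff_sq s u p + 2 * b\<^sup>2 * diff_sq s v p)"
    proof (rule AE_I2)
      fix p :: "'a \<times> 'a"
      obtain x y where p: "p = (x, y)" by (cases p)
      have "(a * u x + b * v x - (a * u y + b * v y))\<^sup>2 \<le> 2 * (a * (u x - u y))\<^sup>2 + 2 * (b * (v x - v y))\<^sup>2"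
        using add_square_le[of "a * (u x - u y)" "b * (v x - v y)"] by (simp add: algebra_simps)
      then have "(a * u x + b * v x - (a * u y + b * v y))\<^sup>2 * frac_kernel s x y
         \<le> (2 * (a * (u x - u y))\<^sup>2 + 2 * (b * (v x - v y))\<^sup>2) * frac_kernel s x y"
        by (rule mult_right_mono) (rule frac_kernel_nonneg)
      also have "\<dots> = 2 * a\<^sup>2 * diff_sq s u p + 2 * b\<^sup>2 * diff_sq s v p"
        unfolding power_mult_distrib by (simp add: p diff_sq_def distrib_right mult.assoc)
      finally show "norm (diff_sq s (\<lambda>x. a * u x + b * v x) p) \<le> norm (2 * a\<^sup>2 * diff_sq s u p + 2 * b\<^sup>2 * diff_sq s v p)"
        by (simp add: p diff_sq_def abs_mult frac_kernel_nonneg)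
    qed
  qed measurable
  ultimately show ?thesis by (simp add: H_space_iff)
qed

lemma H_space_contraction:
  assumes u: "u \<in> H_space s \<Omega>" and [measurable]: "w \<in> borel_measurable M"
    and "\<And>x. \<bar>w x\<bar> \<le> \<bar>u x\<bar>" "\<And>x y. \<bar>w x - w y\<bar> \<le> \<bar>u x - u y\<bar>"
  shows "w \<in> H_space s \<Omega>" "seminorm s w \<le> seminorm s u"
proof -
  have [measurable]: "u \<in> borel_measurable M" using u H_space_borel by auto
  have le: "diff_sq s w p \<le> diff_sq s u p" for p
    using assms(4) by (auto simp: diff_sq_def abs_le_square_iff frac_kernel_nonneg intro!: mult_right_mono split: prod.split)
  have 1: "integrable M (\<lambda>x. (w x)\<^sup>2)"
    by (rule Bochner_Integration.integrable_bound[OF H_space_square[OF u]]) (use assms(3) in \<open>auto simp: abs_le_square_iff\<close>)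
  have 2: "integrable (M \<Otimes>\<^sub>M M) (diff_sq s w)"
    by (rule Bochner_Integration.integrable_bound[OF H_space_diff_sq[OF u]]) (use le diff_sq_nonneg in \<open>auto simp: abs_of_nonneg\<close>)
  show "w \<in> H_space s \<Omega>" using 1 2 by (simp add: H_space_iff)
  show "seminorm s w \<le> seminorm s u"
    unfolding seminorm_def by (rule integral_mono[OF 2 H_space_diff_sq[OF u]]) (rule le)
qed

lemma H_space_const: "(\<lambda>_. c) \<in> H_space s \<Omega>"
proof -
  have "diff_sq s (\<lambda>_. c) = (\<lambda>_. 0)" by (auto simp: diff_sq_def fun_eq_iff)
  then show ?thesis by (simp add: H_space_iff)
qed

lemma frac_form_eq: "frac_form s \<Omega> u v = (\<integral>p. (u (fst p) - u (snd p)) * (v (fst p) - v (snd p)) * frac_kernel s (fst p) (snd p) \<partial>(M \<Otimes>\<^sub>M M))"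
  unfolding frac_form_def dom_M by (rule Bochner_Integration.integral_cong) auto

lemma frac_form_integrable:
  assumes "u \<in> H_space s \<Omega>" "v \<in> H_space s \<Omega>"
  shows "integrable (M \<Otimes>\<^sub>M M) (\<lambda>p. (u (fst p) - u (snd p)) * (v (fst p) - v (snd p)) * frac_kernel s (fst p) (snd p))"
proof (rule Bochner_Integration.integrable_bound)
  have [measurable]: "u \<in> borel_measurable M" "v \<in> borel_measurable M" using assms H_space_borel by auto
  show "(\<lambda>p. (u (fst p) - u (snd p)) * (v (fst p) - v (snd p)) * frac_kernel s (fst p) (snd p)) \<in> borel_measurable (M \<Otimes>\<^sub>M M)"
    by measurable
  show "integrable (M \<Otimes>\<^sub>M M) (\<lambda>p. diff_sq s u p + diff_sq s v p)" using assms H_space_diff_sq by auto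
  show "AE p in M \<Otimes>\<^sub>M M. norm ((u (fst p) - u (snd p)) * (v (fst p) - v (snd p)) * frac_kernel s (fst p) (snd p)) \<le> norm (diff_sq s u p + diff_sq s v p)"
  proof (rule AE_I2)
    fix p :: "'a \<times> 'a"
    obtain x y where p: "p = (x, y)" by (cases p)
    have ab: "\<bar>a * b\<bar> \<le> a\<^sup>2 + b\<^sup>2" for a b :: real
    proof -
      have "2 * (\<bar>a\<bar> * \<bar>b\<bar>) \<le> a\<^sup>2 + b\<^sup>2" using sum_squares_bound[of "\<bar>a\<bar>" "\<bar>b\<bar>"] by (simp add: mult.assoc)
      moreover have "0 \<le> \<bar>a\<bar> * \<bar>b\<bar>" by simp
      ultimately show ?thesis unfolding abs_mult by linarith
    qed
    have "\<bar>(u x - u y) * (v x - v y)\<bar> * frac_kernel s x y \<le> ((u x - u y)\<^sup>2 + (v x - v y)\<^sup>2) * frac_kernel s x y"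
      by (intro mult_right_mono ab frac_kernel_nonneg)
    moreover have "norm ((u x - u y) * (v x - v y) * frac_kernel s x y) = \<bar>(u x - u y) * (v x - v y)\<bar> * frac_kernel s x y"
      by (simp add: abs_mult frac_kernel_nonneg)
    moreover have "((u x - u y)\<^sup>2 + (v x - v y)\<^sup>2) * frac_kernel s x y \<le> norm (diff_sq s u p + diff_sq s v p)"
      by (simp add: p diff_sq_def distrib_right)
    ultimately show "norm ((u (fst p) - u (snd p)) * (v (fst p) - v (snd p)) * frac_kernel s (fst p) (snd p)) \<le> norm (diff_sq s u p + diff_sq s v p)"
      unfolding p fst_conv snd_conv by linarith
  qed
qed

lemma seminorm_add:
  assumes "u \<in> H_space s \<Omega>" "v \<in> H_space s \<Omega>"
  shows "seminorm s (\<lambda>x. u x + t * v x) = seminorm s u + 2 * t * frac_form s \<Omega> u v + t\<^sup>2 * seminorm s v"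
proof -
  let ?f = "\<lambda>p. (u (fst p) - u (snd p)) * (v (fst p) - v (snd p)) * frac_kernel s (fst p) (snd p)"
  have "diff_sq s (\<lambda>x. u x + t * v x) = (\<lambda>p. diff_sq s u p + 2 * t * ?f p + t\<^sup>2 * diff_sq s v p)"
    by (auto simp: diff_sq_def fun_eq_iff power2_eq_square algebra_simps)
  then show ?thesis unfolding seminorm_def frac_form_eq
    using H_space_diff_sq[OF assms(1)] H_space_diff_sq[OF assms(2)] frac_form_integrable[OF assms] by simp
qed

lemma seminorm_uminus: "seminorm s (\<lambda>x. - u x) = seminorm s u"
  unfolding seminorm_def diff_sq_def by (simp add: power2_commute)

lemma seminorm_midpoint:
  assumes "u \<in> H_space s \<Omega>" "v \<in> H_space s \<Omega>"
  shows "seminorm s (\<lambda>x. (u x + v x) / 2) \<le> (seminorm s u + seminorm s v) / 2"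
proof -
  have "integrable (M \<Otimes>\<^sub>M M) (diff_sq s (\<lambda>x. (1/2) * u x + (1/2) * v x))"
    by (intro H_space_diff_sq H_space_lincomb assms)
  then have i: "integrable (M \<Otimes>\<^sub>M M) (diff_sq s (\<lambda>x. (u x + v x) / 2))" by (simp add: add_divide_distrib)
  have "seminorm s (\<lambda>x. (u x + v x) / 2) \<le> (\<integral>p. diff_sq s u p / 2 + diff_sq s v p / 2 \<partial>(M \<Otimes>\<^sub>M M))"
    unfolding seminorm_def
  proof (rule integral_mono[OF i])
    fix p :: "'a \<times> 'a"
    obtain x y where p: "p = (x, y)" by (cases p)
    have "((u x + v x) / 2 - (u y + v y) / 2)\<^sup>2 = ((u x - u y) / 2 + (v x - v y) / 2)\<^sup>2" by (simp add: field_simps)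
    also have "\<dots> \<le> (u x - u y)\<^sup>2 / 2 + (v x - v y)\<^sup>2 / 2"
      using add_square_le[of "(u x - u y) / 2" "(v x - v y) / 2"] by (simp add: power_divide)
    finally have "((u x + v x) / 2 - (u y + v y) / 2)\<^sup>2 * frac_kernel s x y \<le> ((u x - u y)\<^sup>2 / 2 + (v x - v y)\<^sup>2 / 2) * frac_kernel s x y"
      by (rule mult_right_mono) (rule frac_kernel_nonneg)
    then show "diff_sq s (\<lambda>x. (u x + v x) / 2) p \<le> diff_sq s u p / 2 + diff_sq s v p / 2"
      by (simp add: p diff_sq_def algebra_simps)
  qed (use assms H_space_diff_sq in auto)
  also have "\<dots> = (seminorm s u + seminorm s v) / 2"
    unfolding seminorm_def using assms H_space_diff_sq by (simp add: add_divide_distrib)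
  finally show ?thesis .
qed

text \<open>A null set times the whole space is a null set of the product.\<close>

lemma AE_pair_of_AE:
  assumes "AE x in M. P x" shows "AE p in M \<Otimes>\<^sub>M M. P (fst p) \<and> P (snd p)"
proof -
  obtain N where N: "{x \<in> space M. \<not> P x} \<subseteq> N" "emeasure M N = 0" "N \<in> sets M" using AE_E[OF assms] by blast
  have ae: "AE x in M. x \<notin> N" by (rule AE_I'[of N]) (use N in \<open>auto simp: null_sets_def\<close>)
  have [measurable]: "Measurable.pred M (\<lambda>x. x \<notin> N)" using N(3) by measurable
  have "AE p in M \<Otimes>\<^sub>M M. fst p \<notin> N \<and> snd p \<notin> N"
  proof (rule MM.AE_pair_measure)
    show "{p \<in> space (M \<Otimes>\<^sub>M M). fst p \<notin> N \<and> snd p \<notin> N} \<in> sets (M \<Otimes>\<^sub>M M)" using N(3) by measurable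
    show "AE x in M. AE y in M. fst (x, y) \<notin> N \<and> snd (x, y) \<notin> N" using ae by eventually_elim (use ae in auto)
  qed
  then show ?thesis
  proof (rule AE_mp, intro AE_I2 impI)
    fix p assume "p \<in> space (M \<Otimes>\<^sub>M M)" "fst p \<notin> N \<and> snd p \<notin> N"
    then show "P (fst p) \<and> P (snd p)" using N(1) by (auto simp: space_pair_measure)
  qed
qed

lemma seminorm_lsc:
  fixes u :: "nat \<Rightarrow> 'a \<Rightarrow> real"
  assumes u: "\<And>n. u n \<in> H_space s \<Omega>" and G: "\<And>n. seminorm s (u n) \<le> G"
    and v: "v \<in> U" and ae: "AE x in M. (\<lambda>n. u n x) \<longlonglongrightarrow> v x"
  shows "v \<in> H_space s \<Omega>" "seminorm s v \<le> G"
proof -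
  have [measurable]: "u n \<in> borel_measurable M" for n using u H_space_borel by auto
  have [measurable]: "v \<in> borel_measurable M" using v by (simp add: unit_functions_def)
  have "(\<integral>\<^sup>+p. ennreal (diff_sq s v p) \<partial>(M \<Otimes>\<^sub>M M)) = (\<integral>\<^sup>+p. liminf (\<lambda>n. ennreal (diff_sq s (u n) p)) \<partial>(M \<Otimes>\<^sub>M M))"
  proof (rule nn_integral_cong_AE)
    show "AE p in M \<Otimes>\<^sub>M M. ennreal (diff_sq s v p) = liminf (\<lambda>n. ennreal (diff_sq s (u n) p))"
      using AE_pair_of_AE[OF ae]
    proof eventually_elim
      case (elim p)
      then have "(\<lambda>n. (u n (fst p) - u n (snd p))\<^sup>2 * frac_kernel s (fst p) (snd p)) \<longlonglongrightarrow> (v (fst p) - v (snd p))\<^sup>2 * frac_kernel s (fst p) (snd p)"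
        by (intro tendsto_intros) auto
      then have "(\<lambda>n. ennreal (diff_sq s (u n) p)) \<longlonglongrightarrow> ennreal (diff_sq s v p)"
        by (intro tendsto_ennrealI) (simp add: diff_sq_def case_prod_beta)
      from lim_imp_Liminf[OF _ this] show ?case by simp
    qed
  qed
  also have "\<dots> \<le> liminf (\<lambda>n. \<integral>\<^sup>+p. ennreal (diff_sq s (u n) p) \<partial>(M \<Otimes>\<^sub>M M))"
    by (rule nn_integral_liminf) measurable
  also have "\<dots> \<le> ennreal G"
  proof -
    have "(\<integral>\<^sup>+p. ennreal (diff_sq s (u n) p) \<partial>(M \<Otimes>\<^sub>M M)) \<le> ennreal G" for n
      using frac_seminorm_sq_seminorm[OF u] G by (simp add: frac_seminorm_sq_eq ennreal_leI)
    then show ?thesis by (intro Liminf_le) (auto intro: always_eventually)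
  qed
  finally have fin: "(\<integral>\<^sup>+p. ennreal (diff_sq s v p) \<partial>(M \<Otimes>\<^sub>M M)) \<le> ennreal G" .
  have G0: "0 \<le> G" using G[of 0] seminorm_nonneg order_trans by blast
  have "integrable (M \<Otimes>\<^sub>M M) (diff_sq s v)"
    by (rule integrableI_nonneg) (use fin diff_sq_nonneg in \<open>auto intro: le_less_trans\<close>)
  moreover have "integrable M (\<lambda>x. (v x)\<^sup>2)"
    by (rule M.integrable_const_bound[of _ 1]) (use v in \<open>auto simp: unit_functions_def abs_square_le_1\<close>)
  ultimately show H: "v \<in> H_space s \<Omega>" by (simp add: H_space_iff)
  show "seminorm s v \<le> G"
    using fin frac_seminorm_sq_seminorm[OF H] G0 by (simp add: frac_seminorm_sq_eq)
qed

end

text \<open>The projection of the line to the interval of admissible values.\<close>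

definition clip :: "real \<Rightarrow> real" where "clip t = max (-1) (min 1 t)"

lemma clip_props: "\<bar>clip t\<bar> \<le> 1" "\<bar>clip t\<bar> \<le> \<bar>t\<bar>" "\<bar>clip a - clip b\<bar> \<le> \<bar>a - b\<bar>" "\<bar>t\<bar> \<le> 1 \<Longrightarrow> clip t = t"
  by (auto simp: clip_def abs_le_iff max_def min_def)

lemma clip_measurable [measurable]: "clip \<in> borel_measurable borel"
  unfolding clip_def by measurable

text \<open>Apart from continuity, sign and symmetry, the potential enters through two inequalities on \<open>[-1,1]\<close>.  The first one says that it becomes
  midpoint convex after adding \<open>L / 2\<close> times the square.  The second one is a first-order expansion
  that remains true when the increment is clipped.\<close>

locale double_well = bounded_open_set \<Omega> for \<Omega> :: "'a::euclidean_space set" +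
  fixes s A B L :: real and W :: "real \<Rightarrow> real"
  assumes s: "0 < s" and A: "0 < A" and B: "0 < B" and L: "0 \<le> L"
    and W_cont: "continuous_on UNIV W" and dW_cont: "continuous_on UNIV (deriv W)"
    and W_nonneg: "\<And>t. 0 \<le> W t" and W_even: "\<And>t. W (- t) = W t"
    and W_mid: "\<And>a b. \<bar>a\<bar> \<le> 1 \<Longrightarrow> \<bar>b\<bar> \<le> 1 \<Longrightarrow> W ((a + b) / 2) \<le> (W a + W b) / 2 + L / 8 * (a - b)\<^sup>2"
    and W_taylor: "\<And>a h. \<bar>a\<bar> \<le> 1 \<Longrightarrow> W (clip (a + h)) \<le> W a + deriv W a * h + L * h\<^sup>2"
begin

definition K :: "('a \<Rightarrow> real) set" where "K = U \<inter> H_space s \<Omega>"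

definition E :: "('a \<Rightarrow> real) \<Rightarrow> real" where
  "E u = A * seminorm s u + B * (\<integral>x. W (u x) \<partial>M)"

definition sqdist :: "('a \<Rightarrow> real) \<Rightarrow> ('a \<Rightarrow> real) \<Rightarrow> real" where
  "sqdist u v = (\<integral>x. (u x - v x)\<^sup>2 \<partial>M)"

lemma W_measurable [measurable]: "W \<in> borel_measurable borel" "deriv W \<in> borel_measurable borel"
  using W_cont dW_cont by (auto intro: borel_measurable_continuous_onI)

lemma W_bounded: "\<exists>C. \<forall>t. \<bar>t\<bar> \<le> 1 \<longrightarrow> \<bar>W t\<bar> \<le> C \<and> \<bar>deriv W t\<bar> \<le> C"
proof -
  have "compact (W ` {-1..1})" "compact (deriv W ` {-1..1})"
    using W_cont dW_cont by (auto intro!: compact_continuous_image intro: continuous_on_subset)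
  then obtain C1 C2 where "\<forall>x\<in>W ` {-1..1}. norm x \<le> C1" "\<forall>x\<in>deriv W ` {-1..1}. norm x \<le> C2"
    using compact_imp_bounded bounded_iff by metis
  then have "\<bar>W t\<bar> \<le> C1 \<and> \<bar>deriv W t\<bar> \<le> C2" if "\<bar>t\<bar> \<le> 1" for t
    using that by (auto simp: abs_le_iff)
  then show ?thesis by (intro exI[of _ "max C1 C2"]) (auto simp: le_max_iff_disj)
qed

lemma W_integrable: "u \<in> U \<Longrightarrow> integrable M (\<lambda>x. W (u x))"
proof -
  assume u: "u \<in> U"
  then have [measurable]: "u \<in> borel_measurable M" by (simp add: unit_functions_def)
  obtain C where C: "\<forall>t. \<bar>t\<bar> \<le> 1 \<longrightarrow> \<bar>W t\<bar> \<le> C \<and> \<bar>deriv W t\<bar> \<le> C" using W_bounded by blast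
  show ?thesis
    by (rule M.integrable_const_bound[of _ C]) (use C u in \<open>auto simp: unit_functions_def\<close>)
qed

lemma K_D: "u \<in> K \<Longrightarrow> u \<in> U" "u \<in> K \<Longrightarrow> u \<in> H_space s \<Omega>" by (auto simp: K_def)

lemma E_nonneg: "0 \<le> E u"
  unfolding E_def using A B seminorm_nonneg W_nonneg by (intro add_nonneg_nonneg mult_nonneg_nonneg) auto

lemma seminorm_le_E: "seminorm s u \<le> E u / A"
  unfolding E_def using A B W_nonneg by (simp add: field_simps)

lemma U_uminus: "u \<in> U \<Longrightarrow> (\<lambda>x. - u x) \<in> U" by (simp add: unit_functions_def)

lemma K_uminus: "u \<in> K \<Longrightarrow> (\<lambda>x. - u x) \<in> K"
  using H_space_lincomb[of u s u "-1" 0] U_uminus by (auto simp: K_def)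

lemma E_uminus: "E (\<lambda>x. - u x) = E u"
  by (simp add: E_def seminorm_uminus W_even)

lemma K_midpoint: assumes "u \<in> K" "v \<in> K" shows "(\<lambda>x. (u x + v x) / 2) \<in> K"
proof -
  have "\<bar>(u x + v x) / 2\<bar> \<le> 1" for x
  proof -
    have "\<bar>u x\<bar> \<le> 1" "\<bar>v x\<bar> \<le> 1" using assms by (auto simp: K_def unit_functions_def)
    then have "\<bar>u x + v x\<bar> \<le> 2" by linarith
    then show ?thesis by simp
  qed
  moreover have "(\<lambda>x. (u x + v x) / 2) \<in> H_space s \<Omega>"
    using H_space_lincomb[OF K_D(2)[OF assms(1)] K_D(2)[OF assms(2)], of "1/2" "1/2"] by (simp add: add_divide_distrib)
  ultimately show ?thesis using H_space_borel by (auto simp: K_def unit_functions_def)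
qed

lemma K_zero: "(\<lambda>_. 0) \<in> K" using H_space_const by (simp add: K_def unit_functions_def)

lemma K_clip: assumes "u \<in> H_space s \<Omega>"
  shows "(\<lambda>x. clip (u x)) \<in> K" "seminorm s (\<lambda>x. clip (u x)) \<le> seminorm s u"
proof -
  have [measurable]: "u \<in> borel_measurable M" using assms by (rule H_space_borel)
  have "(\<lambda>x. clip (u x)) \<in> H_space s \<Omega>" "seminorm s (\<lambda>x. clip (u x)) \<le> seminorm s u"
    by (rule H_space_contraction[OF assms]; simp add: clip_props)+
  then show "(\<lambda>x. clip (u x)) \<in> K" "seminorm s (\<lambda>x. clip (u x)) \<le> seminorm s u"
    by (auto simp: K_def unit_functions_def clip_props)
qed

lemma sqdist_le: assumes "u \<in> U" "v \<in> U" shows "sqdist u v \<le> 2 * L1_dist M u v"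
proof -
  have "(u x - v x)\<^sup>2 \<le> 2 * \<bar>u x - v x\<bar>" for x
  proof -
    have "\<bar>u x\<bar> \<le> 1" "\<bar>v x\<bar> \<le> 1" using assms by (auto simp: unit_functions_def)
    then have "\<bar>u x - v x\<bar> * \<bar>u x - v x\<bar> \<le> 2 * \<bar>u x - v x\<bar>" by (intro mult_right_mono) linarith+
    then show ?thesis by (simp add: power2_eq_square flip: abs_mult)
  qed
  then have "sqdist u v \<le> (\<integral>x. 2 * \<bar>u x - v x\<bar> \<partial>M)"
    unfolding sqdist_def using M.unit_functions_integrable[OF assms] by (intro integral_mono) auto
  then show ?thesis by simp
qed

text \<open>The variance of the absolute difference is not negative.\<close>

lemma L1_dist_sq_le: assumes "u \<in> U" "v \<in> U" shows "(L1_dist M u v)\<^sup>2 \<le> volume * sqdist u v"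
proof -
  define m where "m = L1_dist M u v / volume"
  note i = M.unit_functions_integrable[OF assms]
  have "0 \<le> (\<integral>x. (\<bar>u x - v x\<bar> - m)\<^sup>2 \<partial>M)" by simp
  also have "\<dots> = (\<integral>x. (u x - v x)\<^sup>2 - 2 * m * \<bar>u x - v x\<bar> + m\<^sup>2 \<partial>M)"
    by (simp add: power2_diff algebra_simps)
  also have "\<dots> = sqdist u v - 2 * m * L1_dist M u v + m\<^sup>2 * volume"
    using i by (simp add: sqdist_def volume_def space_M)
  also have "\<dots> = sqdist u v - (L1_dist M u v)\<^sup>2 / volume"
    using volume_pos by (simp add: m_def power2_eq_square field_simps)
  finally show ?thesis using volume_pos by (simp add: field_simps)
qed

lemma sqdist_nonneg: "0 \<le> sqdist u v" by (simp add: sqdist_def)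

lemma sqdist_diff_le: assumes "u \<in> U" "v \<in> U" "w \<in> U"
  shows "\<bar>sqdist u w - sqdist v w\<bar> \<le> 4 * L1_dist M u v"
proof -
  note i = M.unit_functions_integrable
  have "\<bar>(u x - w x)\<^sup>2 - (v x - w x)\<^sup>2\<bar> \<le> 4 * \<bar>u x - v x\<bar>" for x
  proof -
    have b: "\<bar>u x\<bar> \<le> 1" "\<bar>v x\<bar> \<le> 1" "\<bar>w x\<bar> \<le> 1" using assms by (auto simp: unit_functions_def)
    have "(u x - w x)\<^sup>2 - (v x - w x)\<^sup>2 = (u x + v x - 2 * w x) * (u x - v x)" by (simp add: power2_eq_square algebra_simps)
    moreover have "\<bar>u x + v x - 2 * w x\<bar> * \<bar>u x - v x\<bar> \<le> 4 * \<bar>u x - v x\<bar>" using b by (intro mult_right_mono) linarith+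
    ultimately show ?thesis by (simp add: abs_mult)
  qed
  then have "(\<integral>x. \<bar>(u x - w x)\<^sup>2 - (v x - w x)\<^sup>2\<bar> \<partial>M) \<le> (\<integral>x. 4 * \<bar>u x - v x\<bar> \<partial>M)"
    using i(3)[OF assms(1,3)] i(3)[OF assms(2,3)] i(2)[OF assms(1,2)] by (intro integral_mono) auto
  moreover have "\<bar>sqdist u w - sqdist v w\<bar> \<le> (\<integral>x. \<bar>(u x - w x)\<^sup>2 - (v x - w x)\<^sup>2\<bar> \<partial>M)"
    unfolding sqdist_def Bochner_Integration.integral_diff[OF i(3)[OF assms(1,3)] i(3)[OF assms(2,3)], symmetric]
    by (rule integral_abs_bound)
  ultimately show ?thesis by simp
qed

text \<open>The seminorm is lower semicontinuous by Fatou's lemma, and the potential term is continuous by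
  dominated convergence.\<close>

lemma E_lsc:
  fixes u :: "nat \<Rightarrow> 'a \<Rightarrow> real"
  assumes u: "\<And>n. u n \<in> K" and c: "\<And>\<delta>. 0 < \<delta> \<Longrightarrow> \<forall>\<^sub>F n in sequentially. E (u n) \<le> c + \<delta>"
    and v: "v \<in> U" and lim: "(\<lambda>n. L1_dist M (u n) v) \<longlonglongrightarrow> 0"
  shows "v \<in> K" "E v \<le> c"
proof -
  have uU: "u n \<in> U" "u n \<in> H_space s \<Omega>" for n using u by (auto simp: K_def)
  have [measurable]: "u n \<in> borel_measurable M" "v \<in> borel_measurable M" for n using uU v by (auto simp: unit_functions_def)
  obtain r where r: "strict_mono r" "AE x in M. (\<lambda>n. u (r n) x) \<longlonglongrightarrow> v x"
    using M.L1_AE_subseq[OF uU(1) v lim] by blast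
  obtain C where C: "\<forall>t. \<bar>t\<bar> \<le> 1 \<longrightarrow> \<bar>W t\<bar> \<le> C \<and> \<bar>deriv W t\<bar> \<le> C" using W_bounded by blast
  have Wlim: "(\<lambda>n. \<integral>x. W (u (r n) x) \<partial>M) \<longlonglongrightarrow> (\<integral>x. W (v x) \<partial>M)"
  proof (rule integral_dominated_convergence[where w = "\<lambda>_. C"])
    show "AE x in M. (\<lambda>n. W (u (r n) x)) \<longlonglongrightarrow> W (v x)"
      using r(2) by eventually_elim (use W_cont in \<open>auto intro!: isCont_tendsto_compose[of _ W] simp: continuous_on_eq_continuous_at\<close>)
    show "AE x in M. norm (W (u (r n) x)) \<le> C" for n
      using C uU by (auto simp: unit_functions_def)
  qed auto
  let ?w = "\<integral>x. W (v x) \<partial>M"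
  have key: "v \<in> H_space s \<Omega> \<and> seminorm s v \<le> (c - B * ?w + \<delta>) / A" if \<delta>: "0 < \<delta>" for \<delta>
  proof -
    have "\<forall>\<^sub>F n in sequentially. ?w - \<delta> / (2 * B) < (\<integral>x. W (u (r n) x) \<partial>M)"
      by (rule order_tendstoD(1)[OF Wlim]) (use B \<delta> in simp)
    moreover have "\<forall>\<^sub>F n in sequentially. E (u (r n)) \<le> c + \<delta> / 2"
      using eventually_subseq[OF r(1) c[of "\<delta> / 2"]] \<delta> by simp
    ultimately have "\<forall>\<^sub>F n in sequentially. seminorm s (u (r n)) \<le> (c - B * ?w + \<delta>) / A"
    proof eventually_elim
      case (elim n)
      have "B * (?w - \<delta> / (2 * B)) \<le> B * (\<integral>x. W (u (r n) x) \<partial>M)" using elim(1) B by (intro mult_left_mono) auto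
      then have "B * ?w - \<delta> / 2 \<le> B * (\<integral>x. W (u (r n) x) \<partial>M)" using B by (simp add: right_diff_distrib)
      then have "A * seminorm s (u (r n)) \<le> c - B * ?w + \<delta>" using elim(2) unfolding E_def by linarith
      then show ?case using A by (simp add: pos_le_divide_eq mult.commute)
    qed
    then obtain N where N: "\<And>n. n \<ge> N \<Longrightarrow> seminorm s (u (r n)) \<le> (c - B * ?w + \<delta>) / A"
      by (auto simp: eventually_sequentially)
    have ae: "AE x in M. (\<lambda>n. u (r (n + N)) x) \<longlonglongrightarrow> v x"
      using r(2) by eventually_elim (rule LIMSEQ_ignore_initial_segment)
    show ?thesis using seminorm_lsc[of "\<lambda>n. u (r (n + N))" s, OF uU(2) N v ae] by simp
  qed
  have H: "v \<in> H_space s \<Omega>" using key[of 1] by simp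
  then show "v \<in> K" using v by (simp add: K_def)
  have "A * seminorm s v \<le> (c - B * ?w) + \<delta>" if "0 < \<delta>" for \<delta>
    using key[OF that] A by (simp add: pos_le_divide_eq mult.commute)
  then have "A * seminorm s v \<le> c - B * ?w" by (rule field_le_epsilon)
  then show "E v \<le> c" by (simp add: E_def)
qed

lemma E_midpoint:
  assumes "u \<in> K" "v \<in> K"
  shows "E (\<lambda>x. (u x + v x) / 2) \<le> (E u + E v) / 2 + B * L / 8 * sqdist u v"
proof -
  have b: "\<bar>u x\<bar> \<le> 1" "\<bar>v x\<bar> \<le> 1" for x using assms by (auto simp: K_def unit_functions_def)
  note i = W_integrable[OF K_D(1)[OF assms(1)]] W_integrable[OF K_D(1)[OF assms(2)]] W_integrable[OF K_D(1)[OF K_midpoint[OF assms]]]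
    M.unit_functions_integrable(3)[OF K_D(1)[OF assms(1)] K_D(1)[OF assms(2)]]
  have "(\<integral>x. W ((u x + v x) / 2) \<partial>M) \<le> (\<integral>x. (W (u x) + W (v x)) / 2 + L / 8 * (u x - v x)\<^sup>2 \<partial>M)"
    using i by (intro integral_mono W_mid b) auto
  also have "\<dots> = ((\<integral>x. W (u x) \<partial>M) + (\<integral>x. W (v x) \<partial>M)) / 2 + L / 8 * sqdist u v"
    using i by (simp add: sqdist_def)
  finally have "B * (\<integral>x. W ((u x + v x) / 2) \<partial>M) \<le> B * (((\<integral>x. W (u x) \<partial>M) + (\<integral>x. W (v x) \<partial>M)) / 2 + L / 8 * sqdist u v)"
    using B by (intro mult_left_mono) auto
  moreover have "A * seminorm s (\<lambda>x. (u x + v x) / 2) \<le> A * ((seminorm s u + seminorm s v) / 2)"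
    using A seminorm_midpoint assms by (intro mult_left_mono) (auto simp: K_def)
  ultimately show ?thesis unfolding E_def by (simp add: field_simps)
qed

end

section \<open>The resolvent of the energy and its fixed points\<close>

context double_well
begin

text \<open>With this value the defect of midpoint convexity of \<open>J u\<close> is at least \<open>sqdist\<close>: the potential
  contributes at worst \<open>- B L / 8\<close> and the penalty \<open>\<tau> / 4\<close>.\<close>

definition \<tau> :: real where "\<tau> = B * L / 2 + 4"

lemma \<tau>_pos: "0 < \<tau>" using B L by (simp add: \<tau>_def add_nonneg_pos)

text \<open>A step of the minimizing movement scheme of \<open>E\<close> from \<open>u\<close> minimizes \<open>J u\<close>.\<close>

definition J :: "('a \<Rightarrow> real) \<Rightarrow> ('a \<Rightarrow> real) \<Rightarrow> real" where
  "J u v = E v + \<tau> * sqdist v u"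

lemma J_nonneg: "0 \<le> J u v"
  unfolding J_def using E_nonneg sqdist_nonneg \<tau>_pos by (intro add_nonneg_nonneg mult_nonneg_nonneg) (auto simp: less_imp_le)

lemma J_midpoint:
  assumes u: "u \<in> U" and v: "v \<in> K" "w \<in> K"
  shows "J u (\<lambda>x. (v x + w x) / 2) \<le> (J u v + J u w) / 2 - sqdist v w"
proof -
  note i = M.unit_functions_integrable(3)
  have "sqdist (\<lambda>x. (v x + w x) / 2) u = (\<integral>x. (v x - u x)\<^sup>2 / 2 + (w x - u x)\<^sup>2 / 2 - (v x - w x)\<^sup>2 / 4 \<partial>M)"
    unfolding sqdist_def by (rule Bochner_Integration.integral_cong) (auto simp: power2_eq_square field_simps)
  also have "\<dots> = (sqdist v u + sqdist w u) / 2 - sqdist v w / 4"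
    using i[OF K_D(1)[OF v(1)] u] i[OF K_D(1)[OF v(2)] u] i[OF K_D(1)[OF v(1)] K_D(1)[OF v(2)]]
    by (simp add: sqdist_def)
  finally have "J u (\<lambda>x. (v x + w x) / 2) \<le> (E v + E w) / 2 + B * L / 8 * sqdist v w + \<tau> * ((sqdist v u + sqdist w u) / 2 - sqdist v w / 4)"
    using E_midpoint[OF v] by (simp add: J_def)
  also have "\<dots> = (J u v + J u w) / 2 - sqdist v w"
    by (simp add: J_def \<tau>_def field_simps)
  finally show ?thesis .
qed

lemma Cauchy_of_sqdist:
  fixes v :: "nat \<Rightarrow> 'a \<Rightarrow> real"
  assumes v: "\<And>n. v n \<in> U" and q: "\<And>m n. sqdist (v m) (v n) \<le> 1 / real (Suc m) + 1 / real (Suc n)" and e: "0 < e"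
  shows "\<exists>N. \<forall>m\<ge>N. \<forall>n\<ge>N. L1_dist M (v m) (v n) < e"
proof -
  have "(\<lambda>n. volume * (2 / real (Suc n))) \<longlonglongrightarrow> volume * 0"
    using tendsto_mult[OF tendsto_const[of 2] LIMSEQ_inverse_real_of_nat] by (intro tendsto_mult tendsto_const) (simp add: divide_inverse)
  then have "\<forall>\<^sub>F n in sequentially. volume * (2 / real (Suc n)) < e\<^sup>2" by (rule order_tendstoD(2)) (use e in simp)
  then obtain N where N: "volume * (2 / real (Suc N)) < e\<^sup>2" by (auto simp: eventually_sequentially)
  have "L1_dist M (v m) (v n) < e" if "m \<ge> N" "n \<ge> N" for m n
  proof -
    have "1 / real (Suc m) \<le> 1 / real (Suc N)" "1 / real (Suc n) \<le> 1 / real (Suc N)"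
      using that by (auto intro!: divide_left_mono)
    then have "sqdist (v m) (v n) \<le> 2 / real (Suc N)" using q[of m n] by simp
    then have "volume * sqdist (v m) (v n) \<le> volume * (2 / real (Suc N))" using volume_pos by (intro mult_left_mono) auto
    then have "(L1_dist M (v m) (v n))\<^sup>2 < e\<^sup>2" using L1_dist_sq_le[OF v v, of m n] N by linarith
    then show ?thesis by (rule power2_less_imp_less) (use e in simp)
  qed
  then show ?thesis by blast
qed

text \<open>By strong midpoint convexity a minimizing sequence is a Cauchy sequence.\<close>

lemma J_minimizer_exists:
  assumes u: "u \<in> U" shows "\<exists>v\<in>K. \<forall>w\<in>K. J u v \<le> J u w"
proof -
  define I where "I = Inf (J u ` K)"
  have bdd: "bdd_below (J u ` K)" using J_nonneg by (intro bdd_belowI[of _ 0]) auto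
  have ne: "J u ` K \<noteq> {}" using K_zero by auto
  have I: "I \<le> J u w" if "w \<in> K" for w unfolding I_def using bdd that by (intro cInf_lower) auto
  have "\<exists>v\<in>K. J u v < I + 1 / real (Suc n)" for n
    using cInf_lessD[OF ne, of "I + 1 / real (Suc n)"] by (auto simp: I_def)
  then obtain v where v: "\<And>n. v n \<in> K" "\<And>n. J u (v n) < I + 1 / real (Suc n)" by metis
  have vU: "v n \<in> U" for n using v K_D by blast
  have "sqdist (v m) (v n) \<le> 1 / real (Suc m) + 1 / real (Suc n)" for m n
  proof -
    have "I \<le> (J u (v m) + J u (v n)) / 2 - sqdist (v m) (v n)"
      using I[OF K_midpoint[OF v(1) v(1)]] J_midpoint[OF u v(1) v(1)] order_trans by blast
    moreover have "0 \<le> 1 / real (Suc m)" "0 \<le> 1 / real (Suc n)" by auto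
    ultimately show ?thesis using v(2)[of m] v(2)[of n] by argo
  qed
  then obtain w where w: "w \<in> U" "(\<lambda>n. L1_dist M (v n) w) \<longlonglongrightarrow> 0"
    using M.L1_complete[of v] vU Cauchy_of_sqdist by blast
  have ev: "\<forall>\<^sub>F n in sequentially. E (v n) \<le> (I - \<tau> * sqdist w u) + \<delta>" if \<delta>: "0 < \<delta>" for \<delta>
  proof -
    have "(\<lambda>n. 1 / real (Suc n) + \<tau> * (4 * L1_dist M (v n) w)) \<longlonglongrightarrow> 0 + \<tau> * (4 * 0)"
      by (intro tendsto_add tendsto_mult tendsto_const w(2)) (use LIMSEQ_inverse_real_of_nat in \<open>simp add: divide_inverse\<close>)
    then have "\<forall>\<^sub>F n in sequentially. 1 / real (Suc n) + \<tau> * (4 * L1_dist M (v n) w) < \<delta>"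
      by (rule order_tendstoD(2)) (use \<delta> in simp)
    then show ?thesis
    proof eventually_elim
      case (elim n)
      have "sqdist w u - 4 * L1_dist M (v n) w \<le> sqdist (v n) u"
        using sqdist_diff_le[OF vU[of n] w(1) u] by linarith
      then have "\<tau> * (sqdist w u - 4 * L1_dist M (v n) w) \<le> \<tau> * sqdist (v n) u"
        using \<tau>_pos by (intro mult_left_mono) auto
      then show ?case using v(2)[of n] elim unfolding J_def right_diff_distrib by linarith
    qed
  qed
  have "w \<in> K" "E w \<le> I - \<tau> * sqdist w u"
    by (rule E_lsc(1)[OF v(1) ev w], assumption) (rule E_lsc(2)[OF v(1) ev w])
  then show ?thesis using I by (intro bexI[of _ w]) (auto simp: J_def intro: order_trans[of _ I])
qed

definition minimizes :: "('a \<Rightarrow> real) \<Rightarrow> ('a \<Rightarrow> real) \<Rightarrow> bool" where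
  "minimizes u v \<longleftrightarrow> v \<in> K \<and> (\<forall>w\<in>K. J u v \<le> J u w)"

definition resolvent0 :: "('a \<Rightarrow> real) \<Rightarrow> 'a \<Rightarrow> real" where
  "resolvent0 u = (SOME v. minimizes u v)"

text \<open>A minimizer is unique only up to null sets.  The average of the chosen minimizer with its antipodal
  counterpart is again a minimizer, and it depends on \<open>u\<close> in an exactly odd way.\<close>

definition T :: "('a \<Rightarrow> real) \<Rightarrow> 'a \<Rightarrow> real" where
  "T u = (\<lambda>x. (resolvent0 u x + - resolvent0 (\<lambda>y. - u y) x) / 2)"

lemma J_uminus: "J (\<lambda>x. - u x) (\<lambda>x. - v x) = J u v"
proof -
  have "(- v x - - u x)\<^sup>2 = (v x - u x)\<^sup>2" for x by (simp add: power2_commute)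
  then show ?thesis by (simp add: J_def E_uminus sqdist_def)
qed

lemma minimizes_T: assumes u: "u \<in> U" shows "minimizes u (T u)"
proof -
  have r: "minimizes v (resolvent0 v)" if "v \<in> U" for v
    unfolding resolvent0_def by (rule someI_ex[of "minimizes v"]) (use J_minimizer_exists[OF that] in \<open>auto simp: minimizes_def\<close>)
  define v where "v = (\<lambda>x. - resolvent0 (\<lambda>y. - u y) x)"
  have "minimizes u v"
  proof -
    note m = r[OF U_uminus[OF u]]
    have "v \<in> K" using m K_uminus by (auto simp: minimizes_def v_def)
    moreover have "J u v \<le> J u w" if "w \<in> K" for w
    proof -
      have "J u v = J (\<lambda>y. - u y) (resolvent0 (\<lambda>y. - u y))" using J_uminus[of u v] by (simp add: v_def)
      also have "\<dots> \<le> J (\<lambda>y. - u y) (\<lambda>y. - w y)" using m K_uminus[OF that] by (auto simp: minimizes_def)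
      finally show ?thesis by (simp add: J_uminus)
    qed
    ultimately show ?thesis by (simp add: minimizes_def)
  qed
  moreover note r[OF u]
  ultimately have r0: "resolvent0 u \<in> K" "\<And>w. w \<in> K \<Longrightarrow> J u (resolvent0 u) \<le> J u w"
    and vK: "v \<in> K" "\<And>w. w \<in> K \<Longrightarrow> J u v \<le> J u w"
    by (auto simp: minimizes_def)
  have T: "T u = (\<lambda>x. (resolvent0 u x + v x) / 2)" by (simp add: T_def v_def)
  have mid: "J u (T u) \<le> (J u (resolvent0 u) + J u v) / 2"
    using J_midpoint[OF u r0(1) vK(1)] sqdist_nonneg[of "resolvent0 u" v] unfolding T by linarith
  have "J u (T u) \<le> J u w" if "w \<in> K" for w
    using mid r0(2)[OF that] vK(2)[OF that] by argo
  moreover have "T u \<in> K" unfolding T by (rule K_midpoint[OF r0(1) vK(1)])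
  ultimately show ?thesis by (simp add: minimizes_def)
qed

lemma T_uminus: "T (\<lambda>x. - u x) = (\<lambda>x. - T u x)"
  by (simp add: T_def fun_eq_iff field_simps)

lemma T_K: "u \<in> U \<Longrightarrow> T u \<in> K" using minimizes_T by (auto simp: minimizes_def)

lemma J_T_gap:
  assumes u: "u \<in> U" and w: "w \<in> K" shows "J u (T u) + 2 * sqdist (T u) w \<le> J u w"
proof -
  have "J u (T u) \<le> J u (\<lambda>x. (T u x + w x) / 2)"
    using minimizes_T[OF u] K_midpoint[OF T_K[OF u] w] by (auto simp: minimizes_def)
  also have "\<dots> \<le> (J u (T u) + J u w) / 2 - sqdist (T u) w" by (rule J_midpoint[OF u T_K[OF u] w])
  finally show ?thesis by argo
qed

lemma sqdist_sym: "sqdist u v = sqdist v u" by (simp add: sqdist_def power2_commute)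

text \<open>Adding the two strong minimality inequalities for \<open>u\<close> and \<open>u'\<close> cancels the energies and leaves a
  mixed term that is linear in both differences.\<close>

lemma T_Lipschitz:
  assumes u: "u \<in> U" "u' \<in> U" shows "sqdist (T u) (T u') \<le> \<tau>\<^sup>2 / 4 * sqdist u u'"
proof -
  let ?v = "T u" and ?v' = "T u'"
  have vU: "?v \<in> U" "?v' \<in> U" using T_K u K_D by auto
  note i = M.unit_functions_integrable(3)
  have "4 * sqdist ?v ?v' \<le> \<tau> * (sqdist ?v' u - sqdist ?v u + sqdist ?v u' - sqdist ?v' u')"
    using J_T_gap[OF u(1) T_K[OF u(2)]] J_T_gap[OF u(2) T_K[OF u(1)]] sqdist_sym[of ?v ?v']
    unfolding J_def by (simp add: algebra_simps)
  also have "\<dots> = (\<integral>x. \<tau> * ((?v' x - u x)\<^sup>2 - (?v x - u x)\<^sup>2 + (?v x - u' x)\<^sup>2 - (?v' x - u' x)\<^sup>2) \<partial>M)"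
    using i[OF vU(2) u(1)] i[OF vU(1) u(1)] i[OF vU(1) u(2)] i[OF vU(2) u(2)] by (simp add: sqdist_def)
  also have "\<dots> \<le> (\<integral>x. 2 * (?v x - ?v' x)\<^sup>2 + \<tau>\<^sup>2 / 2 * (u x - u' x)\<^sup>2 \<partial>M)"
  proof (rule integral_mono)
    fix x
    \<comment> \<open>The left-hand side of the claim is \<open>2 \<tau> (v' - v) (u' - u)\<close>.\<close>
    have "0 \<le> 2 * ((?v' x - ?v x) - \<tau> / 2 * (u' x - u x))\<^sup>2" by simp
    then show "\<tau> * ((?v' x - u x)\<^sup>2 - (?v x - u x)\<^sup>2 + (?v x - u' x)\<^sup>2 - (?v' x - u' x)\<^sup>2) \<le> 2 * (?v x - ?v' x)\<^sup>2 + \<tau>\<^sup>2 / 2 * (u x - u' x)\<^sup>2"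
      by (simp add: power2_eq_square field_simps)
  qed (use i[OF vU(2) u(1)] i[OF vU(1) u(1)] i[OF vU(1) u(2)] i[OF vU(2) u(2)] i[OF vU] i[OF u] in auto)
  also have "\<dots> = 2 * sqdist ?v ?v' + \<tau>\<^sup>2 / 2 * sqdist u u'"
    using i[OF vU] i[OF u] by (simp add: sqdist_def)
  finally show ?thesis by simp
qed

lemma T_uniformly_continuous:
  assumes e: "0 < e"
  shows "\<exists>\<delta>>0. \<forall>u\<in>U. \<forall>v\<in>U. L1_dist M u v < \<delta> \<longrightarrow> L1_dist M (T u) (T v) < e"
proof -
  define C where "C = volume * (\<tau>\<^sup>2 / 4) * 2"
  have C: "0 < C" using volume_pos \<tau>_pos by (simp add: C_def)
  have "L1_dist M (T u) (T v) < e" if uv: "u \<in> U" "v \<in> U" "L1_dist M u v < e\<^sup>2 / C" for u v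
  proof -
    have "(L1_dist M (T u) (T v))\<^sup>2 \<le> volume * sqdist (T u) (T v)"
      using L1_dist_sq_le K_D(1)[OF T_K] uv by blast
    also have "\<dots> \<le> volume * (\<tau>\<^sup>2 / 4 * (2 * L1_dist M u v))"
      using volume_pos T_Lipschitz[OF uv(1,2)] sqdist_le[OF uv(1,2)]
      by (intro mult_left_mono order_trans[OF T_Lipschitz[OF uv(1,2)]]) (auto intro: mult_left_mono)
    also have "\<dots> = C * L1_dist M u v" by (simp add: C_def)
    also have "\<dots> < e\<^sup>2" using uv(3) C by (simp add: field_simps)
    finally show ?thesis by (rule power2_less_imp_less) (use e in simp)
  qed
  then show ?thesis using C e by (intro exI[of _ "e\<^sup>2 / C"]) auto
qed

text \<open>The Moreau envelope of \<open>E\<close>.\<close>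

definition \<Phi> :: "('a \<Rightarrow> real) \<Rightarrow> real" where "\<Phi> u = J u (T u)"

lemma \<Phi>_Lipschitz: assumes "u \<in> U" "v \<in> U" shows "\<bar>\<Phi> u - \<Phi> v\<bar> \<le> 4 * \<tau> * L1_dist M u v"
proof -
  have le: "\<Phi> v \<le> \<Phi> u + 4 * \<tau> * L1_dist M u v" if uv: "u \<in> U" "v \<in> U" for u v
  proof -
    have "\<Phi> v \<le> J v (T u)" using minimizes_T[OF uv(2)] T_K[OF uv(1)] by (auto simp: minimizes_def \<Phi>_def)
    moreover have "sqdist (T u) v \<le> sqdist (T u) u + 4 * L1_dist M u v"
      using sqdist_diff_le[OF uv K_D(1)[OF T_K[OF uv(1)]]] sqdist_sym by (smt (verit))
    then have "\<tau> * sqdist (T u) v \<le> \<tau> * (sqdist (T u) u + 4 * L1_dist M u v)" using \<tau>_pos by (intro mult_left_mono) auto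
    ultimately show ?thesis unfolding \<Phi>_def J_def by (simp add: algebra_simps)
  qed
  have "L1_dist M v u = L1_dist M u v" by (simp add: abs_minus_commute)
  then show ?thesis using le[OF assms] le[OF assms(2,1)] by (simp add: abs_le_iff)
qed

lemma \<Phi>_le_E: "u \<in> K \<Longrightarrow> \<Phi> u \<le> E u"
  using minimizes_T[OF K_D(1)] unfolding minimizes_def \<Phi>_def J_def by (force simp: sqdist_def)

lemma E_T: "E (T u) = \<Phi> u - \<tau> * sqdist (T u) u" by (simp add: \<Phi>_def J_def)

lemma E_T_le: "E (T u) \<le> \<Phi> u"
  using \<tau>_pos sqdist_nonneg by (simp add: E_T)

lemma L1_dist_zero_of_sqdist: "u \<in> U \<Longrightarrow> v \<in> U \<Longrightarrow> sqdist u v = 0 \<Longrightarrow> L1_dist M u v = 0"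
  using L1_dist_sq_le[of u v] by simp

lemma fixed_point_E:
  assumes p: "p \<in> K" "L1_dist M p (T p) = 0" shows "E p = \<Phi> p" 
proof (rule antisym)
  have "L1_dist M (T p) p = 0" using p(2) by (simp add: abs_minus_commute)
  then show "E p \<le> \<Phi> p"
    using E_T_le[of p] T_K[OF K_D(1)[OF p(1)]] p(1) K_D(1)
    by (intro E_lsc(2)[of "\<lambda>_. T p"]) auto
qed (rule \<Phi>_le_E[OF p(1)])

text \<open>The competitor is \<open>p + t v\<close>, clipped to admissible values.  Clipping lowers the seminorm, and by the
  clipped expansion of the potential it does not spoil the first-order terms.\<close>

lemma fixed_point_variation:
  assumes p: "p \<in> K" "L1_dist M p (T p) = 0" and v: "v \<in> H_space s \<Omega>" and t: "0 < t"
  shows "0 \<le> 2 * A * frac_form s \<Omega> p v + B * (\<integral>x. deriv W (p x) * v x \<partial>M)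
     + t * (A * seminorm s v + (B * L + \<tau>) * (\<integral>x. (v x)\<^sup>2 \<partial>M))"
proof -
  have pU: "p \<in> U" "p \<in> H_space s \<Omega>" using p K_D by auto
  have b: "\<bar>p x\<bar> \<le> 1" for x using pU by (auto simp: unit_functions_def)
  have [measurable]: "p \<in> borel_measurable M" "v \<in> borel_measurable M" using pU v H_space_borel by auto
  define w where "w = (\<lambda>x. p x + t * v x)"
  have wH: "w \<in> H_space s \<Omega>" using H_space_lincomb[OF pU(2) v, of 1 t] by (simp add: w_def)
  define c where "c = (\<lambda>x. clip (w x))"
  have c: "c \<in> K" "seminorm s c \<le> seminorm s w" using K_clip[OF wH] by (auto simp: c_def)
  note v2 = H_space_square[OF v]
  obtain C where C: "\<forall>t. \<bar>t\<bar> \<le> 1 \<longrightarrow> \<bar>W t\<bar> \<le> C \<and> \<bar>deriv W t\<bar> \<le> C" using W_bounded by blast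
  have dWv: "integrable M (\<lambda>x. deriv W (p x) * v x)"
  proof (rule Bochner_Integration.integrable_bound)
    show "integrable M (\<lambda>x. C\<^sup>2 + (v x)\<^sup>2)" using v2 by simp
    show "AE x in M. norm (deriv W (p x) * v x) \<le> norm (C\<^sup>2 + (v x)\<^sup>2)"
    proof (rule AE_I2)
      fix x
      have "\<bar>deriv W (p x)\<bar> \<le> C" using C b by blast
      then have "\<bar>deriv W (p x)\<bar> * \<bar>v x\<bar> \<le> C * \<bar>v x\<bar>" by (intro mult_right_mono) auto
      moreover have "2 * (C * \<bar>v x\<bar>) \<le> C\<^sup>2 + (v x)\<^sup>2" using sum_squares_bound[of C "\<bar>v x\<bar>"] by (simp add: mult.assoc)
      moreover have "0 \<le> C * \<bar>v x\<bar>" using \<open>\<bar>deriv W (p x)\<bar> \<le> C\<close> by (intro mult_nonneg_nonneg) auto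
      ultimately have "\<bar>deriv W (p x)\<bar> * \<bar>v x\<bar> \<le> C\<^sup>2 + (v x)\<^sup>2" by linarith
      then show "norm (deriv W (p x) * v x) \<le> norm (C\<^sup>2 + (v x)\<^sup>2)" by (simp add: abs_mult)
    qed
  qed measurable
  have "E p \<le> J p c"
    using minimizes_T[OF pU(1)] c(1) fixed_point_E[OF p] by (auto simp: minimizes_def \<Phi>_def)
  moreover have "A * seminorm s c \<le> A * (seminorm s p + 2 * t * frac_form s \<Omega> p v + t\<^sup>2 * seminorm s v)"
    using c(2) A seminorm_add[OF pU(2) v, of t] by (simp add: w_def)
  moreover have "B * (\<integral>x. W (c x) \<partial>M) \<le> B * ((\<integral>x. W (p x) \<partial>M) + t * (\<integral>x. deriv W (p x) * v x \<partial>M) + L * t\<^sup>2 * (\<integral>x. (v x)\<^sup>2 \<partial>M))"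
  proof -
    have "(\<integral>x. W (c x) \<partial>M) \<le> (\<integral>x. W (p x) + t * (deriv W (p x) * v x) + L * t\<^sup>2 * (v x)\<^sup>2 \<partial>M)"
    proof (rule integral_mono)
      show "W (c x) \<le> W (p x) + t * (deriv W (p x) * v x) + L * t\<^sup>2 * (v x)\<^sup>2" for x
        using W_taylor[OF b[of x], of "t * v x"] by (simp add: c_def w_def power_mult_distrib mult_ac)
    qed (use W_integrable[OF K_D(1)[OF c(1)]] W_integrable[OF pU(1)] dWv v2 in auto)
    also have "\<dots> = (\<integral>x. W (p x) \<partial>M) + t * (\<integral>x. deriv W (p x) * v x \<partial>M) + L * t\<^sup>2 * (\<integral>x. (v x)\<^sup>2 \<partial>M)"
      using W_integrable[OF pU(1)] dWv v2 by simp
    finally show ?thesis using B by (intro mult_left_mono) auto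
  qed
  moreover have "\<tau> * sqdist c p \<le> \<tau> * (t\<^sup>2 * (\<integral>x. (v x)\<^sup>2 \<partial>M))"
  proof -
    have "sqdist c p \<le> (\<integral>x. t\<^sup>2 * (v x)\<^sup>2 \<partial>M)"
      unfolding sqdist_def
    proof (rule integral_mono)
      fix x
      have "\<bar>c x - p x\<bar> \<le> \<bar>t * v x\<bar>" using clip_props(3)[of "w x" "p x"] clip_props(4)[OF b[of x]] by (simp add: c_def w_def)
      then show "(c x - p x)\<^sup>2 \<le> t\<^sup>2 * (v x)\<^sup>2" by (simp add: abs_le_square_iff power_mult_distrib)
    qed (use M.unit_functions_integrable(3)[OF K_D(1)[OF c(1)] pU(1)] v2 in auto)
    then show ?thesis using \<tau>_pos by (intro mult_left_mono) auto
  qed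
  ultimately have "0 \<le> t * (2 * A * frac_form s \<Omega> p v + B * (\<integral>x. deriv W (p x) * v x \<partial>M)
     + t * (A * seminorm s v + (B * L + \<tau>) * (\<integral>x. (v x)\<^sup>2 \<partial>M)))"
    unfolding J_def E_def by (simp add: algebra_simps power2_eq_square)
  then show ?thesis using t by (simp add: zero_le_mult_iff)
qed

text \<open>Letting \<open>t\<close> tend to \<open>0\<close> gives an inequality for \<open>v\<close> and for \<open>- v\<close>.\<close>

lemma fixed_point_critical:
  assumes p: "p \<in> K" "L1_dist M p (T p) = 0" and v: "v \<in> H_space s \<Omega>"
  shows "2 * A * frac_form s \<Omega> p v + B * (\<integral>x. deriv W (p x) * v x \<partial>M) = 0"
proof -
  have ge: "0 \<le> 2 * A * frac_form s \<Omega> p v + B * (\<integral>x. deriv W (p x) * v x \<partial>M)" if v: "v \<in> H_space s \<Omega>" for v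
  proof (rule field_le_epsilon)
    fix e :: real assume e: "0 < e"
    define D where "D = A * seminorm s v + (B * L + \<tau>) * (\<integral>x. (v x)\<^sup>2 \<partial>M)"
    have D: "0 \<le> D" unfolding D_def using A B L \<tau>_pos seminorm_nonneg
      by (intro add_nonneg_nonneg mult_nonneg_nonneg) auto
    have "e / (D + 1) * D \<le> e" using D e by (simp add: field_simps)
    then show "0 \<le> 2 * A * frac_form s \<Omega> p v + B * (\<integral>x. deriv W (p x) * v x \<partial>M) + e"
      using fixed_point_variation[OF p v, of "e / (D + 1)"] D e unfolding D_def[symmetric] by simp
  qed
  have "(\<lambda>x. - v x) \<in> H_space s \<Omega>" using H_space_lincomb[OF v v, of "-1" 0] by simp
  moreover have "frac_form s \<Omega> p (\<lambda>x. - v x) = - frac_form s \<Omega> p v"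
    unfolding frac_form_eq Bochner_Integration.integral_minus[symmetric]
    by (rule Bochner_Integration.integral_cong) (auto simp: algebra_simps)
  ultimately have "2 * A * frac_form s \<Omega> p v + B * (\<integral>x. deriv W (p x) * v x \<partial>M) \<le> 0"
    using ge[of "\<lambda>x. - v x"] by simp
  then show ?thesis using ge[OF v] by linarith
qed

lemma E_compact:
  fixes u :: "nat \<Rightarrow> 'a \<Rightarrow> real"
  assumes u: "\<And>n. u n \<in> K" "\<And>n. E (u n) \<le> c"
  shows "\<exists>r. strict_mono r \<and> (\<exists>v\<in>U. (\<lambda>n. L1_dist M (u (r n)) v) \<longlonglongrightarrow> 0)"
proof (rule fractional_rellich[OF _ _ _ s])
  show "u n \<in> U" "u n \<in> H_space s \<Omega>" for n using u K_D by auto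
  show "seminorm s (u n) \<le> c / A" for n
    using seminorm_le_E[of "u n"] u(2)[of n] A by (meson divide_right_mono less_imp_le order_trans)
qed

lemma mean_diff_le: assumes "u \<in> U" "v \<in> U" shows "\<bar>(\<integral>x. u x \<partial>M) - (\<integral>x. v x \<partial>M)\<bar> \<le> L1_dist M u v"
proof -
  have "(\<integral>x. u x \<partial>M) - (\<integral>x. v x \<partial>M) = (\<integral>x. u x - v x \<partial>M)"
    using M.unit_functions_integrable(1)[OF assms(1) assms(1)] M.unit_functions_integrable(1)[OF assms(2) assms(2)] by simp
  then show ?thesis using integral_abs_bound[of M "\<lambda>x. u x - v x"] by simp
qed

lemma zero_mean_minimizer:
  "\<exists>w\<in>K. (\<integral>x. w x \<partial>M) = 0 \<and> (\<forall>v\<in>K. (\<integral>x. v x \<partial>M) = 0 \<longrightarrow> E w \<le> E v)"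
proof -
  define Z where "Z = {v \<in> K. (\<integral>x. v x \<partial>M) = 0}"
  define I where "I = Inf (E ` Z)"
  have bdd: "bdd_below (E ` Z)" using E_nonneg by (intro bdd_belowI[of _ 0]) auto
  have ne: "E ` Z \<noteq> {}" using K_zero by (auto simp: Z_def)
  have I: "I \<le> E w" if "w \<in> Z" for w unfolding I_def using bdd that by (intro cInf_lower) auto
  have "\<exists>v\<in>Z. E v < I + 1 / real (Suc n)" for n
    using cInf_lessD[OF ne, of "I + 1 / real (Suc n)"] by (auto simp: I_def)
  then obtain v where v: "\<And>n. v n \<in> Z" "\<And>n. E (v n) < I + 1 / real (Suc n)" by metis
  have vK: "v n \<in> K" for n using v by (auto simp: Z_def)
  have Ebd: "E (v n) \<le> I + 1" for n
  proof -
    have "1 / real (Suc n) \<le> 1" by simp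
    then show ?thesis using v(2)[of n] by linarith
  qed
  then obtain r w where r: "strict_mono r" "w \<in> U" "(\<lambda>n. L1_dist M (v (r n)) w) \<longlonglongrightarrow> 0"
    using E_compact[of v "I + 1", OF vK Ebd] by blast
  have ev: "\<forall>\<^sub>F n in sequentially. E (v (r n)) \<le> I + \<delta>" if "0 < \<delta>" for \<delta>
  proof -
    have "(\<lambda>n. inverse (real (Suc n))) \<longlonglongrightarrow> 0" by (rule LIMSEQ_inverse_real_of_nat)
    then have "\<forall>\<^sub>F n in sequentially. inverse (real (Suc n)) < \<delta>" using that by (rule order_tendstoD(2))
    from eventually_subseq[OF r(1) this] show ?thesis
    proof eventually_elim
      case (elim n)
      then show ?case using v(2)[of "r n"] by (simp add: inverse_eq_divide)
    qed
  qed
  have w: "w \<in> K" "E w \<le> I"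
    using E_lsc[of "\<lambda>n. v (r n)" I w, OF vK ev r(2,3)] by blast+
  have "(\<integral>x. w x \<partial>M) = 0"
  proof -
    have "\<bar>\<integral>x. w x \<partial>M\<bar> \<le> L1_dist M (v (r n)) w" for n
      using mean_diff_le[OF K_D(1)[OF vK[of "r n"]] r(2)] v(1)[of "r n"] by (simp add: Z_def)
    then have "\<bar>\<integral>x. w x \<partial>M\<bar> \<le> 0" by (intro LIMSEQ_le_const[OF r(3)]) auto
    then show ?thesis by simp
  qed
  then show ?thesis using w I by (intro bexI[of _ w]) (auto simp: Z_def intro: order_trans)
qed

end

section \<open>Integrals of the kernel and of the layer weights\<close>

lemma dyadic_exponent:
  fixes x :: real assumes "1 \<le> x" shows "\<exists>j::nat. 2 ^ j \<le> x \<and> x < 2 ^ Suc j"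
proof -
  obtain n where n: "x < 2 ^ n" using real_arch_pow[of 2 x] by auto
  define m where "m = (LEAST n. x < 2 ^ n)"
  have m: "x < 2 ^ m" unfolding m_def by (rule LeastI[of _ n]) (rule n)
  have "m \<noteq> 0" using m assms by (intro notI) simp
  then obtain j where j: "m = Suc j" by (cases m) auto
  have "\<not> x < 2 ^ j" using not_less_Least[of j "\<lambda>n. x < 2 ^ n"] j by (simp add: m_def)
  then show ?thesis using m j by (intro exI[of _ j]) auto
qed

lemma ennreal_suminf_ge: "f i \<le> (\<Sum>i. f i :: ennreal)"
  using sum_le_suminf[of f "{i}"] by simp

text \<open>Decomposition into dyadic shells around the scale \<open>\<rho>\<close>.  The shells beyond \<open>\<rho>\<close> contribute a geometric
  series of ratio \<open>2 powr (- 2 s)\<close>, those inside one of ratio \<open>2 powr (2 s - 2)\<close>.\<close>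

lemma kernel_integral_bound:
  fixes f :: "'b \<Rightarrow> real" and n :: nat
  assumes [measurable]: "f \<in> borel_measurable N" and nonneg: "\<And>x. 0 \<le> f x"
    and growth: "\<And>r. 0 < r \<Longrightarrow> emeasure N {x \<in> space N. f x \<le> r} \<le> ennreal (V * r ^ n)"
    and s: "0 < s" "s < 1" and \<rho>: "0 < \<rho>" and V: "0 \<le> V"
  shows "(\<integral>\<^sup>+x. ennreal (min 1 ((f x / \<rho>)\<^sup>2) / f x powr (real n + 2 * s)) \<partial>N)
     \<le> ennreal ((V * 2 ^ n / (1 - 2 powr (-2 * s)) + V * 2 ^ n * 2 powr (2 * s) / (1 - 2 powr (2 * s - 2))) * \<rho> powr (- 2 * s))"
proof -
  let ?a = "real n + 2 * s"
  have a: "0 < ?a" using s by simp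
  define c1 where "c1 j = (2 ^ j * \<rho>) powr (- ?a)" for j :: nat
  define c2 where "c2 j = (1 / 4) ^ j * (\<rho> / 2 ^ Suc j) powr (- ?a)" for j :: nat
  \<comment> \<open>Sublevel sets may replace the shells in an upper bound.\<close>
  define S1 where "S1 j = {x \<in> space N. f x \<le> 2 ^ Suc j * \<rho>}" for j :: nat
  define S2 where "S2 j = {x \<in> space N. f x \<le> \<rho> / 2 ^ j}" for j :: nat
  have [measurable]: "S1 j \<in> sets N" "S2 j \<in> sets N" for j unfolding S1_def S2_def by measurable
  define q1 q2 :: real where "q1 = 2 powr (- 2 * s)" and "q2 = 2 powr (2 * s - 2)"
  have q1: "0 < q1" "q1 < 1" unfolding q1_def using s powr_less_mono[of "- 2 * s" 0 2] by auto
  have q2: "0 < q2" "q2 < 1" unfolding q2_def using s powr_less_mono[of "2 * s - 2" 0 2] by auto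
  have e1: "c1 j * (V * (2 ^ Suc j * \<rho>) ^ n) = V * 2 ^ n * \<rho> powr (- 2 * s) * q1 ^ j" for j
  proof -
    have p2: "(2::real) ^ j = 2 powr real j" by (simp add: powr_realpow)
    have "c1 j * (2 ^ j * \<rho>) ^ n = (2 ^ j * \<rho>) powr (- ?a) * (2 ^ j * \<rho>) powr real n"
      using \<rho> by (simp add: c1_def powr_realpow)
    also have "\<dots> = (2 ^ j * \<rho>) powr (- 2 * s)" by (simp flip: powr_add)
    also have "\<dots> = (2 ^ j) powr (- 2 * s) * \<rho> powr (- 2 * s)" using \<rho> by (simp add: powr_mult)
    also have "(2 ^ j) powr (- 2 * s) = q1 ^ j" unfolding p2 q1_def powr_powr by (simp add: powr_powr mult.commute flip: powr_realpow)
    finally have "c1 j * (2 ^ j * \<rho>) ^ n = q1 ^ j * \<rho> powr (- 2 * s)" .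
    then show ?thesis by (simp add: power_mult_distrib mult_ac)
  qed
  have e2: "c2 j * (V * (\<rho> / 2 ^ j) ^ n) = V * 2 ^ n * 2 powr (2 * s) * \<rho> powr (- 2 * s) * q2 ^ j" for j
  proof -
    have p2: "(2::real) ^ j = 2 powr real j" by (simp add: powr_realpow)
    define r where "r = \<rho> / 2 ^ j"
    have r: "0 < r" using \<rho> by (simp add: r_def)
    have "(\<rho> / 2 ^ Suc j) powr (- ?a) = (r / 2) powr (- ?a)" by (simp add: r_def mult.commute)
    also have "\<dots> = r powr (- ?a) / 2 powr (- ?a)" using r by (simp only: powr_divide)
    also have "\<dots> = r powr (- ?a) * 2 powr ?a" unfolding powr_minus[of 2 ?a] by (simp only: divide_inverse inverse_inverse_eq)
    finally have "c2 j * r ^ n = (1 / 4) ^ j * (r powr (- ?a) * r powr real n) * 2 powr ?a"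
      using r by (simp add: c2_def powr_realpow)
    also have "r powr (- ?a) * r powr real n = r powr (- 2 * s)" by (simp flip: powr_add)
    also have "r powr (- 2 * s) = \<rho> powr (- 2 * s) * 2 powr (real j * (2 * s))"
      unfolding r_def p2 using \<rho> by (simp add: powr_divide powr_powr powr_minus field_simps)
    also have "2 powr ?a = 2 ^ n * 2 powr (2 * s)" by (simp add: powr_add powr_realpow)
    also have "(1 / 4) ^ j * (\<rho> powr (- 2 * s) * 2 powr (real j * (2 * s))) * (2 ^ n * 2 powr (2 * s))
       = ((1 / 4) ^ j * 2 powr (real j * (2 * s))) * (\<rho> powr (- 2 * s) * 2 ^ n * 2 powr (2 * s))" by simp
    also have "(1 / 4) ^ j * 2 powr (real j * (2 * s)) = q2 ^ j"
    proof -
      have "(1 / 4 :: real) ^ j = 2 powr (real j * (- 2))"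
        by (simp add: powr_powr[symmetric] powr_realpow[symmetric] powr_minus mult.commute[of "real j"] power_one_over inverse_eq_divide)
      then show ?thesis unfolding q2_def by (simp add: powr_powr mult.commute algebra_simps flip: powr_realpow powr_add)
    qed
    finally show ?thesis by (simp add: r_def mult_ac)
  qed
  have pt: "ennreal (min 1 ((f x / \<rho>)\<^sup>2) / f x powr ?a) \<le> (\<Sum>j. ennreal (c1 j) * indicator (S1 j) x) + (\<Sum>j. ennreal (c2 j) * indicator (S2 j) x)"
    if x: "x \<in> space N" for x
  proof (cases "f x = 0")
    case True then show ?thesis by simp
  next
    case False
    then have fx: "0 < f x" using nonneg[of x] by simp
    have inv: "1 / y powr ?a = y powr (- ?a)" for y by (simp only: powr_minus_divide)
    show ?thesis
    proof (cases "\<rho> \<le> f x")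
      case True
      then obtain j where j: "2 ^ j \<le> f x / \<rho>" "f x / \<rho> < 2 ^ Suc j" using dyadic_exponent[of "f x / \<rho>"] \<rho> by auto
      then have j': "2 ^ j * \<rho> \<le> f x" "f x \<le> 2 ^ Suc j * \<rho>" using \<rho> by (auto simp: field_simps)
      have "min 1 ((f x / \<rho>)\<^sup>2) / f x powr ?a \<le> 1 / f x powr ?a" by (intro divide_right_mono) auto
      also have "\<dots> \<le> c1 j" unfolding inv c1_def using j'(1) \<rho> a by (intro powr_mono2') auto
      finally have "ennreal (min 1 ((f x / \<rho>)\<^sup>2) / f x powr ?a) \<le> ennreal (c1 j) * indicator (S1 j) x"
        using j'(2) x by (simp add: S1_def ennreal_leI)
      also have "\<dots> \<le> (\<Sum>j. ennreal (c1 j) * indicator (S1 j) x)" by (rule ennreal_suminf_ge)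
      finally show ?thesis by (meson add_increasing2 zero_le)
    next
      case False
      then obtain j where j: "2 ^ j \<le> \<rho> / f x" "\<rho> / f x < 2 ^ Suc j" using dyadic_exponent[of "\<rho> / f x"] fx by auto
      then have j': "f x \<le> \<rho> / 2 ^ j" "\<rho> / 2 ^ Suc j \<le> f x" using fx by (auto simp: field_simps)
      have "f x / \<rho> \<le> (1 / 2) ^ j" using j'(1) \<rho> by (simp add: field_simps power_one_over)
      then have "(f x / \<rho>)\<^sup>2 \<le> ((1 / 2) ^ j)\<^sup>2" using fx \<rho> by (intro power_mono) auto
      also have "((1 / 2 :: real) ^ j)\<^sup>2 = (1 / 4) ^ j" by (simp add: power_mult[symmetric] mult.commute[of j]) (simp add: power_mult power2_eq_square)
      finally have "min 1 ((f x / \<rho>)\<^sup>2) * (1 / f x powr ?a) \<le> (1 / 4) ^ j * (1 / f x powr ?a)" by (intro mult_right_mono) auto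
      also have "\<dots> \<le> c2 j" unfolding inv c2_def using j'(2) \<rho> a by (intro mult_left_mono powr_mono2') auto
      finally have "ennreal (min 1 ((f x / \<rho>)\<^sup>2) / f x powr ?a) \<le> ennreal (c2 j) * indicator (S2 j) x"
        using j'(1) x by (simp add: S2_def ennreal_leI)
      also have "\<dots> \<le> (\<Sum>j. ennreal (c2 j) * indicator (S2 j) x)" by (rule ennreal_suminf_ge)
      finally show ?thesis by (meson add_increasing zero_le)
    qed
  qed
  have "(\<integral>\<^sup>+x. ennreal (min 1 ((f x / \<rho>)\<^sup>2) / f x powr ?a) \<partial>N)
     \<le> (\<integral>\<^sup>+x. (\<Sum>j. ennreal (c1 j) * indicator (S1 j) x) + (\<Sum>j. ennreal (c2 j) * indicator (S2 j) x) \<partial>N)"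
    by (rule nn_integral_mono) (rule pt)
  also have "\<dots> = (\<Sum>j. ennreal (c1 j) * emeasure N (S1 j)) + (\<Sum>j. ennreal (c2 j) * emeasure N (S2 j))"
    by (simp add: nn_integral_add nn_integral_suminf nn_integral_cmult_indicator)
  also have "\<dots> \<le> (\<Sum>j. ennreal (V * 2 ^ n * \<rho> powr (- 2 * s) * q1 ^ j)) + (\<Sum>j. ennreal (V * 2 ^ n * 2 powr (2 * s) * \<rho> powr (- 2 * s) * q2 ^ j))"
  proof (intro add_mono suminf_le summableI)
    fix j
    have "ennreal (c1 j) * emeasure N (S1 j) \<le> ennreal (c1 j) * ennreal (V * (2 ^ Suc j * \<rho>) ^ n)"
      unfolding S1_def using \<rho> by (intro mult_left_mono growth) auto
    also have "\<dots> = ennreal (c1 j * (V * (2 ^ Suc j * \<rho>) ^ n))" using V \<rho> by (intro ennreal_mult[symmetric]) (auto simp: c1_def)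
    finally show "ennreal (c1 j) * emeasure N (S1 j) \<le> ennreal (V * 2 ^ n * \<rho> powr (- 2 * s) * q1 ^ j)" unfolding e1 .
    have "ennreal (c2 j) * emeasure N (S2 j) \<le> ennreal (c2 j) * ennreal (V * (\<rho> / 2 ^ j) ^ n)"
      unfolding S2_def using \<rho> by (intro mult_left_mono growth) auto
    also have "\<dots> = ennreal (c2 j * (V * (\<rho> / 2 ^ j) ^ n))" using V \<rho> by (intro ennreal_mult[symmetric]) (auto simp: c2_def)
    finally show "ennreal (c2 j) * emeasure N (S2 j) \<le> ennreal (V * 2 ^ n * 2 powr (2 * s) * \<rho> powr (- 2 * s) * q2 ^ j)" unfolding e2 .
  qed
  also have "\<dots> = ennreal (V * 2 ^ n * \<rho> powr (- 2 * s) * (1 / (1 - q1))) + ennreal (V * 2 ^ n * 2 powr (2 * s) * \<rho> powr (- 2 * s) * (1 / (1 - q2)))"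
    using V q1 q2 by (subst (1 2) suminf_ennreal2) (auto simp: suminf_mult suminf_geometric intro!: summable_mult summable_geometric)
  also have "\<dots> = ennreal (V * 2 ^ n * \<rho> powr (- 2 * s) * (1 / (1 - q1)) + V * 2 ^ n * 2 powr (2 * s) * \<rho> powr (- 2 * s) * (1 / (1 - q2)))"
    using V q1 q2 by (intro ennreal_plus[symmetric] mult_nonneg_nonneg) auto
  also have "V * 2 ^ n * \<rho> powr (- 2 * s) * (1 / (1 - q1)) + V * 2 ^ n * 2 powr (2 * s) * \<rho> powr (- 2 * s) * (1 / (1 - q2))
     = (V * 2 ^ n / (1 - 2 powr (-2 * s)) + V * 2 ^ n * 2 powr (2 * s) / (1 - 2 powr (2 * s - 2))) * \<rho> powr (- 2 * s)"
    unfolding q1_def q2_def distrib_right times_divide_eq_right times_divide_eq_left by (simp only: mult_ac mult_1_right)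
  finally show ?thesis .
qed

text \<open>Up to a constant, \<open>g powr (- 2 s)\<close> is at most the integral of \<open>t powr (- 2 s - 1)\<close> from \<open>g\<close> to
  \<open>2 g\<close>.  Exchanging the order of integration turns the bound for the measure of sublevel sets into a
  one-dimensional integral.\<close>

lemma weight_integral_bound:
  fixes f :: "'b \<Rightarrow> real"
  assumes N: "sigma_finite_measure N" and [measurable]: "f \<in> borel_measurable N" and nonneg: "\<And>x. 0 \<le> f x"
    and growth: "\<And>r. 0 < r \<Longrightarrow> emeasure N {x \<in> space N. f x \<le> r} \<le> ennreal (V * r)"
    and bound: "\<And>x. x \<in> space N \<Longrightarrow> f x \<le> 2 * D"
    and s: "0 < s" and \<epsilon>: "0 < \<epsilon>" "\<epsilon> \<le> D" and V: "0 \<le> V" and P: "0 \<le> P"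
    and int: "(\<integral>\<^sup>+t. ennreal (t powr (- 2 * s)) * indicator {\<epsilon>..2 * D} t \<partial>lborel) \<le> ennreal P"
  shows "(\<integral>\<^sup>+x. ennreal (max \<epsilon> (f x / 2) powr (- 2 * s)) \<partial>N) \<le> ennreal (4 * V * 2 powr (2 * s) * P)"
proof -
  interpret N: sigma_finite_measure N by (rule N)
  interpret NL: pair_sigma_finite N lborel ..
  \<comment> \<open>For \<open>g = max \<epsilon> (f x / 2)\<close> both indicators equal \<open>1\<close> when \<open>t\<close> is between \<open>g\<close> and \<open>2 g\<close>.\<close>
  define h where "h t x = ennreal (t powr (- 2 * s - 1)) * indicator {\<epsilon>..2 * D} t * indicator {x \<in> space N. f x \<le> 2 * t} x" for t x
  have h_meas: "(\<lambda>(x, t). h t x) \<in> borel_measurable (N \<Otimes>\<^sub>M lborel)"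
  proof -
    have "(\<lambda>p. ennreal (snd p powr (- 2 * s - 1)) * indicator {\<epsilon>..2 * D} (snd p) * (if f (fst p) \<le> 2 * snd p then 1 else 0)) \<in> borel_measurable (N \<Otimes>\<^sub>M lborel)"
      by measurable
    then show ?thesis
      by (rule measurable_cong[THEN iffD1, rotated]) (auto simp: h_def space_pair_measure indicator_def)
  qed
  define c where "c = ennreal (2 * 2 powr (2 * s))"
  have "ennreal (max \<epsilon> (f x / 2) powr (- 2 * s)) \<le> c * (\<integral>\<^sup>+t. h t x \<partial>lborel)" if x: "x \<in> space N" for x
  proof -
    define g where "g = max \<epsilon> (f x / 2)"
    have g: "0 < g" "\<epsilon> \<le> g" "f x \<le> 2 * g" "g \<le> D" using \<epsilon> bound[OF x] by (auto simp: g_def)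
    have "ennreal ((2 * g) powr (- 2 * s - 1)) * ennreal g = (\<integral>\<^sup>+t. ennreal ((2 * g) powr (- 2 * s - 1)) * indicator {g..2 * g} t \<partial>lborel)"
      using g by (simp add: nn_integral_cmult_indicator)
    also have "\<dots> \<le> (\<integral>\<^sup>+t. h t x \<partial>lborel)"
    proof (rule nn_integral_mono)
      fix t
      show "ennreal ((2 * g) powr (- 2 * s - 1)) * indicator {g..2 * g} t \<le> h t x"
      proof (cases "t \<in> {g..2 * g}")
        case True
        then have "(2 * g) powr (- 2 * s - 1) \<le> t powr (- 2 * s - 1)" using g s by (intro powr_mono2') auto
        then show ?thesis using True g x by (simp add: h_def ennreal_leI)
      qed simp
    qed
    finally have le: "ennreal ((2 * g) powr (- 2 * s - 1)) * ennreal g \<le> (\<integral>\<^sup>+t. h t x \<partial>lborel)" .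
    have "2 * 2 powr (2 * s) * ((2 * g) powr (- 2 * s - 1) * g) = g powr (- 2 * s)"
    proof -
      have "(2 * g) powr (- 2 * s - 1) = 2 powr (- 2 * s - 1) * g powr (- 2 * s - 1)" using g by (simp add: powr_mult)
      moreover have "g powr (- 2 * s - 1) * g = g powr (- 2 * s)" using g by (simp add: powr_diff)
      moreover have "2 * 2 powr (2 * s) * 2 powr (- 2 * s - 1) = (1::real)" by (simp add: powr_diff powr_minus)
      ultimately show ?thesis by (metis (no_types, opaque_lifting) mult.assoc mult_1)
    qed
    then have "ennreal (g powr (- 2 * s)) = c * (ennreal ((2 * g) powr (- 2 * s - 1)) * ennreal g)"
      using g by (simp add: c_def flip: ennreal_mult)
    also have "\<dots> \<le> c * (\<integral>\<^sup>+t. h t x \<partial>lborel)" by (intro mult_left_mono le) simp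
    finally show ?thesis by (simp add: g_def)
  qed
  then have "(\<integral>\<^sup>+x. ennreal (max \<epsilon> (f x / 2) powr (- 2 * s)) \<partial>N) \<le> (\<integral>\<^sup>+x. c * (\<integral>\<^sup>+t. h t x \<partial>lborel) \<partial>N)"
    by (rule nn_integral_mono)
  also have "\<dots> = c * (\<integral>\<^sup>+x. (\<integral>\<^sup>+t. h t x \<partial>lborel) \<partial>N)"
    using h_meas by (intro nn_integral_cmult) (simp add: lborel.borel_measurable_nn_integral)
  also have "(\<integral>\<^sup>+x. (\<integral>\<^sup>+t. h t x \<partial>lborel) \<partial>N) = (\<integral>\<^sup>+t. (\<integral>\<^sup>+x. h t x \<partial>N) \<partial>lborel)"
    using NL.Fubini'[OF h_meas] by simp
  also have "\<dots> \<le> (\<integral>\<^sup>+t. ennreal (2 * V) * (ennreal (t powr (- 2 * s)) * indicator {\<epsilon>..2 * D} t) \<partial>lborel)"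
  proof (rule nn_integral_mono)
    fix t
    show "(\<integral>\<^sup>+x. h t x \<partial>N) \<le> ennreal (2 * V) * (ennreal (t powr (- 2 * s)) * indicator {\<epsilon>..2 * D} t)"
    proof (cases "t \<in> {\<epsilon>..2 * D}")
      case True
      then have t: "0 < t" using \<epsilon> by simp
      have "(\<integral>\<^sup>+x. h t x \<partial>N) = ennreal (t powr (- 2 * s - 1)) * emeasure N {x \<in> space N. f x \<le> 2 * t}"
        using True by (simp add: h_def nn_integral_cmult_indicator)
      also have "\<dots> \<le> ennreal (t powr (- 2 * s - 1)) * ennreal (V * (2 * t))" using t by (intro mult_left_mono growth) auto
      also have "\<dots> = ennreal (2 * V * t powr (- 2 * s))"
        using V t by (simp add: powr_diff field_simps flip: ennreal_mult)
      finally show ?thesis using True V by (simp add: ennreal_mult)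
    qed (simp add: h_def)
  qed
  also have "\<dots> = ennreal (2 * V) * (\<integral>\<^sup>+t. ennreal (t powr (- 2 * s)) * indicator {\<epsilon>..2 * D} t \<partial>lborel)"
    by (rule nn_integral_cmult) measurable
  also have "\<dots> \<le> ennreal (2 * V) * ennreal P" by (intro mult_left_mono int) simp
  finally have "(\<integral>\<^sup>+x. ennreal (max \<epsilon> (f x / 2) powr (- 2 * s)) \<partial>N) \<le> c * (ennreal (2 * V) * ennreal P)"
    by (simp add: mult_left_mono)
  also have "\<dots> = ennreal (4 * V * 2 powr (2 * s) * P)" using V P by (simp add: c_def mult_ac flip: ennreal_mult)
  finally show ?thesis .
qed

lemma coeff_A_pos: "0 < \<epsilon> \<Longrightarrow> \<epsilon> \<le> 1/2 \<Longrightarrow> 0 < coeff_A s \<epsilon>"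
  using ln_less_zero[of \<epsilon>] by (auto simp: coeff_A_def)

lemma coeff_B_pos: "0 < \<epsilon> \<Longrightarrow> \<epsilon> \<le> 1/2 \<Longrightarrow> 0 < coeff_B s \<epsilon>"
  using ln_less_zero[of \<epsilon>] by (auto simp: coeff_B_def)

lemma coeff_B_le: "0 < \<epsilon> \<Longrightarrow> \<epsilon> \<le> 1/2 \<Longrightarrow> coeff_B s \<epsilon> * \<epsilon> powr (2 * s) \<le> 2 * coeff_A s \<epsilon>"
  using ln_less_zero[of \<epsilon>] by (auto simp: coeff_A_def coeff_B_def abs_mult powr_diff field_simps)

text \<open>A lower bound by one negative power of \<open>\<epsilon>\<close> for all three regimes of \<open>s\<close>.  In the critical case it
  follows from \<open>- ln \<epsilon> \<le> 2 \<epsilon> powr (- 1/2)\<close>.\<close>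

lemma coeff_B_ge:
  assumes \<epsilon>: "0 < \<epsilon>" "\<epsilon> \<le> 1/2" shows "\<epsilon> powr (- min (2 * s) (1/2)) / 2 \<le> coeff_B s \<epsilon>"
proof -
  let ?m = "min (2 * s) (1/2)"
  have le: "\<epsilon> powr (- ?m) / 2 \<le> \<epsilon> powr (- c)" if "?m \<le> c" for c
  proof -
    have "\<epsilon> powr (- ?m) / 2 \<le> \<epsilon> powr (- ?m)" by simp
    also have "\<dots> \<le> \<epsilon> powr (- c)" using \<epsilon> that by (intro powr_mono') auto
    finally show ?thesis .
  qed
  consider "s < 1/2" | "s = 1/2" | "s > 1/2" by linarith
  then show ?thesis
  proof cases
    case 1
    then show ?thesis using le[of "2 * s"] by (simp add: coeff_B_def powr_minus_divide)
  next
    case 2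
    have "- ln \<epsilon> = 2 * ln (\<epsilon> powr (- 1/2))" using \<epsilon> by (simp add: ln_powr)
    also have "\<dots> \<le> 2 * \<epsilon> powr (- 1/2)" using \<epsilon> ln_le_minus_one[of "\<epsilon> powr (- 1/2)"] by simp
    finally have "- ln \<epsilon> * \<epsilon> \<le> 2 * \<epsilon> powr (- 1/2) * \<epsilon>" using \<epsilon> by (intro mult_right_mono) auto
    also have "\<dots> = 2 * (\<epsilon> powr (- 1/2) * \<epsilon> powr 1)" using \<epsilon> by simp
    also have "\<dots> = 2 * \<epsilon> powr (1/2)" unfolding powr_add[symmetric] by simp
    finally have le2: "- ln \<epsilon> * \<epsilon> \<le> 2 * \<epsilon> powr (1/2)" .
    have ln0: "ln \<epsilon> < 0" using \<epsilon> by simp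
    then have "0 < - ln \<epsilon> * \<epsilon>" using \<epsilon> by (simp add: mult_neg_pos)
    then have "1 / (2 * \<epsilon> powr (1/2)) \<le> 1 / (- ln \<epsilon> * \<epsilon>)" using le2 \<epsilon> by (intro divide_left_mono mult_pos_pos) auto
    moreover have "\<bar>\<epsilon> * ln \<epsilon>\<bar> = - ln \<epsilon> * \<epsilon>" using \<epsilon> ln0 by (simp add: abs_mult)
    ultimately show ?thesis using 2 by (simp add: coeff_B_def powr_minus_divide)
  next
    case 3
    then show ?thesis using le[of 1] \<epsilon> by (simp add: coeff_B_def powr_minus_divide)
  qed
qed

lemma coeff_B_unbounded: 
  assumes s: "0 < s" shows "\<exists>\<epsilon>0>0. \<forall>\<epsilon>. 0 < \<epsilon> \<and> \<epsilon> < \<epsilon>0 \<longrightarrow> C < coeff_B s \<epsilon>"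
proof -
  define m where "m = min (2 * s) (1/2)"
  have m: "0 < m" using s by (simp add: m_def)
  define c where "c = 2 * (\<bar>C\<bar> + 1)"
  have c: "0 < c" by (simp add: c_def)
  have "C < coeff_B s \<epsilon>" if \<epsilon>: "0 < \<epsilon>" "\<epsilon> < min (1/2) (c powr (- 1 / m))" for \<epsilon>
  proof -
    have "(c powr (- 1 / m)) powr (- m) = c" using c m by (simp add: powr_powr)
    moreover have "(c powr (- 1 / m)) powr (- m) < \<epsilon> powr (- m)" using \<epsilon> m by (intro powr_less_mono2_neg) auto
    moreover have "\<epsilon> powr (- m) / 2 \<le> coeff_B s \<epsilon>" unfolding m_def using coeff_B_ge[of \<epsilon> s] \<epsilon> by simp
    ultimately show ?thesis by (simp add: c_def abs_if split: if_splits)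
  qed
  then show ?thesis using c by (intro exI[of _ "min (1/2) (c powr (- 1 / m))"]) auto
qed

text \<open>The coefficient of the seminorm is the reciprocal of the growth of this integral in each of the three
  regimes: bounded, logarithmic, and of order \<open>\<epsilon> powr (1 - 2 s)\<close>.\<close>

lemma coeff_A_powr_integral:
  fixes b :: real assumes s: "0 < s" and b: "1 \<le> b"
  shows "\<exists>C\<ge>0. \<forall>\<epsilon>. 0 < \<epsilon> \<and> \<epsilon> \<le> 1/2 \<longrightarrow> (\<exists>P\<ge>0. coeff_A s \<epsilon> * P \<le> C \<and>
     (\<integral>\<^sup>+t. ennreal (t powr (- 2 * s)) * indicator {\<epsilon>..b} t \<partial>lborel) \<le> ennreal P)"
proof -
  have ftc: "(\<integral>\<^sup>+t. ennreal (t powr (- 2 * s)) * indicator {\<epsilon>..b} t \<partial>lborel) = ennreal (F b - F \<epsilon>)"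
    if "0 < \<epsilon>" "\<epsilon> \<le> 1/2" and "\<And>t. 0 < t \<Longrightarrow> (F has_real_derivative t powr (- 2 * s)) (at t)" for F \<epsilon>
    by (rule nn_integral_FTC_Icc) (use that b in \<open>auto intro: has_field_derivative_at_within\<close>)
  consider "s < 1/2" | "s = 1/2" | "s > 1/2" by linarith
  then show ?thesis
  proof cases
    case 1
    define F where "F t = t powr (1 - 2 * s) / (1 - 2 * s)" for t
    have D: "(F has_real_derivative t powr (- 2 * s)) (at t)" if "0 < t" for t
      unfolding F_def using that 1 by (auto intro!: derivative_eq_intros)
    have "0 \<le> F t" for t using 1 by (simp add: F_def)
    then show ?thesis using ftc[OF _ _ D] 1
      by (intro exI[of _ "F b"] conjI allI impI) (auto simp: coeff_A_def intro!: exI[of _ "F b"] ennreal_leI)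
  next
    case 2
    have D: "(ln has_real_derivative t powr (- 2 * s)) (at t)" if "0 < t" for t
    proof -
      have "t powr (- 2 * s) = 1 / t" using that unfolding 2 by (simp add: powr_minus_divide)
      then show ?thesis using that by (auto intro!: derivative_eq_intros)
    qed
    have lb: "0 \<le> ln b" using b by simp
    have "coeff_A s \<epsilon> * (ln b - ln \<epsilon>) \<le> ln b / ln 2 + 1" "0 \<le> ln b - ln \<epsilon>" if \<epsilon>: "0 < \<epsilon>" "\<epsilon> \<le> 1/2" for \<epsilon>
    proof -
      have "ln \<epsilon> \<le> ln (1/2)" using \<epsilon> by simp
      then have l: "ln 2 \<le> - ln \<epsilon>" by (simp add: ln_div)
      have l2: "0 < ln (2::real)" by simp
      have "coeff_A s \<epsilon> * (ln b - ln \<epsilon>) = ln b / (- ln \<epsilon>) + 1"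
      proof -
        have "ln \<epsilon> < 0" using l l2 by linarith
        then show ?thesis using 2 by (simp add: coeff_A_def diff_divide_distrib)
      qed
      also have "ln b / (- ln \<epsilon>) \<le> ln b / ln 2" using l l2 lb by (intro divide_left_mono mult_pos_pos) linarith+
      finally show "coeff_A s \<epsilon> * (ln b - ln \<epsilon>) \<le> ln b / ln 2 + 1" by simp
      show "0 \<le> ln b - ln \<epsilon>" using l l2 lb by linarith
    qed
    then have "\<exists>P\<ge>0. coeff_A s \<epsilon> * P \<le> ln b / ln 2 + 1 \<and>
       (\<integral>\<^sup>+t. ennreal (t powr (- 2 * s)) * indicator {\<epsilon>..b} t \<partial>lborel) \<le> ennreal P" if "0 < \<epsilon>" "\<epsilon> \<le> 1/2" for \<epsilon>
      using ftc[OF that D] that by (intro exI[of _ "ln b - ln \<epsilon>"]) simp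
    then show ?thesis using lb by (intro exI[of _ "ln b / ln 2 + 1"]) auto
  next
    case 3
    define F where "F t = t powr (1 - 2 * s) / (1 - 2 * s)" for t
    have D: "(F has_real_derivative t powr (- 2 * s)) (at t)" if "0 < t" for t
      unfolding F_def using that 3 by (auto intro!: derivative_eq_intros)
    have "F b \<le> 0" using 3 by (simp add: F_def divide_nonneg_neg)
    have "coeff_A s \<epsilon> * (- F \<epsilon>) \<le> 1 / (2 * (2 * s - 1))" if "0 < \<epsilon>" for \<epsilon>
    proof -
      have "\<epsilon> powr (2 * s - 1) * \<epsilon> powr (1 - 2 * s) = 1" using that by (simp flip: powr_add)
      moreover have "- F \<epsilon> = \<epsilon> powr (1 - 2 * s) / (2 * s - 1)"
        unfolding F_def by (metis minus_diff_eq minus_divide_right)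
      ultimately show ?thesis using 3 by (simp add: coeff_A_def)
    qed
    moreover have "0 \<le> - F \<epsilon>" for \<epsilon> using 3 by (simp add: F_def divide_nonneg_neg)
    ultimately have "\<exists>P\<ge>0. coeff_A s \<epsilon> * P \<le> 1 / (2 * (2 * s - 1)) \<and>
       (\<integral>\<^sup>+t. ennreal (t powr (- 2 * s)) * indicator {\<epsilon>..b} t \<partial>lborel) \<le> ennreal P" if "0 < \<epsilon>" "\<epsilon> \<le> 1/2" for \<epsilon>
      using ftc[OF that D] that \<open>F b \<le> 0\<close> by (intro exI[of _ "- F \<epsilon>"]) (simp add: ennreal_leI)
    then show ?thesis using 3 by (intro exI[of _ "1 / (2 * (2 * s - 1))"]) auto
  qed
qed

section \<open>Piecewise linear profiles and the test functions\<close>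

text \<open>A profile is represented by a primitive \<open>F\<close> of a step function with values \<open>1\<close> and \<open>-1\<close> and at most
  \<open>k\<close> jumps.  Working with primitives makes averages of the step function difference quotients.\<close>

definition zigzag :: "real \<Rightarrow> real \<Rightarrow> nat \<Rightarrow> (real \<Rightarrow> real) \<Rightarrow> bool" where
  "zigzag a b k F \<longleftrightarrow> F a = 0 \<and> (\<forall>x y. \<bar>F x - F y\<bar> \<le> \<bar>x - y\<bar>) \<and>
     (\<exists>J. finite J \<and> card J \<le> k \<and> J \<subseteq> {a..b} \<and>
        (\<forall>x y. a \<le> x \<and> x \<le> y \<and> (\<forall>p\<in>J. \<not> (x \<le> p \<and> p \<le> y)) \<longrightarrow>
           (\<exists>\<sigma>\<in>{1, -1}. \<forall>z\<in>{x..y}. F z = F x + \<sigma> * (z - x))))"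

text \<open>The step function is replaced by \<open>1\<close> to the right of the grid point \<open>a + j h\<close>.  The extreme cases are
  stated separately, because the maps have to be the constant one and the identity on the whole line, not
  only between \<open>a\<close> and \<open>a + N h\<close>.\<close>

definition fold_at :: "real \<Rightarrow> real \<Rightarrow> nat \<Rightarrow> nat \<Rightarrow> (real \<Rightarrow> real) \<Rightarrow> real \<Rightarrow> real" where
  "fold_at a h N j F = (if j = 0 then (\<lambda>t. t - a) else if N \<le> j then F
     else (\<lambda>t. F (min t (a + real j * h)) + (t - min t (a + real j * h))))"

lemma zigzag_init: "zigzag a b 0 (\<lambda>t. t - a)"
  unfolding zigzag_def by (intro conjI exI[of _ "{}"] allI impI bexI[of _ 1]) auto

lemma zigzag_mono: "zigzag a b k F \<Longrightarrow> k \<le> k' \<Longrightarrow> zigzag a b k' F"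
  unfolding zigzag_def by (elim conjE exE, intro conjI exI) (assumption | erule (1) order_trans)+

lemma zigzag_neg:
  assumes "zigzag a b k F" shows "zigzag a b k (\<lambda>t. - F t)"
proof -
  obtain J where J: "finite J" "card J \<le> k" "J \<subseteq> {a..b}"
    "\<And>x y. a \<le> x \<Longrightarrow> x \<le> y \<Longrightarrow> \<forall>p\<in>J. \<not> (x \<le> p \<and> p \<le> y) \<Longrightarrow> \<exists>\<sigma>\<in>{1, -1}. \<forall>z\<in>{x..y}. F z = F x + \<sigma> * (z - x)"
    using assms unfolding zigzag_def by blast
  have "\<exists>\<sigma>\<in>{1, -1}. \<forall>z\<in>{x..y}. - F z = - F x + \<sigma> * (z - x)" if xy: "a \<le> x" "x \<le> y" "\<forall>p\<in>J. \<not> (x \<le> p \<and> p \<le> y)" for x y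
  proof -
    obtain \<sigma> where \<sigma>: "\<sigma> \<in> {1, -1}" "\<And>z. z \<in> {x..y} \<Longrightarrow> F z = F x + \<sigma> * (z - x)" using J(4)[OF xy] by blast
    show ?thesis
    proof (intro bexI[of _ "- \<sigma>"] ballI)
      show "- F z = - F x + - \<sigma> * (z - x)" if "z \<in> {x..y}" for z
        using \<sigma>(2)[OF that] by linarith
    qed (use \<sigma>(1) in auto)
  qed
  moreover have "\<bar>- F x - - F y\<bar> \<le> \<bar>x - y\<bar>" for x y
  proof -
    have "\<bar>- F x - - F y\<bar> = \<bar>F x - F y\<bar>" by simp
    then show ?thesis using assms unfolding zigzag_def by simp
  qed
  ultimately show ?thesis using J assms unfolding zigzag_def by (intro conjI exI[of _ J]) auto
qed

lemma zigzag_fold: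
  assumes F: "zigzag a b k F" and h: "0 < h" "a + real N * h = b" and j: "j \<le> N"
  shows "zigzag a b (Suc k) (fold_at a h N j F)"
proof -
  consider "j = 0" | "N \<le> j" "j \<noteq> 0" | "0 < j" "j < N" by linarith
  then show ?thesis
  proof cases
    case 1
    then have "fold_at a h N j F = (\<lambda>t. t - a)" by (simp add: fold_at_def)
    then show ?thesis using zigzag_mono[OF zigzag_init] by simp
  next
    case 2
    then have "fold_at a h N j F = F" by (simp add: fold_at_def)
    then show ?thesis using zigzag_mono[OF F] by simp
  next
    case 3
    define \<tau> where "\<tau> = a + real j * h"
    have \<tau>: "a < \<tau>" "\<tau> \<le> b" using 3 h by (auto simp: \<tau>_def mult_right_mono)
    have G: "fold_at a h N j F = (\<lambda>t. F (min t \<tau>) + (t - min t \<tau>))" using 3 by (simp add: fold_at_def \<tau>_def)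
    have F0: "F a = 0" and lip: "\<And>x y. \<bar>F x - F y\<bar> \<le> \<bar>x - y\<bar>" using F unfolding zigzag_def by auto
    obtain J where J: "finite J" "card J \<le> k" "J \<subseteq> {a..b}"
      "\<And>x y. a \<le> x \<Longrightarrow> x \<le> y \<Longrightarrow> \<forall>p\<in>J. \<not> (x \<le> p \<and> p \<le> y) \<Longrightarrow> \<exists>\<sigma>\<in>{1, -1}. \<forall>z\<in>{x..y}. F z = F x + \<sigma> * (z - x)"
      using F unfolding zigzag_def by blast
    let ?G = "\<lambda>t. F (min t \<tau>) + (t - min t \<tau>)"
    have "\<bar>?G x - ?G y\<bar> \<le> \<bar>x - y\<bar>" for x y
      using lip[of "min x \<tau>" "min y \<tau>"] by (auto simp: min_def split: if_splits)
    moreover have "\<exists>\<sigma>\<in>{1, -1}. \<forall>z\<in>{x..y}. ?G z = ?G x + \<sigma> * (z - x)"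
      if xy: "a \<le> x" "x \<le> y" "\<forall>p\<in>insert \<tau> J. \<not> (x \<le> p \<and> p \<le> y)" for x y
    proof (cases "y < \<tau>")
      case True
      obtain \<sigma> where \<sigma>: "\<sigma> \<in> {1, -1}" "\<And>z. z \<in> {x..y} \<Longrightarrow> F z = F x + \<sigma> * (z - x)"
        using J(4)[OF xy(1,2)] xy(3) by blast
      show ?thesis
      proof (intro bexI[of _ \<sigma>] ballI)
        fix z assume z: "z \<in> {x..y}"
        then have "min z \<tau> = z" "min x \<tau> = x" using True by auto
        then show "?G z = ?G x + \<sigma> * (z - x)" using \<sigma>(2)[OF z] by simp
      qed (rule \<sigma>(1))
    next
      case False
      then have "\<tau> < x" using xy by auto
      then show ?thesis by (intro bexI[of _ 1]) auto
    qed
    moreover have "card (insert \<tau> J) \<le> Suc k" using J(1,2) by (simp add: card_insert_if)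
    moreover have "insert \<tau> J \<subseteq> {a..b}" using J(3) \<tau> by auto
    ultimately show ?thesis unfolding G zigzag_def using F0 J(1) \<tau>
      by (intro conjI exI[of _ "insert \<tau> J"]) (auto simp: min_def)
  qed
qed

text \<open>Between the end points of the grid, one formula covers the extreme cases too.\<close>

lemma fold_at_eq:
  assumes "F a = 0" "0 < h" "t \<le> a + real N * h" "a \<le> t" "j \<le> N"
  shows "fold_at a h N j F t = F (min t (a + real j * h)) + (t - min t (a + real j * h))"
proof -
  consider "j = 0" | "j = N" "j \<noteq> 0" | "0 < j" "j < N" using assms(5) by linarith
  then show ?thesis by cases (use assms in \<open>auto simp: fold_at_def min_def\<close>)
qed

definition zigzag_close :: "real \<Rightarrow> real \<Rightarrow> real \<Rightarrow> nat \<Rightarrow> (real \<Rightarrow> real) \<Rightarrow> (real \<Rightarrow> real) \<Rightarrow> bool" where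
  "zigzag_close a b h d F G \<longleftrightarrow> zigzag a b d F \<and> zigzag a b d G \<and> (\<forall>t\<in>{a..b}. \<bar>F t - G t\<bar> \<le> real d * (2 * h))"

lemma zigzag_close_fold:
  assumes FG: "zigzag_close a b h d F G" and h: "0 < h" "a + real N * h = b"
    and ij: "i \<le> N" "j \<le> N" "i \<le> Suc j" "j \<le> Suc i"
  shows "zigzag_close a b h (Suc d) (fold_at a h N i F) (fold_at a h N j G)"
  unfolding zigzag_close_def
proof (intro conjI ballI)
  have FG': "zigzag a b d F" "zigzag a b d G" "\<And>t. t \<in> {a..b} \<Longrightarrow> \<bar>F t - G t\<bar> \<le> real d * (2 * h)"
    using FG by (auto simp: zigzag_close_def)
  then have 0: "F a = 0" "G a = 0" and lip: "\<And>x y. \<bar>G x - G y\<bar> \<le> \<bar>x - y\<bar>" by (auto simp: zigzag_def)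
  show "zigzag a b (Suc d) (fold_at a h N i F)" "zigzag a b (Suc d) (fold_at a h N j G)"
    using zigzag_fold[OF FG'(1) h ij(1)] zigzag_fold[OF FG'(2) h ij(2)] by blast+
  fix t assume t: "t \<in> {a..b}"
  define p q where "p = min t (a + real i * h)" and "q = min t (a + real j * h)"
  have "\<bar>real i - real j\<bar> \<le> 1" using ij by linarith
  then have "\<bar>real i * h - real j * h\<bar> \<le> h" using h by (simp add: abs_mult mult_le_cancel_right1 flip: left_diff_distrib)
  then have pq: "\<bar>p - q\<bar> \<le> h" unfolding p_def q_def by linarith
  have "0 \<le> real i * h" using h by simp
  then have "p \<in> {a..b}" using t by (auto simp: p_def)
  then have "\<bar>F p - G p\<bar> \<le> real d * (2 * h)" by (rule FG'(3))
  moreover have "fold_at a h N i F t = F p + (t - p)" "fold_at a h N j G t = G q + (t - q)"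
    unfolding p_def q_def using fold_at_eq[of F a h t N i] fold_at_eq[of G a h t N j] 0 h ij t by auto
  moreover have "\<bar>G p - G q\<bar> \<le> h" using lip[of p q] pq by linarith
  ultimately have "\<bar>fold_at a h N i F t - fold_at a h N j G t\<bar> \<le> real d * (2 * h) + 2 * h"
    using pq by linarith
  then show "\<bar>fold_at a h N i F t - fold_at a h N j G t\<bar> \<le> real (Suc d) * (2 * h)" by (simp add: algebra_simps)
qed

lemma zigzag_close_init: "zigzag_close a b h 0 (\<lambda>t. t - a) (\<lambda>t. t - a)"
  by (simp add: zigzag_close_def zigzag_init)

lemma zigzag_close_neg: "zigzag_close a b h d F G \<Longrightarrow> zigzag_close a b h d (\<lambda>t. - F t) (\<lambda>t. - G t)"
  by (auto simp: zigzag_close_def zigzag_neg abs_minus_commute)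

lemma sweeping_fold: "0 < N \<Longrightarrow> sweeping N (fold_at a h N) (\<lambda>F t. - F t)"
  by unfold_locales (auto simp: fold_at_def)

text \<open>The average of the step function over an interval of length \<open>2 \<epsilon>\<close>.\<close>

definition layer :: "real \<Rightarrow> (real \<Rightarrow> real) \<Rightarrow> real \<Rightarrow> real" where
  "layer \<epsilon> F t = (F (t + \<epsilon>) - F (t - \<epsilon>)) / (2 * \<epsilon>)"

lemma layer_neg: "layer \<epsilon> (\<lambda>t. - F t) t = - layer \<epsilon> F t"
proof -
  have "- F (t + \<epsilon>) - - F (t - \<epsilon>) = - (F (t + \<epsilon>) - F (t - \<epsilon>))" by simp
  then show ?thesis unfolding layer_def by (simp only: minus_divide_left)
qed

lemma layer_bounds:
  assumes "zigzag a b k F" "0 < \<epsilon>"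
  shows "\<bar>layer \<epsilon> F t\<bar> \<le> 1" "\<bar>layer \<epsilon> F t - layer \<epsilon> F t'\<bar> \<le> \<bar>t - t'\<bar> / \<epsilon>"
proof -
  have lip: "\<bar>F x - F y\<bar> \<le> \<bar>x - y\<bar>" for x y using assms by (auto simp: zigzag_def)
  have "\<bar>F (t + \<epsilon>) - F (t - \<epsilon>)\<bar> \<le> 2 * \<epsilon>" using lip[of "t + \<epsilon>" "t - \<epsilon>"] assms(2) by simp
  then show "\<bar>layer \<epsilon> F t\<bar> \<le> 1" using assms(2) by (simp add: layer_def abs_divide)
  have l: "\<bar>F (t + \<epsilon>) - F (t' + \<epsilon>)\<bar> \<le> \<bar>t - t'\<bar>" "\<bar>F (t - \<epsilon>) - F (t' - \<epsilon>)\<bar> \<le> \<bar>t - t'\<bar>"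
    using lip[of "t + \<epsilon>" "t' + \<epsilon>"] lip[of "t - \<epsilon>" "t' - \<epsilon>"] by simp_all
  have eq: "F (t + \<epsilon>) - F (t - \<epsilon>) - (F (t' + \<epsilon>) - F (t' - \<epsilon>)) = (F (t + \<epsilon>) - F (t' + \<epsilon>)) - (F (t - \<epsilon>) - F (t' - \<epsilon>))"
    by simp
  have "\<bar>F (t + \<epsilon>) - F (t - \<epsilon>) - (F (t' + \<epsilon>) - F (t' - \<epsilon>))\<bar> \<le> \<bar>t - t'\<bar> + \<bar>t - t'\<bar>"
    unfolding eq by (rule order_trans[OF abs_triangle_ineq4 add_mono[OF l]])
  then have "\<bar>F (t + \<epsilon>) - F (t - \<epsilon>) - (F (t' + \<epsilon>) - F (t' - \<epsilon>))\<bar> / (2 * \<epsilon>) \<le> \<bar>t - t'\<bar> / \<epsilon>"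
    using assms(2) by (simp add: field_simps)
  then show "\<bar>layer \<epsilon> F t - layer \<epsilon> F t'\<bar> \<le> \<bar>t - t'\<bar> / \<epsilon>"
    using assms(2) by (simp add: layer_def abs_divide flip: diff_divide_distrib)
qed

definition kinks :: "real \<Rightarrow> (real \<Rightarrow> real) \<Rightarrow> real set \<Rightarrow> bool" where
  "kinks a F J \<longleftrightarrow> (\<forall>x y. a \<le> x \<and> x \<le> y \<and> (\<forall>p\<in>J. \<not> (x \<le> p \<and> p \<le> y)) \<longrightarrow>
           (\<exists>\<sigma>\<in>{1, -1}. \<forall>z\<in>{x..y}. F z = F x + \<sigma> * (z - x)))"

lemma layer_away_from_kinks:
  assumes "kinks a F J" "0 < \<epsilon>" "a \<le> x" "x \<le> y" "\<forall>p\<in>J. \<not> (x \<le> p \<and> p \<le> y)"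
  obtains \<sigma> where "\<sigma> \<in> {1, -1}" "\<And>t. x \<le> t - \<epsilon> \<Longrightarrow> t + \<epsilon> \<le> y \<Longrightarrow> layer \<epsilon> F t = \<sigma>"
proof -
  obtain \<sigma> where \<sigma>: "\<sigma> \<in> {1, -1}" "\<And>z. z \<in> {x..y} \<Longrightarrow> F z = F x + \<sigma> * (z - x)"
    using assms(1)[unfolded kinks_def, rule_format, of x y] assms(3-5) by blast
  have layer: "layer \<epsilon> F t = \<sigma>" if "x \<le> t - \<epsilon>" "t + \<epsilon> \<le> y" for t
  proof -
    have "F (t + \<epsilon>) = F x + \<sigma> * (t + \<epsilon> - x)" "F (t - \<epsilon>) = F x + \<sigma> * (t - \<epsilon> - x)"
      by (rule \<sigma>(2), use that assms(2) in simp)+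
    then have "F (t + \<epsilon>) - F (t - \<epsilon>) = \<sigma> * (2 * \<epsilon>)" by (simp add: algebra_simps)
    then show ?thesis using assms(2) by (simp add: layer_def)
  qed
  show ?thesis by (rule that[OF \<sigma>(1) layer])
qed

context bounded_open_set
begin

definition halfwidth :: real where "halfwidth = (SOME R. 1 \<le> R \<and> (\<forall>x\<in>\<Omega>. \<forall>b\<in>Basis. \<bar>x \<bullet> b\<bar> \<le> R))"

lemma halfwidth: "1 \<le> halfwidth" "x \<in> \<Omega> \<Longrightarrow> b \<in> Basis \<Longrightarrow> \<bar>x \<bullet> b\<bar> \<le> halfwidth"
proof -
  obtain B where B: "\<And>x. x \<in> \<Omega> \<Longrightarrow> norm x \<le> B" using bounded_\<Omega> by (auto simp: bounded_iff)
  have "1 \<le> max 1 B \<and> (\<forall>x\<in>\<Omega>. \<forall>b\<in>Basis. \<bar>x \<bullet> b\<bar> \<le> max 1 B)"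
    using B Basis_le_norm by (meson le_max_iff_disj order_trans order_refl)
  then have "1 \<le> halfwidth \<and> (\<forall>x\<in>\<Omega>. \<forall>b\<in>Basis. \<bar>x \<bullet> b\<bar> \<le> halfwidth)" unfolding halfwidth_def by (rule someI)
  then show "1 \<le> halfwidth" "x \<in> \<Omega> \<Longrightarrow> b \<in> Basis \<Longrightarrow> \<bar>x \<bullet> b\<bar> \<le> halfwidth" by auto
qed

abbreviation "lo \<equiv> - (halfwidth + 1)"
abbreviation "hi \<equiv> halfwidth + 1"

definition axis :: 'a where "axis = (SOME b. b \<in> Basis)"

lemma axis: "axis \<in> Basis" unfolding axis_def by (rule someI_ex[of "\<lambda>b. b \<in> Basis"]) (use nonempty_Basis in blast)

definition test_fun :: "real \<Rightarrow> (real \<Rightarrow> real) \<Rightarrow> 'a \<Rightarrow> real" where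
  "test_fun \<epsilon> F x = layer \<epsilon> F (x \<bullet> axis)"

lemma test_fun_unit:
  assumes "zigzag a b k F" "0 < \<epsilon>" shows "test_fun \<epsilon> F \<in> U"
proof -
  have "continuous_on UNIV (layer \<epsilon> F)"
    unfolding continuous_on_iff
  proof (intro ballI allI impI)
    fix t e :: real assume "0 < e"
    have "dist (layer \<epsilon> F t') (layer \<epsilon> F t) < e" if "dist t' t < \<epsilon> * e" for t'
    proof -
      have "\<bar>layer \<epsilon> F t' - layer \<epsilon> F t\<bar> \<le> \<bar>t' - t\<bar> / \<epsilon>" by (rule layer_bounds(2)[OF assms])
      also have "\<dots> < e" using that assms(2) by (simp add: dist_real_def field_simps)
      finally show ?thesis by (simp add: dist_real_def)
    qed
    then show "\<exists>d>0. \<forall>x'\<in>UNIV. dist x' t < d \<longrightarrow> dist (layer \<epsilon> F x') (layer \<epsilon> F t) < e"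
      using \<open>0 < e\<close> assms(2) by (intro exI[of _ "\<epsilon> * e"]) auto
  qed
  then have [measurable]: "layer \<epsilon> F \<in> borel_measurable borel" by (rule borel_measurable_continuous_onI)
  have "test_fun \<epsilon> F \<in> borel_measurable M" unfolding test_fun_def[abs_def] by measurable
  then show ?thesis using layer_bounds(1)[OF assms] by (simp add: unit_functions_def test_fun_def)
qed

lemma test_fun_close:
  assumes FG: "zigzag_close lo hi h d F G" and \<epsilon>: "0 < \<epsilon>" "\<epsilon> \<le> 1"
  shows "L1_dist M (test_fun \<epsilon> F) (test_fun \<epsilon> G) \<le> volume * (real d * (2 * h) / \<epsilon>)"
proof -
  have U: "test_fun \<epsilon> F \<in> U" "test_fun \<epsilon> G \<in> U" using FG \<epsilon> test_fun_unit by (auto simp: zigzag_close_def)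
  have "L1_dist M (test_fun \<epsilon> F) (test_fun \<epsilon> G) \<le> (\<integral>x. real d * (2 * h) / \<epsilon> \<partial>M)"
  proof (rule integral_mono)
    fix x assume "x \<in> space M"
    then have "\<bar>x \<bullet> axis\<bar> \<le> halfwidth" using halfwidth(2) axis space_M by auto
    then have t: "x \<bullet> axis + \<epsilon> \<in> {lo..hi}" "x \<bullet> axis - \<epsilon> \<in> {lo..hi}" using \<epsilon> by (auto simp: abs_le_iff)
    have "\<bar>F (x \<bullet> axis + \<epsilon>) - G (x \<bullet> axis + \<epsilon>)\<bar> \<le> real d * (2 * h)" "\<bar>F (x \<bullet> axis - \<epsilon>) - G (x \<bullet> axis - \<epsilon>)\<bar> \<le> real d * (2 * h)"
      using FG t unfolding zigzag_close_def by blast+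
    then have "\<bar>(F (x \<bullet> axis + \<epsilon>) - F (x \<bullet> axis - \<epsilon>)) - (G (x \<bullet> axis + \<epsilon>) - G (x \<bullet> axis - \<epsilon>))\<bar> \<le> 2 * (real d * (2 * h))" by linarith
    then have "\<bar>(F (x \<bullet> axis + \<epsilon>) - F (x \<bullet> axis - \<epsilon>)) - (G (x \<bullet> axis + \<epsilon>) - G (x \<bullet> axis - \<epsilon>))\<bar> / (2 * \<epsilon>) \<le> real d * (2 * h) / \<epsilon>"
      using \<epsilon> by (simp add: field_simps)
    then show "\<bar>test_fun \<epsilon> F x - test_fun \<epsilon> G x\<bar> \<le> real d * (2 * h) / \<epsilon>"
      using \<epsilon> by (simp add: test_fun_def layer_def abs_divide flip: diff_divide_distrib)
  qed (use M.unit_functions_integrable(2)[OF U] in auto)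
  then show ?thesis by (simp add: volume_def space_M)
qed

definition slab_const :: real where "slab_const = 2 * (2 * halfwidth) ^ (DIM('a) - 1)"

lemma slab_const_nonneg: "0 \<le> slab_const" using halfwidth(1) by (simp add: slab_const_def)

lemma emeasure_M_le: "S \<in> sets borel \<Longrightarrow> emeasure M {x \<in> space M. x \<in> S} \<le> emeasure lborel S"
proof -
  assume S: "S \<in> sets borel"
  have "{x \<in> space M. x \<in> S} = S \<inter> \<Omega>" by (auto simp: space_M)
  moreover have "emeasure M (S \<inter> \<Omega>) = emeasure lborel (S \<inter> \<Omega>)" using S by (intro emeasure_M) auto
  ultimately show ?thesis using S by (metis emeasure_mono inf_le1 sets_lborel)
qed

lemma emeasure_slab:
  assumes r: "0 < r" shows "emeasure M {x \<in> space M. \<bar>x \<bullet> axis - p\<bar> \<le> r} \<le> ennreal (slab_const * r)"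
proof -
  let ?R = halfwidth
  define l :: 'a where "l = (\<Sum>b\<in>Basis. (if b = axis then p - r else - ?R) *\<^sub>R b)"
  define u :: 'a where "u = (\<Sum>b\<in>Basis. (if b = axis then p + r else ?R) *\<^sub>R b)"
  have l: "l \<bullet> b = (if b = axis then p - r else - ?R)" if "b \<in> Basis" for b using that by (simp add: l_def)
  have u: "u \<bullet> b = (if b = axis then p + r else ?R)" if "b \<in> Basis" for b using that by (simp add: u_def)
  have R: "0 \<le> ?R" using halfwidth(1) by simp
  have "(\<Prod>b\<in>Basis. (u - l) \<bullet> b) = (\<Prod>b\<in>Basis. if b = axis then 2 * r else 2 * ?R)"
    by (rule prod.cong) (auto simp: inner_diff_left l u)
  also have "\<dots> = 2 * r * (\<Prod>b\<in>Basis - {axis}. if b = axis then 2 * r else 2 * ?R)"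
    using axis by (subst prod.remove[of _ axis]) auto
  also have "(\<Prod>b\<in>Basis - {axis}. if b = axis then 2 * r else 2 * ?R) = (\<Prod>b\<in>Basis - {axis}. 2 * ?R)"
    by (rule prod.cong) auto
  also have "\<dots> = (2 * ?R) ^ (DIM('a) - 1)" using axis by simp
  finally have vol: "(\<Prod>b\<in>Basis. (u - l) \<bullet> b) = slab_const * r" by (simp add: slab_const_def)
  have lu: "l \<bullet> b \<le> u \<bullet> b" if "b \<in> Basis" for b using l[OF that] u[OF that] r R by auto
  have "{x \<in> space M. \<bar>x \<bullet> axis - p\<bar> \<le> r} \<subseteq> {x \<in> space M. x \<in> cbox l u}"
    using halfwidth(2) l u by (fastforce simp: mem_box space_M abs_le_iff)
  moreover have "{x \<in> space M. x \<in> cbox l u} \<in> sets M" using sets_M[of "cbox l u"] by (simp add: space_M Int_def conj_commute)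
  ultimately have "emeasure M {x \<in> space M. \<bar>x \<bullet> axis - p\<bar> \<le> r} \<le> emeasure M {x \<in> space M. x \<in> cbox l u}" by (rule emeasure_mono)
  also have "\<dots> \<le> emeasure lborel (cbox l u)" by (rule emeasure_M_le) simp
  also have "\<dots> = ennreal (slab_const * r)" using lu vol by (simp add: emeasure_lborel_cbox)
  finally show ?thesis .
qed

lemma emeasure_ball_M:
  assumes "0 < r" shows "emeasure M {y \<in> space M. norm (x - y) \<le> r} \<le> ennreal (unit_ball_vol (real DIM('a)) * r ^ DIM('a))"
proof -
  have "{y \<in> space M. norm (x - y) \<le> r} = {y \<in> space M. y \<in> cball x r}" by (auto simp: dist_norm)
  then have "emeasure M {y \<in> space M. norm (x - y) \<le> r} \<le> emeasure lborel (cball x r)" using emeasure_M_le[of "cball x r"] by simp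
  also have "\<dots> = ennreal (unit_ball_vol (real DIM('a)) * r ^ DIM('a))" using assms by (subst emeasure_cball) auto
  finally show ?thesis .
qed

definition kernel_const :: "real \<Rightarrow> real" where
  "kernel_const s = unit_ball_vol (real DIM('a)) * 2 ^ DIM('a) / (1 - 2 powr (-2 * s))
     + unit_ball_vol (real DIM('a)) * 2 ^ DIM('a) * 2 powr (2 * s) / (1 - 2 powr (2 * s - 2))"

lemma kernel_const_nonneg: "0 < s \<Longrightarrow> s < 1 \<Longrightarrow> 0 \<le> kernel_const s"
  unfolding kernel_const_def using powr_less_mono[of "- 2 * s" 0 2] powr_less_mono[of "2 * s - 2" 0 2]
  by (intro add_nonneg_nonneg divide_nonneg_nonneg mult_nonneg_nonneg) auto

text \<open>Up to a factor the distance from the layer at \<open>p\<close>, cut off below at the width of the layer.\<close>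

definition scale :: "real \<Rightarrow> real \<Rightarrow> 'a \<Rightarrow> real" where
  "scale \<epsilon> p x = max \<epsilon> (\<bar>x \<bullet> axis - p\<bar> / 2)"

lemma scale_measurable [measurable]: "scale \<epsilon> p \<in> borel_measurable M"
  unfolding scale_def by measurable

text \<open>If the values at \<open>x\<close> and \<open>y\<close> differ, some kink \<open>p\<close> lies within \<open>\<epsilon>\<close> of the segment between the two
  coordinates.  At distance less than the scale of \<open>p\<close> this is only possible inside the layer, where the
  Lipschitz bound applies; at larger distances the bound by \<open>2\<close> suffices.\<close>

lemma diff_sq_test_fun:
  assumes F: "zigzag lo b k F" "kinks lo F J" "finite J" and \<epsilon>: "0 < \<epsilon>" "\<epsilon> \<le> 1" and xy: "x \<in> \<Omega>" "y \<in> \<Omega>"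
  shows "diff_sq s (test_fun \<epsilon> F) (x, y) \<le> 4 * (\<Sum>p\<in>J. min 1 ((norm (x - y) / scale \<epsilon> p x)\<^sup>2) / norm (x - y) powr (real DIM('a) + 2 * s))"
proof -
  let ?u = "test_fun \<epsilon> F" and ?k = "\<lambda>p. min 1 ((norm (x - y) / scale \<epsilon> p x)\<^sup>2) / norm (x - y) powr (real DIM('a) + 2 * s)"
  let ?t = "x \<bullet> axis" and ?t' = "y \<bullet> axis"
  have tt: "\<bar>?t - ?t'\<bar> \<le> norm (x - y)" using Basis_le_norm[OF axis, of "x - y"] by (simp add: inner_diff_left)
  have bd: "\<bar>?t\<bar> \<le> halfwidth" "\<bar>?t'\<bar> \<le> halfwidth" using halfwidth(2) axis xy by auto
  have ge0: "0 \<le> ?k p" for p by simp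
  show ?thesis
  proof (cases "?u x = ?u y")
    case True
    then show ?thesis using ge0 by (simp add: diff_sq_def sum_nonneg)
  next
    case False
    define l r where "l = min ?t ?t' - \<epsilon>" and "r = max ?t ?t' + \<epsilon>"
    have "\<exists>p\<in>J. l \<le> p \<and> p \<le> r"
    proof (rule ccontr)
      assume "\<not> ?thesis"
      moreover have "lo \<le> l" "l \<le> r" using bd \<epsilon> by (auto simp: l_def r_def abs_le_iff)
      ultimately obtain \<sigma> where "\<And>t. l \<le> t - \<epsilon> \<Longrightarrow> t + \<epsilon> \<le> r \<Longrightarrow> layer \<epsilon> F t = \<sigma>"
        using layer_away_from_kinks[OF F(2) \<epsilon>(1), of l r] by blast
      from this[of ?t] this[of ?t'] show False using False by (auto simp: l_def r_def test_fun_def)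
    qed
    then obtain p where p: "p \<in> J" "l \<le> p" "p \<le> r" by blast
    define z where "z = norm (x - y)"
    have dp: "\<bar>?t - p\<bar> \<le> z + \<epsilon>"
    proof (cases "?t \<le> ?t'")
      case True
      then show ?thesis using p tt \<epsilon>(1) by (auto simp: l_def r_def z_def abs_le_iff)
    next
      case False
      then show ?thesis using p tt \<epsilon>(1) by (auto simp: l_def r_def z_def abs_le_iff)
    qed
    have sc: "0 < scale \<epsilon> p x" using \<epsilon> by (simp add: scale_def)
    have "\<bar>?u x - ?u y\<bar> \<le> 2 * min 1 (z / scale \<epsilon> p x)"
    proof -
      have 2: "\<bar>?u x - ?u y\<bar> \<le> 2"
        using layer_bounds(1)[OF F(1) \<epsilon>(1), of ?t] layer_bounds(1)[OF F(1) \<epsilon>(1), of ?t'] by (simp add: test_fun_def)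
      have lip: "\<bar>?u x - ?u y\<bar> \<le> z / \<epsilon>"
        using layer_bounds(2)[OF F(1) \<epsilon>(1), of ?t ?t'] divide_right_mono[OF tt, of \<epsilon>] \<epsilon> by (simp add: test_fun_def z_def)
      show ?thesis
      proof (cases "scale \<epsilon> p x \<le> z")
        case True
        then show ?thesis using 2 sc by simp
      next
        case False
        have "scale \<epsilon> p x \<le> \<epsilon>"
        proof (rule ccontr)
          assume "\<not> scale \<epsilon> p x \<le> \<epsilon>"
          then have "scale \<epsilon> p x = \<bar>?t - p\<bar> / 2" "\<epsilon> < \<bar>?t - p\<bar> / 2" by (auto simp: scale_def max_def split: if_splits)
          moreover define w where "w = \<bar>?t - p\<bar>"
          ultimately have "z < w / 2" "\<epsilon> < w / 2" "w \<le> z + \<epsilon>" using dp False by auto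
          then show False by argo
        qed
        then have s\<epsilon>: "scale \<epsilon> p x = \<epsilon>" by (simp add: scale_def)
        have z0: "0 \<le> z" by (simp add: z_def)
        have "z / \<epsilon> \<le> 1" using False s\<epsilon> \<epsilon> by simp
        moreover have "0 \<le> z / \<epsilon>" using z0 \<epsilon> by simp
        ultimately show ?thesis using lip s\<epsilon> by simp
      qed
    qed
    then have "(?u x - ?u y)\<^sup>2 \<le> (2 * min 1 (z / scale \<epsilon> p x))\<^sup>2"
      by (metis abs_ge_zero power2_abs power_mono)
    also have "\<dots> = 4 * min 1 ((z / scale \<epsilon> p x)\<^sup>2)"
    proof (cases "z / scale \<epsilon> p x \<le> 1")
      case True
      moreover have "0 \<le> z / scale \<epsilon> p x" using sc by (simp add: z_def)
      ultimately have "(z / scale \<epsilon> p x)\<^sup>2 \<le> 1" by (simp add: power_le_one)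
      then have "min 1 (z / scale \<epsilon> p x) = z / scale \<epsilon> p x" "min 1 ((z / scale \<epsilon> p x)\<^sup>2) = (z / scale \<epsilon> p x)\<^sup>2"
        using True by simp_all
      then show ?thesis by (simp only: power_mult_distrib) simp
    next
      case False
      then have "1 \<le> (z / scale \<epsilon> p x)\<^sup>2" by (intro one_le_power) simp
      then show ?thesis using False by simp
    qed
    finally have "diff_sq s ?u (x, y) \<le> 4 * min 1 ((z / scale \<epsilon> p x)\<^sup>2) * frac_kernel s x y"
      unfolding diff_sq_def prod.case by (rule mult_right_mono) (rule frac_kernel_nonneg)
    also have "\<dots> = 4 * ?k p" by (simp add: frac_kernel_def z_def)
    also have "\<dots> \<le> 4 * (\<Sum>p\<in>J. ?k p)" using p(1) F(3) ge0 by (intro mult_left_mono member_le_sum) auto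
    finally show ?thesis .
  qed
qed

text \<open>The potential vanishes outside the layers, and in the layer at \<open>p\<close> the scale is \<open>\<epsilon>\<close>.\<close>

lemma W_test_fun:
  assumes F: "zigzag lo b k F" "kinks lo F J" "finite J" and \<epsilon>: "0 < \<epsilon>" "\<epsilon> \<le> 1" and x: "x \<in> \<Omega>"
    and W: "W 1 = 0" "W (-1) = (0::real)" "\<And>t. \<bar>t\<bar> \<le> 1 \<Longrightarrow> W t \<le> Wm" "0 \<le> Wm"
  shows "W (test_fun \<epsilon> F x) \<le> Wm * \<epsilon> powr (2 * s) * (\<Sum>p\<in>J. scale \<epsilon> p x powr (- 2 * s))"
proof (cases "\<exists>p\<in>J. \<bar>x \<bullet> axis - p\<bar> \<le> \<epsilon>")
  case True
  then obtain p where p: "p \<in> J" "\<bar>x \<bullet> axis - p\<bar> \<le> \<epsilon>" by blast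
  have "\<bar>x \<bullet> axis - p\<bar> / 2 \<le> \<epsilon>" using p(2) \<epsilon>(1) by argo
  then have "scale \<epsilon> p x = \<epsilon>" by (simp add: scale_def)
  then have "\<epsilon> powr (- 2 * s) \<le> (\<Sum>p\<in>J. scale \<epsilon> p x powr (- 2 * s))"
    using p(1) F(3) member_le_sum[of p J "\<lambda>p. scale \<epsilon> p x powr (- 2 * s)"] by simp
  then have "Wm * \<epsilon> powr (2 * s) * \<epsilon> powr (- 2 * s) \<le> Wm * \<epsilon> powr (2 * s) * (\<Sum>p\<in>J. scale \<epsilon> p x powr (- 2 * s))"
    using W(4) by (intro mult_left_mono) auto
  moreover have "\<epsilon> powr (2 * s) * \<epsilon> powr (- 2 * s) = 1" using \<epsilon> by (simp flip: powr_add)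
  moreover have "W (test_fun \<epsilon> F x) \<le> Wm" using W(3) layer_bounds(1)[OF F(1) \<epsilon>(1)] by (simp add: test_fun_def)
  ultimately show ?thesis by (simp add: mult.assoc)
next
  case False
  have "\<bar>x \<bullet> axis\<bar> \<le> halfwidth" using halfwidth(2) axis x by auto
  then have "lo \<le> x \<bullet> axis - \<epsilon>" "x \<bullet> axis - \<epsilon> \<le> x \<bullet> axis + \<epsilon>" using \<epsilon> by (auto simp: abs_le_iff)
  moreover have "\<forall>p\<in>J. \<not> (x \<bullet> axis - \<epsilon> \<le> p \<and> p \<le> x \<bullet> axis + \<epsilon>)" using False by (auto simp: abs_le_iff)
  ultimately obtain \<sigma> where \<sigma>: "\<sigma> \<in> {1, -1}"
      "\<And>t. x \<bullet> axis - \<epsilon> \<le> t - \<epsilon> \<Longrightarrow> t + \<epsilon> \<le> x \<bullet> axis + \<epsilon> \<Longrightarrow> layer \<epsilon> F t = \<sigma>"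
    using layer_away_from_kinks[OF F(2) \<epsilon>(1)] by blast
  have "test_fun \<epsilon> F x = \<sigma>" unfolding test_fun_def by (rule \<sigma>(2)) simp_all
  then have "W (test_fun \<epsilon> F x) = 0" using W(1,2) \<sigma>(1) by auto
  then show ?thesis using W(4) by (simp add: sum_nonneg)
qed

end

section \<open>Energy of the test functions and many critical points\<close>

context bounded_open_set
begin

lemma seminorm_test_fun:
  assumes F: "zigzag lo hi k F" "kinks lo F J" "finite J" "J \<subseteq> {lo..hi}" and \<epsilon>: "0 < \<epsilon>" "\<epsilon> \<le> 1" and s: "0 < s" "s < 1"
    and Q: "0 \<le> Q" "\<And>p. p \<in> J \<Longrightarrow> (\<integral>\<^sup>+x. ennreal (scale \<epsilon> p x powr (- 2 * s)) \<partial>M) \<le> ennreal Q"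
  shows "test_fun \<epsilon> F \<in> H_space s \<Omega>" "seminorm s (test_fun \<epsilon> F) \<le> 4 * kernel_const s * (real (card J) * Q)"
proof -
  let ?u = "test_fun \<epsilon> F" and ?n = "real DIM('a)"
  let ?k = "\<lambda>p x y. min 1 ((norm (x - y) / scale \<epsilon> p x)\<^sup>2) / norm (x - y) powr (?n + 2 * s)"
  have uU: "?u \<in> U" by (rule test_fun_unit[OF F(1) \<epsilon>(1)])
  then have [measurable]: "?u \<in> borel_measurable M" by (simp add: unit_functions_def)
  have kc: "0 \<le> kernel_const s" by (rule kernel_const_nonneg[OF s])
  have inner: "(\<integral>\<^sup>+y. ennreal (diff_sq s ?u (x, y)) \<partial>M) \<le> (\<Sum>p\<in>J. ennreal (4 * kernel_const s) * ennreal (scale \<epsilon> p x powr (- 2 * s)))"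
    if x: "x \<in> space M" for x
  proof -
    have "(\<integral>\<^sup>+y. ennreal (diff_sq s ?u (x, y)) \<partial>M) \<le> (\<integral>\<^sup>+y. (\<Sum>p\<in>J. 4 * ennreal (?k p x y)) \<partial>M)"
    proof (rule nn_integral_mono)
      fix y assume y: "y \<in> space M"
      have "diff_sq s ?u (x, y) \<le> 4 * (\<Sum>p\<in>J. ?k p x y)"
        using diff_sq_test_fun[OF F(1-3) \<epsilon>] x y space_M by blast
      then have "ennreal (diff_sq s ?u (x, y)) \<le> ennreal (4 * (\<Sum>p\<in>J. ?k p x y))" by (rule ennreal_leI)
      also have "\<dots> = (\<Sum>p\<in>J. 4 * ennreal (?k p x y))"
        unfolding sum_distrib_left by (subst sum_ennreal[symmetric]) (auto intro!: sum.cong simp: ennreal_mult simp del: times_divide_eq_right)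
      finally show "ennreal (diff_sq s ?u (x, y)) \<le> (\<Sum>p\<in>J. 4 * ennreal (?k p x y))" .
    qed
    also have "\<dots> = (\<Sum>p\<in>J. 4 * (\<integral>\<^sup>+y. ennreal (?k p x y) \<partial>M))"
      by (simp add: nn_integral_sum nn_integral_cmult)
    also have "\<dots> \<le> (\<Sum>p\<in>J. ennreal (4 * kernel_const s) * ennreal (scale \<epsilon> p x powr (- 2 * s)))"
    proof (rule sum_mono)
      fix p
      have sc: "0 < scale \<epsilon> p x" using \<epsilon> by (simp add: scale_def)
      have "(\<integral>\<^sup>+y. ennreal (?k p x y) \<partial>M) \<le> ennreal (kernel_const s * scale \<epsilon> p x powr (- 2 * s))"
        unfolding kernel_const_def
        by (rule kernel_integral_bound) (use emeasure_ball_M s sc in auto)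
      then have "4 * (\<integral>\<^sup>+y. ennreal (?k p x y) \<partial>M) \<le> 4 * ennreal (kernel_const s * scale \<epsilon> p x powr (- 2 * s))"
        by (intro mult_left_mono) auto
      also have "\<dots> = ennreal (4 * kernel_const s) * ennreal (scale \<epsilon> p x powr (- 2 * s))"
        using kc by (simp add: ennreal_mult mult.assoc)
      finally show "4 * (\<integral>\<^sup>+y. ennreal (?k p x y) \<partial>M) \<le> ennreal (4 * kernel_const s) * ennreal (scale \<epsilon> p x powr (- 2 * s))" .
    qed
    finally show ?thesis .
  qed
  have "frac_seminorm_sq s \<Omega> ?u = (\<integral>\<^sup>+x. (\<integral>\<^sup>+y. ennreal (diff_sq s ?u (x, y)) \<partial>M) \<partial>M)"
    unfolding frac_seminorm_sq_eq by (rule M.nn_integral_fst[symmetric]) measurable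
  also have "\<dots> \<le> (\<integral>\<^sup>+x. (\<Sum>p\<in>J. ennreal (4 * kernel_const s) * ennreal (scale \<epsilon> p x powr (- 2 * s))) \<partial>M)"
    by (rule nn_integral_mono) (rule inner)
  also have "\<dots> = (\<Sum>p\<in>J. ennreal (4 * kernel_const s) * (\<integral>\<^sup>+x. ennreal (scale \<epsilon> p x powr (- 2 * s)) \<partial>M))"
    by (simp add: nn_integral_sum nn_integral_cmult)
  also have "\<dots> \<le> (\<Sum>p\<in>J. ennreal (4 * kernel_const s) * ennreal Q)"
    by (intro sum_mono mult_left_mono Q(2)) auto
  also have "\<dots> = ennreal (4 * kernel_const s * (real (card J) * Q))"
    using kc Q(1) by (simp add: ennreal_of_nat_eq_real_of_nat mult_ac flip: ennreal_mult)
  finally have fin: "frac_seminorm_sq s \<Omega> ?u \<le> ennreal (4 * kernel_const s * (real (card J) * Q))" .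
  have "integrable M (\<lambda>x. (?u x)\<^sup>2)"
    using M.unit_functions_integrable(3)[OF uU, of "\<lambda>_. 0"] by (simp add: unit_functions_def)
  then show H: "?u \<in> H_space s \<Omega>"
    unfolding H_space_def dom_M using fin by (auto intro: le_less_trans)
  show "seminorm s ?u \<le> 4 * kernel_const s * (real (card J) * Q)"
    using fin frac_seminorm_sq_seminorm[OF H] kc Q(1) by simp
qed

text \<open>Both parts of the energy are controlled by the integral of \<open>scale powr (- 2 s)\<close>; for the potential this
  uses that \<open>coeff_B * \<epsilon> powr (2 s)\<close> is at most twice \<open>coeff_A\<close>.\<close>

lemma test_fun_energy:
  assumes s: "0 < s" "s < 1" and [measurable]: "W \<in> borel_measurable borel"
    and W: "W 1 = 0" "W (-1) = (0::real)" "\<And>t. \<bar>t\<bar> \<le> 1 \<Longrightarrow> W t \<le> Wm" "0 \<le> Wm" "\<And>t. 0 \<le> W t"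
  shows "\<exists>C\<ge>0. \<forall>\<epsilon> k F. 0 < \<epsilon> \<and> \<epsilon> \<le> 1/2 \<and> zigzag lo hi k F \<longrightarrow>
     test_fun \<epsilon> F \<in> H_space s \<Omega> \<and>
     coeff_A s \<epsilon> * seminorm s (test_fun \<epsilon> F) + coeff_B s \<epsilon> * (\<integral>x. W (test_fun \<epsilon> F x) \<partial>M) \<le> real k * C"
proof -
  obtain C0 where C0: "0 \<le> C0" "\<And>\<epsilon>. 0 < \<epsilon> \<Longrightarrow> \<epsilon> \<le> 1/2 \<Longrightarrow> \<exists>P\<ge>0. coeff_A s \<epsilon> * P \<le> C0 \<and>
     (\<integral>\<^sup>+t. ennreal (t powr (- 2 * s)) * indicator {\<epsilon>..2 * hi} t \<partial>lborel) \<le> ennreal P"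
    using coeff_A_powr_integral[OF s(1), of "2 * hi"] halfwidth(1) by auto
  have kc: "0 \<le> kernel_const s" by (rule kernel_const_nonneg[OF s])
  define c where "c = 4 * slab_const * 2 powr (2 * s)"
  have c: "0 \<le> c" using slab_const_nonneg by (simp add: c_def)
  define C where "C = (4 * kernel_const s + 2 * Wm) * c * C0"
  have C: "0 \<le> C" using kc W(4) c C0(1) by (simp add: C_def)
  have "test_fun \<epsilon> F \<in> H_space s \<Omega> \<and>
     coeff_A s \<epsilon> * seminorm s (test_fun \<epsilon> F) + coeff_B s \<epsilon> * (\<integral>x. W (test_fun \<epsilon> F x) \<partial>M) \<le> real k * C"
    if \<epsilon>: "0 < \<epsilon>" "\<epsilon> \<le> 1/2" and F: "zigzag lo hi k F" for \<epsilon> k F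
  proof -
    let ?u = "test_fun \<epsilon> F"
    have \<epsilon>1: "\<epsilon> \<le> 1" using \<epsilon> by simp
    obtain J where J: "finite J" "card J \<le> k" "J \<subseteq> {lo..hi}" "kinks lo F J"
      using F unfolding zigzag_def kinks_def by blast
    obtain P where P: "0 \<le> P" "coeff_A s \<epsilon> * P \<le> C0"
      "(\<integral>\<^sup>+t. ennreal (t powr (- 2 * s)) * indicator {\<epsilon>..2 * hi} t \<partial>lborel) \<le> ennreal P"
      using C0(2)[OF \<epsilon>] by blast
    define Q where "Q = c * P"
    have Q0: "0 \<le> Q" using c P(1) by (simp add: Q_def)
    have Q: "(\<integral>\<^sup>+x. ennreal (scale \<epsilon> p x powr (- 2 * s)) \<partial>M) \<le> ennreal Q" if p: "p \<in> J" for p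
      unfolding scale_def Q_def c_def
    proof (rule weight_integral_bound[OF M.sigma_finite_measure_axioms _ _ _ _ s(1) \<epsilon>(1) _ slab_const_nonneg P(1,3)])
      show "(\<lambda>x. \<bar>x \<bullet> axis - p\<bar>) \<in> borel_measurable M" by measurable
      show "emeasure M {x \<in> space M. \<bar>x \<bullet> axis - p\<bar> \<le> r} \<le> ennreal (slab_const * r)" if "0 < r" for r
        by (rule emeasure_slab[OF that])
      show "\<bar>x \<bullet> axis - p\<bar> \<le> 2 * hi" if "x \<in> space M" for x
      proof -
        have "\<bar>x \<bullet> axis\<bar> \<le> halfwidth" using halfwidth(2) axis that space_M by auto
        moreover have "\<bar>p\<bar> \<le> hi" using p J(3) by (auto simp: abs_le_iff)
        ultimately have "\<bar>x \<bullet> axis\<bar> + \<bar>p\<bar> \<le> 2 * hi" by simp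
        then show ?thesis using abs_triangle_ineq4[of "x \<bullet> axis" p] by linarith
      qed
      show "\<epsilon> \<le> hi" using \<epsilon> halfwidth(1) by simp
    qed simp
    note sem = seminorm_test_fun[OF F J(4,1,3) \<epsilon>(1) \<epsilon>1 s Q0 Q]
    have uU: "?u \<in> U" by (rule test_fun_unit[OF F \<epsilon>(1)])
    then have [measurable]: "?u \<in> borel_measurable M" by (simp add: unit_functions_def)
    have "(\<integral>\<^sup>+x. ennreal (W (?u x)) \<partial>M) \<le> (\<integral>\<^sup>+x. ennreal (Wm * \<epsilon> powr (2 * s)) * (\<Sum>p\<in>J. ennreal (scale \<epsilon> p x powr (- 2 * s))) \<partial>M)"
    proof (rule nn_integral_mono)
      fix x assume x: "x \<in> space M"
      have "W (?u x) \<le> Wm * \<epsilon> powr (2 * s) * (\<Sum>p\<in>J. scale \<epsilon> p x powr (- 2 * s))"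
        by (rule W_test_fun[where k = k]) (use F J \<epsilon>(1) \<epsilon>1 x space_M W in auto)
      then have "ennreal (W (?u x)) \<le> ennreal (Wm * \<epsilon> powr (2 * s) * (\<Sum>p\<in>J. scale \<epsilon> p x powr (- 2 * s)))" by (rule ennreal_leI)
      then show "ennreal (W (?u x)) \<le> ennreal (Wm * \<epsilon> powr (2 * s)) * (\<Sum>p\<in>J. ennreal (scale \<epsilon> p x powr (- 2 * s)))"
        using W(4) by (simp add: ennreal_mult sum_nonneg)
    qed
    also have "\<dots> = ennreal (Wm * \<epsilon> powr (2 * s)) * (\<Sum>p\<in>J. \<integral>\<^sup>+x. ennreal (scale \<epsilon> p x powr (- 2 * s)) \<partial>M)"
      by (simp add: nn_integral_sum nn_integral_cmult del: sum_ennreal)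
    also have "\<dots> \<le> ennreal (Wm * \<epsilon> powr (2 * s)) * (\<Sum>p\<in>J. ennreal Q)"
      by (intro mult_left_mono sum_mono Q) auto
    also have "\<dots> = ennreal (Wm * \<epsilon> powr (2 * s) * (real (card J) * Q))"
      using W(4) Q0 by (simp add: ennreal_of_nat_eq_real_of_nat flip: ennreal_mult)
    finally have "(\<integral>\<^sup>+x. ennreal (W (?u x)) \<partial>M) \<le> ennreal (Wm * \<epsilon> powr (2 * s) * (real (card J) * Q))" .
    then have Wint: "(\<integral>x. W (?u x) \<partial>M) \<le> Wm * \<epsilon> powr (2 * s) * (real (card J) * Q)"
      using W(4,5) Q0 by (intro integral_real_bounded) auto
    have A: "0 < coeff_A s \<epsilon>" and B: "0 < coeff_B s \<epsilon>" using coeff_A_pos coeff_B_pos \<epsilon> by auto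
    have "coeff_A s \<epsilon> * seminorm s ?u \<le> coeff_A s \<epsilon> * (4 * kernel_const s * (real (card J) * Q))"
      using A sem(2) by (intro mult_left_mono) auto
    moreover have "coeff_B s \<epsilon> * (\<integral>x. W (?u x) \<partial>M) \<le> coeff_B s \<epsilon> * (Wm * \<epsilon> powr (2 * s) * (real (card J) * Q))"
      using B Wint by (intro mult_left_mono) auto
    moreover have "\<dots> = (coeff_B s \<epsilon> * \<epsilon> powr (2 * s)) * (Wm * (real (card J) * Q))" by simp
    moreover have "\<dots> \<le> (2 * coeff_A s \<epsilon>) * (Wm * (real (card J) * Q))"
      using coeff_B_le[OF \<epsilon>] W(4) Q0 by (intro mult_right_mono) auto
    ultimately have "coeff_A s \<epsilon> * seminorm s ?u + coeff_B s \<epsilon> * (\<integral>x. W (?u x) \<partial>M)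
       \<le> coeff_A s \<epsilon> * (4 * kernel_const s * (real (card J) * Q)) + (2 * coeff_A s \<epsilon>) * (Wm * (real (card J) * Q))"
      by linarith
    also have "\<dots> = real (card J) * ((4 * kernel_const s + 2 * Wm) * c * (coeff_A s \<epsilon> * P))"
      by (simp add: Q_def algebra_simps)
    also have "\<dots> \<le> real (card J) * C"
      unfolding C_def using kc W(4) c P(2) by (intro mult_left_mono) auto
    also have "\<dots> \<le> real k * C" using J(2) C by (intro mult_right_mono) auto
    finally show ?thesis using sem(1) by blast
  qed
  then show ?thesis using C by blast
qed

end

context double_well
begin

text \<open>A profile is labelled by the index of the first member of the covering that contains its test function or
  its antipode, with a sign that tells which one it is.  On a grid so fine that the test functions of one
  simplex are closer than all gaps, complementary labels do not occur in a simplex, which contradicts the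
  combinatorial Borsuk-Ulam theorem.\<close>

lemma no_antipodal_cover:
  assumes test: "\<And>d F. d \<le> k \<Longrightarrow> zigzag lo hi d F \<Longrightarrow> test_fun \<epsilon> F \<in> X" and \<epsilon>: "0 < \<epsilon>" "\<epsilon> \<le> 1"
    and X: "X \<subseteq> U" "\<And>u. u \<in> X \<Longrightarrow> (\<lambda>x. - u x) \<in> X"
    and gap: "\<And>i. i < k \<Longrightarrow> 0 < \<delta> i" "\<And>i u v. i < k \<Longrightarrow> u \<in> D i \<Longrightarrow> v \<in> D i \<Longrightarrow> \<delta> i \<le> L1_dist M u (\<lambda>x. - v x)"
    and cover: "\<And>u. u \<in> X \<Longrightarrow> \<exists>i<k. u \<in> D i \<or> (\<lambda>x. - u x) \<in> D i"
  shows False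
proof -
  let ?w = "2 * hi"
  have w: "0 < ?w" using halfwidth(1) by simp
  define m where "m = Min (insert 1 (\<delta> ` {..<k}))"
  have m: "0 < m" "\<And>i. i < k \<Longrightarrow> m \<le> \<delta> i" unfolding m_def using gap(1) by (auto intro: Min_le)
  \<comment> \<open>The diameter of a simplex of dimension \<open>k\<close> on a grid with \<open>N\<close> intervals is at most \<open>c / N\<close>.\<close>
  define c where "c = volume * (real k * (2 * ?w) / \<epsilon>)"
  obtain N0 where N0: "c / m < real N0" using reals_Archimedean2 by blast
  define N where "N = Suc N0"
  define h where "h = ?w / real N"
  have N: "0 < N" "c < m * real N" using N0 m(1) by (auto simp: N_def field_simps)
  have h: "0 < h" "lo + real N * h = hi" using w N(1) by (auto simp: h_def)
  have small: "volume * (real k * (2 * h) / \<epsilon>) < m"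
  proof -
    have "volume * (real k * (2 * h) / \<epsilon>) = c / real N" by (simp add: c_def h_def)
    also have "\<dots> < m" using N by (simp add: field_simps)
    finally show ?thesis .
  qed
  interpret S: sweeping N "fold_at lo h N" "\<lambda>F t. - F t" "\<lambda>t. t - lo" by (rule sweeping_fold[OF N(1)])
  define t where "t = test_fun \<epsilon>"
  have t_neg: "t (\<lambda>x. - F x) = (\<lambda>x. - t F x)" for F by (simp add: t_def test_fun_def layer_neg fun_eq_iff)
  define idx where "idx F = (LEAST i. i < k \<and> (t F \<in> D i \<or> (\<lambda>x. - t F x) \<in> D i))" for F
  define lab where "lab F = (if t F \<in> D (idx F) then int (idx F) + 1 else - (int (idx F) + 1))" for F
  have idx_neg: "idx (\<lambda>x. - F x) = idx F" for F
    unfolding idx_def t_neg by (simp add: disj_commute)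
  have idx: "idx F < k \<and> (t F \<in> D (idx F) \<or> (\<lambda>x. - t F x) \<in> D (idx F))" if "t F \<in> X" for F
    unfolding idx_def by (rule LeastI_ex) (use cover[OF that] in blast)
  have excl: "\<not> (u \<in> D i \<and> (\<lambda>x. - u x) \<in> D i)" if "i < k" for u i
    using gap(2)[OF that, of u "\<lambda>x. - u x"] gap(1)[OF that] by auto
  have vert: "zigzag lo hi d v" if "\<sigma> \<in> set (S.hemi d)" "v \<in> set \<sigma>" for d \<sigma> v
    by (rule S.hemi_vertices[OF that, where P = "zigzag lo hi"])
       (use zigzag_init zigzag_neg zigzag_fold h in blast)+
  have close: "zigzag_close lo hi h d v v'" if "\<sigma> \<in> set (S.hemi d)" "v \<in> set \<sigma>" "v' \<in> set \<sigma>" for d \<sigma> v v'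
    by (rule S.hemi_spread[OF that, where R = "zigzag_close lo hi h"])
       (use zigzag_close_init zigzag_close_neg zigzag_close_fold h in blast)+
  have inX: "t v \<in> X" if "d \<le> k" "\<sigma> \<in> set (S.hemi d)" "v \<in> set \<sigma>" for d \<sigma> v
    unfolding t_def by (rule test[OF that(1) vert[OF that(2,3)]])
  have lab_neg: "lab (\<lambda>x. - v x) = - lab v" if "t v \<in> X" for v
    using idx[OF that] excl[of "idx v" "t v"] unfolding lab_def idx_neg t_neg by auto
  show False
  proof (rule S.hemisphere_label_bound[of k lab])
    show "lab (\<lambda>x. - v x) = - lab v" if "d \<le> k" "\<sigma> \<in> set (S.hemi d)" "v \<in> set \<sigma>" for d \<sigma> v
      by (rule lab_neg[OF inX[OF that]])
    show "\<bar>lab v\<bar> \<le> int k" if "\<sigma> \<in> set (S.hemi k)" "v \<in> set \<sigma>" for \<sigma> v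
      using idx[OF inX[OF order_refl that]] by (auto simp: lab_def)
    show "no_complementary (lab ` set \<sigma>)" if d: "d \<le> k" "\<sigma> \<in> set (S.hemi d)" for d \<sigma>
      unfolding no_complementary_def
    proof (intro ballI conjI notI)
      fix l assume "l \<in> lab ` set \<sigma>"
      then obtain v where v: "v \<in> set \<sigma>" "l = lab v" by blast
      then show "l = 0 \<Longrightarrow> False" by (simp add: lab_def split: if_splits)
      assume "- l \<in> lab ` set \<sigma>"
      then obtain v' where v': "v' \<in> set \<sigma>" "- l = lab v'" by blast
      have far: False if ww: "w \<in> set \<sigma>" "w' \<in> set \<sigma>" "lab w = - lab w'" "0 < lab w" for w w'
      proof -
        have iw: "t w \<in> D (idx w)" "lab w = int (idx w) + 1" using ww(4) by (auto simp: lab_def split: if_splits)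
        have iw': "t w' \<notin> D (idx w')" "lab w' = - (int (idx w') + 1)" using ww(3,4) by (auto simp: lab_def split: if_splits)
        have eq: "idx w' = idx w" using iw(2) iw'(2) ww(3) by simp
        have "(\<lambda>x. - t w' x) \<in> D (idx w)" using idx[OF inX[OF d ww(2)]] iw'(1) eq by auto
        moreover have i: "idx w < k" using idx[OF inX[OF d ww(1)]] by blast
        ultimately have "\<delta> (idx w) \<le> L1_dist M (t w) (t w')" using gap(2)[OF i iw(1), of "\<lambda>x. - t w' x"] by simp
        moreover have "L1_dist M (t w) (t w') \<le> volume * (real d * (2 * h) / \<epsilon>)"
          unfolding t_def by (rule test_fun_close[OF close[OF d(2) ww(1,2)] \<epsilon>])
        moreover have "volume * (real d * (2 * h) / \<epsilon>) \<le> volume * (real k * (2 * h) / \<epsilon>)"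
          using d(1) h(1) \<epsilon> volume_pos by (intro mult_left_mono divide_right_mono mult_right_mono) auto
        ultimately show False using small m(2)[OF i] by linarith
      qed
      show False
      proof (cases "0 < l")
        case True
        then show False using far[OF v(1) v'(1)] v(2) v'(2) by simp
      next
        case False
        moreover have "lab v' \<noteq> 0" by (simp add: lab_def split: if_splits)
        ultimately show False using far[OF v'(1) v(1)] v(2) v'(2) by simp
      qed
    qed
  qed
qed

text \<open>The bound \<open>zero\<close> says that the function \<open>0\<close>, the only one that equals its antipode, is not in the
  sublevel set of \<open>c\<close>.\<close>

theorem many_critical_points:
  assumes test: "\<And>d F. d \<le> k \<Longrightarrow> zigzag lo hi d F \<Longrightarrow> test_fun \<epsilon> F \<in> K \<and> E (test_fun \<epsilon> F) \<le> c"
    and \<epsilon>: "0 < \<epsilon>" "\<epsilon> \<le> 1" and zero: "c < B * W 0 * volume"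
    and w: "w \<in> K" "\<And>v. v \<in> K \<Longrightarrow> (\<integral>x. v x \<partial>M) = 0 \<Longrightarrow> E w \<le> E v"
  shows "\<exists>P. finite P \<and> card P = k \<and>
     (\<forall>p\<in>P. p \<in> K \<and> E p \<le> c \<and> E w \<le> E p \<and> 0 < L1_dist M p (\<lambda>x. - p x) \<and>
        (\<forall>v\<in>H_space s \<Omega>. 2 * A * frac_form s \<Omega> p v + B * (\<integral>x. deriv W (p x) * v x \<partial>M) = 0) \<and>
        (\<forall>v\<in>H_space s \<Omega>. 2 * A * frac_form s \<Omega> (\<lambda>x. - p x) v + B * (\<integral>x. deriv W (- p x) * v x \<partial>M) = 0)) \<and>
     (\<forall>p\<in>P. \<forall>q\<in>P. p \<noteq> q \<longrightarrow> 0 < L1_dist M p q \<and> 0 < L1_dist M p (\<lambda>x. - q x))"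
proof -
  define X where "X = {u \<in> K. E u \<le> c}"
  have XU: "u \<in> U" "u \<in> K" if "u \<in> X" for u using that K_D by (auto simp: X_def)
  have X_uminus: "(\<lambda>x. - u x) \<in> X" if "u \<in> X" for u using that K_uminus E_uminus by (auto simp: X_def)
  have not_zero: "0 < L1_dist M u (\<lambda>x. - u x)" if u: "u \<in> X" for u
  proof (rule ccontr)
    assume "\<not> ?thesis"
    moreover have "0 \<le> L1_dist M u (\<lambda>x. - u x)" by simp
    ultimately have "L1_dist M u (\<lambda>x. - u x) = 0" by linarith
    moreover have "\<bar>u x - - u x\<bar> = 2 * \<bar>u x\<bar>" for x by simp
    ultimately have "(\<integral>x. 2 * \<bar>u x\<bar> \<partial>M) = 0" by (simp only:)
    then have d0: "L1_dist M u (\<lambda>_. 0) = 0" by simp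
    have "E (\<lambda>_. 0) \<le> c"
    proof (rule E_lsc(2)[of "\<lambda>_. u"])
      show "u \<in> K" using XU u by blast
      show "\<forall>\<^sub>F n in sequentially. E u \<le> c + \<delta>" if "0 < \<delta>" for \<delta> using u that by (simp add: X_def)
      show "(\<lambda>_. 0) \<in> U" using K_zero K_D by blast
    qed (simp add: d0[simplified])
    moreover have "B * W 0 * volume \<le> E (\<lambda>_. 0)"
      using A seminorm_nonneg[of s "\<lambda>_. 0"] by (simp add: E_def volume_def space_M)
    ultimately show False using zero by simp
  qed
  interpret O: odd_dynamics X "L1_dist M" "\<lambda>u x. - u x" T \<Phi> "\<lambda>u. \<integral>x. T u x \<partial>M" "E w"
  proof
    fix u v z assume u: "u \<in> X"
    show "L1_dist M u u = 0" by simp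
    show "(\<lambda>x. - u x) \<in> X" using X_uminus u .
    show "(\<lambda>x. - (- u x)) = u" by simp
    show "0 < L1_dist M u (\<lambda>x. - u x)" using not_zero u .
    have "E (T u) \<le> c" using E_T_le[of u] \<Phi>_le_E[OF XU(2)[OF u]] u by (simp add: X_def)
    then show "T u \<in> X" using T_K[OF XU(1)[OF u]] by (simp add: X_def)
    show "T (\<lambda>x. - u x) = (\<lambda>x. - T u x)" by (rule T_uminus)
    show "0 \<le> \<Phi> u" unfolding \<Phi>_def by (rule J_nonneg)
    show "\<Phi> (\<lambda>x. - u x) = \<Phi> u" unfolding \<Phi>_def T_uminus by (rule J_uminus)
    have T1: "\<Phi> (T u) \<le> E (T u)" by (rule \<Phi>_le_E[OF T_K[OF XU(1)[OF u]]])
    then show "\<Phi> (T u) \<le> \<Phi> u" using E_T_le[of u] by linarith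
    show "L1_dist M u (T u) = 0" if "\<Phi> (T u) = \<Phi> u"
    proof -
      have "\<tau> * sqdist (T u) u \<le> 0" using T1 that E_T[of u] by linarith
      then have "sqdist (T u) u = 0" using \<tau>_pos sqdist_nonneg[of "T u" u] by (simp add: mult_le_0_iff)
      then have "L1_dist M (T u) u = 0" by (rule L1_dist_zero_of_sqdist[OF K_D(1)[OF T_K[OF XU(1)[OF u]]] XU(1)[OF u]])
      then show ?thesis by (simp add: abs_minus_commute)
    qed
    show "(\<integral>x. T (\<lambda>x. - u x) x \<partial>M) = - (\<integral>x. T u x \<partial>M)" by (simp add: T_uminus)
    show "(\<integral>x. T u x \<partial>M) \<noteq> 0" if "\<Phi> u < E w"
      using w(2)[of "T u"] T_K[OF XU(1)[OF u]] E_T_le[of u] that by force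
    assume v: "v \<in> X"
    show "L1_dist M u v = L1_dist M v u" by (simp add: abs_minus_commute)
    show "0 \<le> L1_dist M u v" by simp
    show "L1_dist M (\<lambda>x. - u x) (\<lambda>x. - v x) = L1_dist M u v" by (simp add: abs_minus_commute)
    assume z: "z \<in> X"
    show "L1_dist M u z \<le> L1_dist M u v + L1_dist M v z" by (rule M.L1_dist_triangle[OF XU(1)[OF u] XU(1)[OF v] XU(1)[OF z]])
  next
    fix f :: "nat \<Rightarrow> 'a \<Rightarrow> real" assume f: "\<And>n. f n \<in> X"
    have fK: "f n \<in> K" "E (f n) \<le> c" for n using f by (auto simp: X_def)
    obtain r v where r: "strict_mono r" "v \<in> U" "(\<lambda>n. L1_dist M (f (r n)) v) \<longlonglongrightarrow> 0"
      using E_compact[of f c, OF fK] by blast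
    have "\<forall>\<^sub>F n in sequentially. E (f (r n)) \<le> c + \<delta>" if "0 < \<delta>" for \<delta>
      using fK(2) that by (intro always_eventually allI) (auto intro: add_increasing2 less_imp_le)
    from E_lsc[of "\<lambda>n. f (r n)" c v, OF fK(1) this r(2,3)] have "v \<in> X" by (simp add: X_def)
    then show "\<exists>l\<in>X. \<exists>r. strict_mono r \<and> (\<lambda>n. L1_dist M (f (r n)) l) \<longlonglongrightarrow> 0" using r by blast
  next
    fix e :: real assume e: "0 < e"
    obtain \<delta> where \<delta>: "\<delta> > 0" "\<And>u v. u \<in> U \<Longrightarrow> v \<in> U \<Longrightarrow> L1_dist M u v < \<delta> \<Longrightarrow> L1_dist M (T u) (T v) < e"
      using T_uniformly_continuous[OF e] by blast
    then show "\<exists>\<delta>>0. \<forall>x\<in>X. \<forall>y\<in>X. L1_dist M x y < \<delta> \<longrightarrow> L1_dist M (T x) (T y) < e"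
      using XU(1) by blast
    have "\<bar>(\<integral>x. T u x \<partial>M) - (\<integral>x. T v x \<partial>M)\<bar> < e" if "u \<in> U" "v \<in> U" "L1_dist M u v < \<delta>" for u v
      using mean_diff_le[OF K_D(1)[OF T_K[OF that(1)]] K_D(1)[OF T_K[OF that(2)]]] \<delta>(2)[OF that] by linarith
    then show "\<exists>\<delta>>0. \<forall>x\<in>X. \<forall>y\<in>X. L1_dist M x y < \<delta> \<longrightarrow> \<bar>(\<integral>xa. T x xa \<partial>M) - (\<integral>x. T y x \<partial>M)\<bar> < e"
      using XU(1) \<delta>(1) by blast
    have "\<bar>\<Phi> u - \<Phi> v\<bar> < e" if "u \<in> U" "v \<in> U" "L1_dist M u v < e / (4 * \<tau>)" for u v
    proof -
      have "4 * \<tau> * L1_dist M u v < e" using that(3) \<tau>_pos by (simp add: field_simps)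
      then show ?thesis using \<Phi>_Lipschitz[OF that(1,2)] by linarith
    qed
    then show "\<exists>\<delta>>0. \<forall>x\<in>X. \<forall>y\<in>X. L1_dist M x y < \<delta> \<longrightarrow> \<bar>\<Phi> x - \<Phi> y\<bar> < e"
      using XU(1) e \<tau>_pos by (intro exI[of _ "e / (4 * \<tau>)"]) auto
  qed
  have "\<not> O.antipodal_cover X k"
  proof
    assume "O.antipodal_cover X k"
    then obtain D where D: "\<forall>i<k. \<exists>\<delta>. O.gap \<delta> (D i)" "\<forall>y\<in>X. \<exists>i<k. y \<in> D i \<or> (\<lambda>x. - y x) \<in> D i"
      unfolding O.antipodal_cover_def by blast
    then obtain \<delta> where \<delta>: "\<And>i. i < k \<Longrightarrow> O.gap (\<delta> i) (D i)" by metis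
    show False
    proof (rule no_antipodal_cover[where X = X and k = k and D = D and \<delta> = \<delta>, OF _ \<epsilon>])
      show "test_fun \<epsilon> F \<in> X" if "d \<le> k" "zigzag lo hi d F" for d F using test[OF that] by (simp add: X_def)
      show "X \<subseteq> U" using XU by blast
      show "(\<lambda>x. - u x) \<in> X" if "u \<in> X" for u by (rule X_uminus[OF that])
      show "0 < \<delta> i" if "i < k" for i using \<delta>[OF that] by (simp add: O.gap_def)
      show "\<delta> i \<le> L1_dist M u (\<lambda>x. - v x)" if "i < k" "u \<in> D i" "v \<in> D i" for i u v
        using \<delta>[OF that(1)] that(2,3) unfolding O.gap_def by blast
      show "\<exists>i<k. u \<in> D i \<or> (\<lambda>x. - u x) \<in> D i" if "u \<in> X" for u by (rule bspec[OF D(2) that])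
    qed
  qed
  from O.many_fixed_points[OF this] obtain P where P1:
    "finite P \<and> card P = k \<and> (\<forall>p\<in>P. p \<in> X \<and> L1_dist M p (T p) = 0 \<and> E w \<le> \<Phi> p) \<and>
     (\<forall>p\<in>P. \<forall>q\<in>P. p \<noteq> q \<longrightarrow> 0 < L1_dist M p q \<and> 0 < L1_dist M p (\<lambda>x. - q x))"
    by (rule exE)
  have P: "finite P" "card P = k"
    and PX: "\<And>p. p \<in> P \<Longrightarrow> p \<in> X \<and> L1_dist M p (T p) = 0 \<and> E w \<le> \<Phi> p"
    and sep: "\<forall>p\<in>P. \<forall>q\<in>P. p \<noteq> q \<longrightarrow> 0 < L1_dist M p q \<and> 0 < L1_dist M p (\<lambda>x. - q x)"
    using P1 by simp_all
  show ?thesis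
  proof (intro exI[of _ P] conjI ballI impI)
    fix p assume p: "p \<in> P"
    have pX: "p \<in> K" "E p \<le> c" "L1_dist M p (T p) = 0" "E w \<le> \<Phi> p" using PX[OF p] by (auto simp: X_def)
    show "p \<in> K" "E p \<le> c" using pX by auto
    show "E w \<le> E p" using pX fixed_point_E[OF pX(1,3)] by simp
    show "0 < L1_dist M p (\<lambda>x. - p x)" using not_zero PX[OF p] by blast
    fix v assume v: "v \<in> H_space s \<Omega>"
    show "2 * A * frac_form s \<Omega> p v + B * (\<integral>x. deriv W (p x) * v x \<partial>M) = 0"
      by (rule fixed_point_critical[OF pX(1,3) v])
    have "L1_dist M (\<lambda>x. - p x) (T (\<lambda>x. - p x)) = 0" using pX(3) by (simp add: T_uminus abs_minus_commute)
    then show "2 * A * frac_form s \<Omega> (\<lambda>x. - p x) v + B * (\<integral>x. deriv W (- p x) * v x \<partial>M) = 0"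
      using fixed_point_critical[OF K_uminus[OF pX(1)] _ v] by simp
  next
    fix p q assume "p \<in> P" "q \<in> P" "p \<noteq> q"
    with sep show "0 < L1_dist M p q" "0 < L1_dist M p (\<lambda>x. - q x)" by blast+
  qed (fact P)+
qed

end

section \<open>The potential and the multiplicity theorem\<close>

lemma frechet_derivative_one:
  fixes f :: "real \<Rightarrow> real" assumes "f differentiable (at x)"
  shows "frechet_derivative f (at x) 1 = deriv f x"
proof -
  have "(f has_real_derivative deriv f x) (at x)" using assms by (simp add: DERIV_deriv_iff_real_differentiable)
  then have "(f has_derivative (*) (deriv f x)) (at x)" by (simp add: has_field_derivative_def)
  then have "frechet_derivative f (at x) = (*) (deriv f x)" by (rule frechet_derivative_at[symmetric])
  then show ?thesis by simp
qed

lemma C_2_real: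
  fixes W :: "real \<Rightarrow> real" assumes "C_k 2 W"
  shows "(W has_real_derivative deriv W x) (at x)" "(deriv W has_real_derivative deriv (deriv W) x) (at x)"
    "continuous_on UNIV (deriv (deriv W))"
proof -
  have C: "C_k (Suc (Suc 0)) W" using assms by (simp add: numeral_2_eq_2)
  then have d1: "W differentiable (at x)" for x by simp
  then have 1: "(\<lambda>x. frechet_derivative W (at x) 1) = deriv W" using frechet_derivative_one by auto
  have d2: "deriv W differentiable (at x)" for x using C by (simp add: 1)
  then have 2: "(\<lambda>x. frechet_derivative (deriv W) (at x) 1) = deriv (deriv W)" using frechet_derivative_one by auto
  show "continuous_on UNIV (deriv (deriv W))" using C by (simp add: 1 2)
  show "(W has_real_derivative deriv W x) (at x)" "(deriv W has_real_derivative deriv (deriv W) x) (at x)"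
    using d1 d2 by (auto simp: DERIV_deriv_iff_real_differentiable)
qed

text \<open>With \<open>m\<close> a bound for the second derivative, \<open>m t\<^sup>2 / 2\<close> plus or minus \<open>W t\<close> is convex.  If clipping changes
  \<open>a + h\<close>, the clipped point is \<open>1\<close> or \<open>-1\<close>; there the first derivative vanishes, hence at \<open>a\<close> it is
  of the order of \<open>h\<close> and the error made in the linear term is of second order.\<close>

lemma second_order_bounds:
  fixes W :: "real \<Rightarrow> real"
  assumes C2: "C_k 2 W" and W1: "deriv W 1 = 0" "deriv W (-1) = 0"
  shows "\<exists>L\<ge>0. (\<forall>a b. \<bar>a\<bar> \<le> 1 \<longrightarrow> \<bar>b\<bar> \<le> 1 \<longrightarrow> W ((a + b) / 2) \<le> (W a + W b) / 2 + L / 8 * (a - b)\<^sup>2) \<and>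
     (\<forall>a h. \<bar>a\<bar> \<le> 1 \<longrightarrow> W (clip (a + h)) \<le> W a + deriv W a * h + L * h\<^sup>2)"
proof -
  let ?I = "{-1..1::real}"
  note D1 = C_2_real(1)[OF C2] and D2 = C_2_real(2)[OF C2]
  have "compact (deriv (deriv W) ` ?I)"
    using C_2_real(3)[OF C2] by (intro compact_continuous_image) (auto intro: continuous_on_subset)
  then have "bounded (deriv (deriv W) ` ?I)" by (rule compact_imp_bounded)
  then obtain m where "\<forall>x\<in>deriv (deriv W) ` ?I. norm x \<le> m" unfolding bounded_iff by (rule exE)
  then have m: "\<bar>deriv (deriv W) t\<bar> \<le> m" if "t \<in> ?I" for t using that by simp
  have m0: "0 \<le> m" using m[of 0] by simp
  have I: "t \<in> ?I \<longleftrightarrow> \<bar>t\<bar> \<le> 1" for t by (auto simp: abs_le_iff)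
  have conv_up: "convex_on ?I (\<lambda>t. W t + m / 2 * t\<^sup>2)"
  proof (rule f''_ge0_imp_convex)
    fix t :: real assume t: "t \<in> ?I"
    show "((\<lambda>t. W t + m / 2 * t\<^sup>2) has_real_derivative (deriv W t + m * t)) (at t)"
      by (auto intro!: derivative_eq_intros D1)
    show "((\<lambda>t. deriv W t + m * t) has_real_derivative (deriv (deriv W) t + m)) (at t)"
      by (auto intro!: derivative_eq_intros D2)
    show "0 \<le> deriv (deriv W) t + m" using m[OF t] by linarith
  qed simp
  have conv_down: "convex_on ?I (\<lambda>t. m / 2 * t\<^sup>2 - W t)"
  proof (rule f''_ge0_imp_convex)
    fix t :: real assume t: "t \<in> ?I"
    show "((\<lambda>t. m / 2 * t\<^sup>2 - W t) has_real_derivative (m * t - deriv W t)) (at t)"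
      by (auto intro!: derivative_eq_intros D1)
    show "((\<lambda>t. m * t - deriv W t) has_real_derivative (m - deriv (deriv W) t)) (at t)"
      by (auto intro!: derivative_eq_intros D2)
    show "0 \<le> m - deriv (deriv W) t" using m[OF t] by linarith
  qed simp
  have mid: "W ((a + b) / 2) \<le> (W a + W b) / 2 + m / 8 * (a - b)\<^sup>2" if "\<bar>a\<bar> \<le> 1" "\<bar>b\<bar> \<le> 1" for a b
  proof -
    have "W ((a + b) / 2) + m / 2 * ((a + b) / 2)\<^sup>2 \<le> (W a + m / 2 * a\<^sup>2) / 2 + (W b + m / 2 * b\<^sup>2) / 2"
    proof -
      have "a \<in> ?I" "b \<in> ?I" using that I by auto
      from convex_onD[OF conv_up _ _ this, of "1/2"] show ?thesis by (simp add: add_divide_distrib)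
    qed
    then show ?thesis by (simp add: power2_eq_square field_simps)
  qed
  have taylor: "W b \<le> W a + deriv W a * (b - a) + m / 2 * (b - a)\<^sup>2" if "\<bar>a\<bar> \<le> 1" "\<bar>b\<bar> \<le> 1" for a b
  proof -
    have "(m / 2 * b\<^sup>2 - W b) - (m / 2 * a\<^sup>2 - W a) \<ge> (m * a - deriv W a) * (b - a)"
    proof (rule f''_imp_f')
      show "convex ?I" by simp
      show "((\<lambda>t. m / 2 * t\<^sup>2 - W t) has_real_derivative (m * t - deriv W t)) (at t)" for t
        by (auto intro!: derivative_eq_intros D1)
      show "((\<lambda>t. m * t - deriv W t) has_real_derivative (m - deriv (deriv W) t)) (at t)" for t
        by (auto intro!: derivative_eq_intros D2)
      show "0 \<le> m - deriv (deriv W) t" if "t \<in> ?I" for t using m[OF that] by linarith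
    qed (use that I in auto)
    then show ?thesis by (simp add: power2_eq_square field_simps)
  qed
  have slope: "\<bar>deriv W a\<bar> \<le> m * \<bar>a - e\<bar>" if "\<bar>a\<bar> \<le> 1" "e = 1 \<or> e = -1" for a e
  proof -
    have "\<bar>deriv W a - deriv W e\<bar> \<le> m * \<bar>a - e\<bar>"
    proof -
      have "norm (deriv W a - deriv W e) \<le> m * norm (a - e)"
        by (rule field_differentiable_bound[of ?I "deriv W" "deriv (deriv W)"])
           (use D2 m that in \<open>auto simp: abs_le_iff intro: has_field_derivative_at_within\<close>)
      then show ?thesis by simp
    qed
    then show ?thesis using W1 that(2) by auto
  qed
  have clip_taylor: "W (clip (a + h)) \<le> W a + deriv W a * h + 2 * m * h\<^sup>2" if a: "\<bar>a\<bar> \<le> 1" for a h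
  proof -
    define b where "b = clip (a + h)"
    have b1: "\<bar>b\<bar> \<le> 1" by (simp add: b_def clip_props)
    have ba: "\<bar>b - a\<bar> \<le> \<bar>h\<bar>" using clip_props(3)[of "a + h" a] clip_props(4)[OF a] by (simp add: b_def)
    have sq: "(b - a)\<^sup>2 \<le> h\<^sup>2" using ba by (simp add: abs_le_square_iff)
    have "deriv W a * (b - a) \<le> deriv W a * h + m * h\<^sup>2"
    proof (cases "b = a + h")
      case True
      then show ?thesis using m0 by simp
    next
      case False
      then have "b = 1 \<or> b = -1" and bh: "\<bar>(b - a) - h\<bar> \<le> \<bar>h\<bar>"
        using a by (auto simp: b_def clip_def max_def min_def abs_le_iff split: if_splits)
      then have "\<bar>deriv W a\<bar> \<le> m * \<bar>b - a\<bar>" using slope[OF a, of b] by (simp add: abs_minus_commute)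
      also have "\<dots> \<le> m * \<bar>h\<bar>" using ba m0 by (intro mult_left_mono)
      finally have "\<bar>deriv W a\<bar> * \<bar>(b - a) - h\<bar> \<le> (m * \<bar>h\<bar>) * \<bar>h\<bar>" using bh m0 by (intro mult_mono) auto
      then have "deriv W a * ((b - a) - h) \<le> m * h\<^sup>2"
        by (metis abs_le_D1 abs_mult mult.assoc abs_mult_self_eq power2_eq_square)
      then show ?thesis by (simp add: algebra_simps)
    qed
    moreover have "m / 2 * (b - a)\<^sup>2 \<le> m / 2 * h\<^sup>2" using sq m0 by (intro mult_left_mono) auto
    moreover have "0 \<le> m * h\<^sup>2" using m0 by simp
    ultimately show ?thesis using taylor[OF a b1] unfolding b_def[symmetric] by linarith
  qed
  have "m / 8 * (a - b)\<^sup>2 \<le> 2 * m / 8 * (a - b)\<^sup>2" for a b using m0 by (intro mult_right_mono) auto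
  then have "W ((a + b) / 2) \<le> (W a + W b) / 2 + 2 * m / 8 * (a - b)\<^sup>2" if "\<bar>a\<bar> \<le> 1" "\<bar>b\<bar> \<le> 1" for a b
    using mid[OF that] by (meson add_left_mono order_trans)
  then show ?thesis using clip_taylor m0 by (intro exI[of _ "2 * m"]) auto
qed

context bounded_open_set
begin

lemma ae_eq_L1_dist: "ae_eq \<Omega> u v \<Longrightarrow> L1_dist M u v = 0"
  unfolding ae_eq_def dom_M by (intro integral_eq_zero_AE) auto

lemma AE_M_ex:
  assumes "AE x in M. P x" shows "\<exists>x\<in>\<Omega>. P x"
proof (rule ccontr)
  assume no: "\<not> (\<exists>x\<in>\<Omega>. P x)"
  obtain N where N: "{x \<in> space M. \<not> P x} \<subseteq> N" "emeasure M N = 0" "N \<in> sets M" using AE_E[OF assms] by blast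
  have "\<Omega> \<subseteq> N" using N(1) no by (auto simp: space_M)
  then have "emeasure M \<Omega> = 0" using emeasure_mono[OF _ N(3), of \<Omega>] N(2) by simp
  then show False using volume_pos by (simp add: volume_def measure_def)
qed

end

context double_well
begin

lemma energy_eq:
  assumes "u \<in> K" "A = coeff_A s \<epsilon>" "B = coeff_B s \<epsilon>"
  shows "energy s W \<Omega> \<epsilon> u = ennreal (E u)"
proof -
  have "(\<integral>\<^sup>+x. ennreal (W (u x)) \<partial>M) = ennreal (\<integral>x. W (u x) \<partial>M)"
    using W_integrable[OF K_D(1)[OF assms(1)]] W_nonneg by (intro nn_integral_eq_integral) auto
  then show ?thesis
    using A B W_nonneg seminorm_nonneg
    by (simp add: energy_def dom_M assms(2,3)[symmetric] frac_seminorm_sq_seminorm[OF K_D(2)[OF assms(1)]] E_def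
        flip: ennreal_mult ennreal_plus)
qed

lemma energy_clip_le:
  assumes v: "v \<in> H_space s \<Omega>" and ae: "AE x in M. \<bar>v x\<bar> \<le> 1"
  shows "energy s W \<Omega> \<epsilon> (\<lambda>x. clip (v x)) \<le> energy s W \<Omega> \<epsilon> v"
proof -
  have "frac_seminorm_sq s \<Omega> (\<lambda>x. clip (v x)) \<le> frac_seminorm_sq s \<Omega> v"
    using K_clip[OF v] frac_seminorm_sq_seminorm[OF v] frac_seminorm_sq_seminorm[OF K_D(2)[OF K_clip(1)[OF v]]]
    by (simp add: ennreal_leI)
  moreover have "(\<integral>\<^sup>+x. ennreal (W (clip (v x))) \<partial>M) = (\<integral>\<^sup>+x. ennreal (W (v x)) \<partial>M)"
    by (rule nn_integral_cong_AE) (use ae in eventually_elim, simp add: clip_props(4))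
  ultimately show ?thesis unfolding energy_def dom_M by (auto intro!: add_mono mult_left_mono)
qed

text \<open>A function of energy \<open>0\<close> is almost everywhere equal to a constant at which the potential vanishes, and
  the only constant of zero mean is \<open>0\<close>.\<close>

lemma E_pos_of_zero_mean:
  assumes w: "w \<in> K" "(\<integral>x. w x \<partial>M) = 0" and W0: "0 < W 0"
  shows "0 < E w"
proof (rule ccontr)
  assume "\<not> 0 < E w"
  then have E0: "E w = 0" using E_nonneg[of w] by simp
  have nn: "0 \<le> A * seminorm s w" "0 \<le> B * (\<integral>x. W (w x) \<partial>M)" using A B W_nonneg seminorm_nonneg[of s w] by auto
  then have "seminorm s w = 0" "(\<integral>x. W (w x) \<partial>M) = 0" using E0 A B unfolding E_def by (auto simp: add_nonneg_eq_0_iff)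
  then have "AE p in M \<Otimes>\<^sub>M M. diff_sq s w p = 0" and ae_W: "AE x in M. W (w x) = 0"
    using integral_nonneg_eq_0_iff_AE[OF H_space_diff_sq[OF K_D(2)[OF w(1)]]] diff_sq_nonneg
      integral_nonneg_eq_0_iff_AE[OF W_integrable[OF K_D(1)[OF w(1)]]] W_nonneg by (auto simp: seminorm_def)
  then have "AE x in M. AE y in M. diff_sq s w (x, y) = 0" by (intro MM.AE_pair)
  then obtain x where x: "AE y in M. diff_sq s w (x, y) = 0" using AE_M_ex by blast
  have eq: "AE y in M. w y = w x"
    using x by eventually_elim (auto simp: diff_sq_def frac_kernel_def)
  have [measurable]: "w \<in> borel_measurable M" using K_D w H_space_borel by blast
  have "(\<integral>y. w y \<partial>M) = (\<integral>y. w x \<partial>M)" by (rule integral_cong_AE) (use eq in auto)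
  then have "w x = 0" using w(2) volume_pos by (simp add: volume_def space_M)
  then have "AE y in M. w y = 0 \<and> W (w y) = 0" using eq ae_W by (intro AE_conjI) simp_all
  then obtain y where "w y = 0" "W (w y) = 0" using AE_M_ex by blast
  then have "W 0 = 0" by simp
  then show False using W0 by simp
qed

lemma E_const_zero: assumes "W c = 0" shows "E (\<lambda>_. c) = 0"
proof -
  have "diff_sq s (\<lambda>_. c) = (\<lambda>_. 0)" by (auto simp: diff_sq_def fun_eq_iff)
  then show ?thesis using assms by (simp add: E_def seminorm_def)
qed

lemma not_ae_eq_const:
  assumes u: "u \<in> K" "0 < E u" and c: "W c = 0" "\<bar>c\<bar> \<le> 1" shows "\<not> ae_eq \<Omega> u (\<lambda>_. c)"
proof
  assume "ae_eq \<Omega> u (\<lambda>_. c)"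
  then have d: "L1_dist M (\<lambda>_. c) u = 0" using ae_eq_L1_dist[of u "\<lambda>_. c"] by (simp add: abs_minus_commute)
  have cK: "(\<lambda>_. c) \<in> K" using H_space_const c(2) by (simp add: K_def unit_functions_def)
  have "E u \<le> E (\<lambda>_. c)"
    by (rule E_lsc(2)[of "\<lambda>_ _. c"]) (use cK K_D u d in auto)
  then show False using E_const_zero[OF c(1)] u(2) by simp
qed

end

theorem theorem3p1:
  fixes s :: real and \<Omega> :: "'a::euclidean_space set" and W :: "real \<Rightarrow> real"
  assumes "0 < s" and "s < 1"
    and "smooth_bounded_domain \<Omega>"
    and "\<And>t. 0 \<le> W t"
    and "\<And>t. W (- t) = W t"
    and "C_k 2 W"
    and "W 1 = 0" and "W (-1) = 0"
    and "\<And>t. -1 < t \<Longrightarrow> t < 1 \<Longrightarrow> 0 < W t"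
    and "deriv W 1 = 0" and "deriv W (-1) = 0"
    and "0 < deriv (deriv W) 1" and "0 < deriv (deriv W) (-1)"
  shows "\<exists>(eps :: nat \<Rightarrow> real) (c :: nat \<Rightarrow> real).
    (\<forall>k\<ge>1. 0 < eps k \<and> 0 < c k \<and> (s = 1/2 \<longrightarrow> eps k \<le> 1)) \<and>
    (\<forall>k\<ge>1. \<forall>\<epsilon>. 0 < \<epsilon> \<and> \<epsilon> < eps k \<longrightarrow>
      (\<exists>u :: nat \<Rightarrow> 'a \<Rightarrow> real.
        (\<forall>i\<in>{1..k}.
           critical_point s W \<Omega> \<epsilon> (u i) \<and>
           critical_point s W \<Omega> \<epsilon> (\<lambda>x. - u i x) \<and>
           \<not> ae_eq \<Omega> (u i) (\<lambda>x. - u i x) \<and>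
           \<not> ae_eq \<Omega> (u i) (\<lambda>x. 1) \<and>
           \<not> ae_eq \<Omega> (u i) (\<lambda>x. -1) \<and>
           (AE x in dom_measure \<Omega>. -1 \<le> u i x \<and> u i x \<le> 1) \<and>
           energy s W \<Omega> \<epsilon> (u i) \<le> ennreal (c k)) \<and>
        (\<forall>i\<in>{1..k}. \<forall>j\<in>{1..k}. i \<noteq> j \<longrightarrow>
           \<not> ae_eq \<Omega> (u i) (u j) \<and> \<not> ae_eq \<Omega> (u i) (\<lambda>x. - u j x)) \<and>
        (\<exists>w\<in>zero_mean_class s \<Omega>.
           (\<forall>v\<in>zero_mean_class s \<Omega>. energy s W \<Omega> \<epsilon> w \<le> energy s W \<Omega> \<epsilon> v) \<and>
           (\<forall>i\<in>{1..k}. energy s W \<Omega> \<epsilon> w \<le> energy s W \<Omega> \<epsilon> (u i)))))"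
proof -
  note s = assms(1,2) and C2 = assms(6) and W1 = assms(7,8)
  interpret bounded_open_set \<Omega>
    by unfold_locales (use assms(3) in \<open>auto simp: smooth_bounded_domain_def\<close>)
  obtain L where L: "0 \<le> L"
    "\<And>a b. \<bar>a\<bar> \<le> 1 \<Longrightarrow> \<bar>b\<bar> \<le> 1 \<Longrightarrow> W ((a + b) / 2) \<le> (W a + W b) / 2 + L / 8 * (a - b)\<^sup>2"
    "\<And>a h. \<bar>a\<bar> \<le> 1 \<Longrightarrow> W (clip (a + h)) \<le> W a + deriv W a * h + L * h\<^sup>2"
    using second_order_bounds[OF C2 assms(10,11)] by blast
  have cont: "continuous_on UNIV W" "continuous_on UNIV (deriv W)"
    using C_2_real(1,2)[OF C2] by (auto intro!: continuous_at_imp_continuous_on DERIV_isCont)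
  have DW: "double_well \<Omega> s (coeff_A s \<epsilon>) (coeff_B s \<epsilon>) L W" if "0 < \<epsilon>" "\<epsilon> \<le> 1/2" for \<epsilon>
    by unfold_locales (use s coeff_A_pos[OF that] coeff_B_pos[OF that] L cont assms(4,5) in auto)
  interpret D0: double_well \<Omega> s "coeff_A s (1/2)" "coeff_B s (1/2)" L W by (rule DW) auto
  obtain Wm where Wm: "\<And>t. \<bar>t\<bar> \<le> 1 \<Longrightarrow> \<bar>W t\<bar> \<le> Wm" using D0.W_bounded by blast
  have Wm': "W t \<le> Wm" if "\<bar>t\<bar> \<le> 1" for t using Wm[OF that] by simp
  have Wm0: "0 \<le> Wm" using Wm'[of 1] W1 by simp
  obtain C where C: "0 \<le> C" "\<And>\<epsilon> k F. 0 < \<epsilon> \<Longrightarrow> \<epsilon> \<le> 1/2 \<Longrightarrow> zigzag lo hi k F \<Longrightarrow>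
     test_fun \<epsilon> F \<in> H_space s \<Omega> \<and>
     coeff_A s \<epsilon> * seminorm s (test_fun \<epsilon> F) + coeff_B s \<epsilon> * (\<integral>x. W (test_fun \<epsilon> F x) \<partial>M) \<le> real k * C"
    using test_fun_energy[OF s D0.W_measurable(1) W1 Wm' Wm0 assms(4)] by blast
  have W0: "0 < W 0" using assms(9)[of 0] by simp
  define c where "c k = real k * C + 1" for k :: nat
  have c: "0 < c k" for k using C(1) by (simp add: c_def add_nonneg_pos)
  have "\<exists>\<epsilon>0>0. \<forall>\<epsilon>. 0 < \<epsilon> \<and> \<epsilon> < \<epsilon>0 \<longrightarrow> c k / (W 0 * volume) < coeff_B s \<epsilon>" for k
    by (rule coeff_B_unbounded[OF s(1)])
  then obtain \<epsilon>0 where \<epsilon>0: "\<And>k. 0 < \<epsilon>0 k" "\<And>k \<epsilon>. 0 < \<epsilon> \<Longrightarrow> \<epsilon> < \<epsilon>0 k \<Longrightarrow> c k / (W 0 * volume) < coeff_B s \<epsilon>"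
    by metis
  \<comment> \<open>The bound by \<open>1/2\<close> keeps \<open>ln \<epsilon>\<close> away from \<open>0\<close>; the other one excludes the function \<open>0\<close> from the sublevel set.\<close>
  define eps where "eps k = min (1/2) (\<epsilon>0 k)" for k
  have main: "\<exists>u :: nat \<Rightarrow> 'a \<Rightarrow> real.
        (\<forall>i\<in>{1..k}.
           critical_point s W \<Omega> \<epsilon> (u i) \<and>
           critical_point s W \<Omega> \<epsilon> (\<lambda>x. - u i x) \<and>
           \<not> ae_eq \<Omega> (u i) (\<lambda>x. - u i x) \<and>
           \<not> ae_eq \<Omega> (u i) (\<lambda>x. 1) \<and>
           \<not> ae_eq \<Omega> (u i) (\<lambda>x. -1) \<and>
           (AE x in dom_measure \<Omega>. -1 \<le> u i x \<and> u i x \<le> 1) \<and>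
           energy s W \<Omega> \<epsilon> (u i) \<le> ennreal (c k)) \<and>
        (\<forall>i\<in>{1..k}. \<forall>j\<in>{1..k}. i \<noteq> j \<longrightarrow>
           \<not> ae_eq \<Omega> (u i) (u j) \<and> \<not> ae_eq \<Omega> (u i) (\<lambda>x. - u j x)) \<and>
        (\<exists>w\<in>zero_mean_class s \<Omega>.
           (\<forall>v\<in>zero_mean_class s \<Omega>. energy s W \<Omega> \<epsilon> w \<le> energy s W \<Omega> \<epsilon> v) \<and>
           (\<forall>i\<in>{1..k}. energy s W \<Omega> \<epsilon> w \<le> energy s W \<Omega> \<epsilon> (u i)))"
    (is "?sol k \<epsilon>") if \<epsilon>: "0 < \<epsilon>" "\<epsilon> < eps k" for k \<epsilon>
  proof -
    have \<epsilon>2: "\<epsilon> \<le> 1/2" "\<epsilon> < \<epsilon>0 k" using \<epsilon> by (auto simp: eps_def)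
    interpret D: double_well \<Omega> s "coeff_A s \<epsilon>" "coeff_B s \<epsilon>" L W by (rule DW[OF \<epsilon>(1) \<epsilon>2(1)])
    have test: "test_fun \<epsilon> F \<in> D.K \<and> D.E (test_fun \<epsilon> F) \<le> c k" if "d \<le> k" "zigzag lo hi d F" for d F
    proof -
      have "real d * C \<le> real k * C" using that(1) C(1) by (intro mult_right_mono) auto
      then show ?thesis
        using C(2)[OF \<epsilon>(1) \<epsilon>2(1) that(2)] test_fun_unit[OF that(2) \<epsilon>(1)] by (simp add: D.K_def D.E_def c_def)
    qed
    have zero: "c k < coeff_B s \<epsilon> * W 0 * volume"
      using \<epsilon>0(2)[OF \<epsilon>(1) \<epsilon>2(2)] W0 volume_pos by (simp add: field_simps)
    obtain w where w: "w \<in> D.K" "(\<integral>x. w x \<partial>M) = 0"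
      "\<And>v. v \<in> D.K \<Longrightarrow> (\<integral>x. v x \<partial>M) = 0 \<Longrightarrow> D.E w \<le> D.E v"
      using D.zero_mean_minimizer by blast
    have Ew: "0 < D.E w" by (rule D.E_pos_of_zero_mean[OF w(1,2) W0])
    have \<epsilon>1: "\<epsilon> \<le> 1" using \<epsilon>2(1) by simp
    obtain P where P0: "finite P \<and> card P = k \<and>
     (\<forall>p\<in>P. p \<in> D.K \<and> D.E p \<le> c k \<and> D.E w \<le> D.E p \<and> 0 < L1_dist M p (\<lambda>x. - p x) \<and>
        (\<forall>v\<in>H_space s \<Omega>. 2 * coeff_A s \<epsilon> * frac_form s \<Omega> p v + coeff_B s \<epsilon> * (\<integral>x. deriv W (p x) * v x \<partial>M) = 0) \<and>
        (\<forall>v\<in>H_space s \<Omega>. 2 * coeff_A s \<epsilon> * frac_form s \<Omega> (\<lambda>x. - p x) v + coeff_B s \<epsilon> * (\<integral>x. deriv W (- p x) * v x \<partial>M) = 0)) \<and>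
     (\<forall>p\<in>P. \<forall>q\<in>P. p \<noteq> q \<longrightarrow> 0 < L1_dist M p q \<and> 0 < L1_dist M p (\<lambda>x. - q x))"
      using D.many_critical_points[OF test \<epsilon>(1) \<epsilon>1 zero w(1) w(3)] by (rule exE)
    have P: "finite P" "card P = k"
      and PK: "\<And>p. p \<in> P \<Longrightarrow> p \<in> D.K \<and> D.E p \<le> c k \<and> D.E w \<le> D.E p \<and> 0 < L1_dist M p (\<lambda>x. - p x)"
      and crit: "\<And>p v. p \<in> P \<Longrightarrow> v \<in> H_space s \<Omega> \<Longrightarrow>
         2 * coeff_A s \<epsilon> * frac_form s \<Omega> p v + coeff_B s \<epsilon> * (\<integral>x. deriv W (p x) * v x \<partial>M) = 0"
      and crit_neg: "\<And>p v. p \<in> P \<Longrightarrow> v \<in> H_space s \<Omega> \<Longrightarrow>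
         2 * coeff_A s \<epsilon> * frac_form s \<Omega> (\<lambda>x. - p x) v + coeff_B s \<epsilon> * (\<integral>x. deriv W (- p x) * v x \<partial>M) = 0"
      and sep: "\<And>p q. p \<in> P \<Longrightarrow> q \<in> P \<Longrightarrow> p \<noteq> q \<Longrightarrow> 0 < L1_dist M p q \<and> 0 < L1_dist M p (\<lambda>x. - q x)"
      using P0 by simp_all
    obtain u where u: "bij_betw u {1..k} P"
      using finite_same_card_bij[of "{1..k}" P] P by auto
    have uP: "u i \<in> P" if "i \<in> {1..k}" for i using u that by (auto dest: bij_betwE)
    have energy: "energy s W \<Omega> \<epsilon> v = ennreal (D.E v)" if "v \<in> D.K" for v by (rule D.energy_eq[OF that refl refl])
    have wZ: "w \<in> zero_mean_class s \<Omega>"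
      using w D.K_D[OF w(1)] unfolding zero_mean_class_def dom_M by (auto simp: unit_functions_def abs_le_iff minus_le_iff)
    have w_min: "energy s W \<Omega> \<epsilon> w \<le> energy s W \<Omega> \<epsilon> v" if "v \<in> zero_mean_class s \<Omega>" for v
    proof -
      have v: "v \<in> H_space s \<Omega>" "AE x in M. \<bar>v x\<bar> \<le> 1" "(\<integral>x. v x \<partial>M) = 0"
        using that unfolding zero_mean_class_def dom_M by (auto simp: abs_le_iff minus_le_iff)
      have [measurable]: "v \<in> borel_measurable M" using v(1) by (rule H_space_borel)
      have "(\<integral>x. clip (v x) \<partial>M) = (\<integral>x. v x \<partial>M)"
        by (rule integral_cong_AE) (use v(2) in \<open>auto simp: clip_props(4)\<close>)
      then have "D.E w \<le> D.E (\<lambda>x. clip (v x))" using w(3)[OF D.K_clip(1)[OF v(1)]] v(3) by simp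
      then have "energy s W \<Omega> \<epsilon> w \<le> energy s W \<Omega> \<epsilon> (\<lambda>x. clip (v x))"
        by (simp add: energy[OF w(1)] energy[OF D.K_clip(1)[OF v(1)]] ennreal_leI)
      also have "\<dots> \<le> energy s W \<Omega> \<epsilon> v" by (rule D.energy_clip_le[OF v(1,2)])
      finally show ?thesis .
    qed
    have K_AE: "AE x in M. \<bar>v x\<bar> \<le> 1" if "v \<in> D.K" for v
      using D.K_D(1)[OF that] by (auto simp: unit_functions_def)
    have not_ae: "\<not> ae_eq \<Omega> v v'" if "0 < L1_dist M v v'" for v v' using that ae_eq_L1_dist[of v v'] by auto
    show ?thesis
    proof (intro exI[of _ u] conjI ballI impI bexI[OF _ wZ])
      fix i assume i: "i \<in> {1..k}"
      note Pi = PK[OF uP[OF i]]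
      have K: "u i \<in> D.K" using Pi by blast
      have E: "0 < D.E (u i)" using Pi Ew by linarith
      show "critical_point s W \<Omega> \<epsilon> (u i)"
        unfolding critical_point_def dom_M using D.K_D(2)[OF K] K_AE[OF K] crit[OF uP[OF i]] by blast
      show "critical_point s W \<Omega> \<epsilon> (\<lambda>x. - u i x)"
        unfolding critical_point_def dom_M using D.K_D(2)[OF D.K_uminus[OF K]] K_AE[OF D.K_uminus[OF K]] crit_neg[OF uP[OF i]] by blast
      show "\<not> ae_eq \<Omega> (u i) (\<lambda>x. - u i x)" by (rule not_ae) (use Pi in blast)
      show "\<not> ae_eq \<Omega> (u i) (\<lambda>x. 1)" by (rule D.not_ae_eq_const[OF K E]) (use W1 in simp_all)
      show "\<not> ae_eq \<Omega> (u i) (\<lambda>x. -1)" by (rule D.not_ae_eq_const[OF K E]) (use W1 in simp_all)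
      show "AE x in dom_measure \<Omega>. -1 \<le> u i x \<and> u i x \<le> 1"
        unfolding dom_M using K_AE[OF K] by eventually_elim (auto simp: abs_le_iff)
      show "energy s W \<Omega> \<epsilon> (u i) \<le> ennreal (c k)" using Pi by (simp add: energy[OF K] ennreal_leI)
      show "energy s W \<Omega> \<epsilon> w \<le> energy s W \<Omega> \<epsilon> (u i)" using Pi by (simp add: energy[OF K] energy[OF w(1)] ennreal_leI)
    next
      fix i j assume ij: "i \<in> {1..k}" "j \<in> {1..k}" "i \<noteq> j"
      have "u i \<noteq> u j" using inj_onD[OF bij_betw_imp_inj_on[OF u] _ ij(1,2)] ij(3) by blast
      from sep[OF uP[OF ij(1)] uP[OF ij(2)] this]
      show "\<not> ae_eq \<Omega> (u i) (u j)" "\<not> ae_eq \<Omega> (u i) (\<lambda>x. - u j x)" using not_ae by simp_all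
    next
      show "energy s W \<Omega> \<epsilon> w \<le> energy s W \<Omega> \<epsilon> v" if "v \<in> zero_mean_class s \<Omega>" for v by (rule w_min[OF that])
    qed
  qed
  have "\<forall>k\<ge>1. 0 < eps k \<and> 0 < c k \<and> (s = 1/2 \<longrightarrow> eps k \<le> 1)"
    using \<epsilon>0(1) c by (auto simp: eps_def)
  moreover have "\<forall>k\<ge>1. \<forall>\<epsilon>. 0 < \<epsilon> \<and> \<epsilon> < eps k \<longrightarrow> ?sol k \<epsilon>"
    by (intro allI impI, elim conjE) (rule main)
  ultimately show ?thesis by (intro exI[of _ eps] exI[of _ c] conjI)
qed

end
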